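(* Let $F\subset E$ and assume that, as $n\to\infty$: (1) $k_n\uparrow\infty$ and $n\nu_n\to\infty$; (2) $0<m\le M<+\infty$ and $\delta_n:=\max_{1\le r\le k_n}\nu_{n,r}(M_{n,r}-m_{n,r})=o(1/n)$; (3) for each $(x_1,\dots,x_p)\subset F$ there exists a covariance matrix $\Sigma_{(x_1,\dots,x_p)}=[\sigma(x_i,x_j)]_{1\le i,j\le p}$ in $\mathbb{R}^p$ such that for all $1\le i,j\le p$, $\sum_{r=1}^{k_n}w_{n,r}(x_i)w_{n,r}(x_j)\to\sigma(x_i,x_j)$; (4) for all $x\in F$, $\max_{1\le r\le k_n}|w_{n,r}(x)|\to 0$; (5) for all $x\in F$, $\left|\sum_{r=1}^{k_n}\nu_{n,r}\kappa_{n,r}(x)f_{n,r}-f(x)\right|=o\left(\kappa_n(x)/n\right)$; (6) for all $x\in F$, $\left(\sum_{r=1}^{k_n}|w_{n,r}(x)|\right)\max\left((n\delta_n)^2,\;n\nu_n\exp(-mcn\nu_n),\;\Delta_n\right)\to 0$. Let $\widehat a_n=\sum_{r=1}^{k_n}\nu_{n,r}\left(1+\frac1{N_{n,r}}\right)Y^*_{n,r}$ and $\widehat c_n=N_n(S)/(n\widehat a_n)$. Then for all $(x_1,\dots,x_p)\subset F$, $$\left\{\frac{n\widehat c_n}{\kappa_n(x_j)}\left(\widehat f_n(x_j)-f(x_j)\right):1\le j\le p\right\}\underset{\mathcal D}{\to}N\left(0,\Sigma_{(x_1,\dots,x_p)}\right)\quad\text{as } n\to\infty,$$ where $\underset{\mathcal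 D}{\to}$ denotes convergence in distribution and $N(0,\Sigma)$ is the centered Gaussian distribution in $\mathbb{R}^p$ with covariance matrix $\Sigma$.
   Context: $(E,\mathcal{E},\nu)$ is a probability space, $f:E\to\mathbb{R}^+$ is measurable, $S=\{(x,y)\in E\times\mathbb{R}:0\le y\le f(x)\}$, $c>0$ is a constant and $\lambda$ is Lebesgue measure on $\mathbb{R}^+$. For each $n\ge1$, $N_n$ is a Poisson point process on $E\times\mathbb{R}^+$ with intensity measure $nc(\nu\otimes\lambda)\mathbf{1}_S$, and $\{(X_{n,i},Y_{n,i}):1\le i\le N_n(S)\}$ is its set of points. $(k_n)$ is a sequence of positive integers and, for each $n$, $\{I_{n,r}:1\le r\le k_n\}$ is a measurable partition of $E$. Put $\nu_{n,r}=\nu(I_{n,r})>0$, $\nu_n=\min_{1\le r\le k_n}\nu_{n,r}$, $D_{n,r}=\{(x,y):x\in I_{n,r},\,0\le y\le f(x)\}$, $N_{n,r}=N_n(D_{n,r})$, and $Y^*_{n,r}=\max\{Y_{n,i}:(X_{n,i},Y_{n,i})\in D_{n,r}\}$ if $N_{n,r}\ne0$, $Y^*_{n,r}=0$ otherwise. The convention $0\times\infty=0$ is used, so $(1+1/N_{n,r})Y^*_{n,r}=0$ when $N_{n,r}=0$ (and $\widehat c_n=0$ when $N_n(S)=0$). Let $m=\sup\{\alpha>0:\nu(\{f<\alpha\})=0\}$ and $M=\inf\{\alpha>0:\nu(\{f>\alpha\})=0\}$ be the $\nu$-essential infimum and supremum of $f$; $m_{n,r}=\sup\{\alpha>0:\nu(\{f<\alpha\}\cap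 I_{n,r})=0\}$ and $M_{n,r}=\inf\{\alpha>0:\nu(\{f>\alpha\}\cap I_{n,r})=0\}$ those on $I_{n,r}$; $f_{n,r}=\nu_{n,r}^{-1}\int_{I_{n,r}}f\,d\nu$; $\Delta_n=\max_{1\le r\le k_n}(M_{n,r}-m_{n,r})$. $\kappa_{n,r}:E\to\mathbb{R}$ ($1\le r\le k_n$) are given (deterministic) weight functions, $\kappa_n(x)=\left(\sum_{r=1}^{k_n}\kappa_{n,r}^2(x)\right)^{1/2}$ (assumed positive for $x\in F$), $w_{n,r}(x)=\kappa_{n,r}(x)/\kappa_n(x)$. The estimator is $$\widehat f_n(x)=\sum_{r=1}^{k_n}\nu_{n,r}\kappa_{n,r}(x)\left(1+\frac1{N_{n,r}}\right)Y^*_{n,r},\quad x\in E.$$ *)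

theory Defs
  imports "HOL-Probability.Probability" "HOL-Library.Landau_Symbols"
begin

section \<open>Poisson point processes\<close>

definition poisson_point_process ::
  "'w measure \<Rightarrow> 'b measure \<Rightarrow> ('w \<Rightarrow> 'b measure) \<Rightarrow> bool" where
  "poisson_point_process P \<mu> N \<longleftrightarrow>
     (\<forall>\<omega>\<in>space P. sets (N \<omega>) = sets \<mu>) \<and>
     (\<forall>A\<in>sets \<mu>. (\<lambda>\<omega>. emeasure (N \<omega>) A) \<in> borel_measurable P) \<and>
     (\<forall>A\<in>sets \<mu>. emeasure \<mu> A < \<infinity> \<longrightarrow>
        (\<forall>j::nat. measure P {\<omega>\<in>space P. emeasure (N \<omega>) A = of_nat j} =
           exp (- measure \<mu> A) * measure \<mu> A ^ j / fact j)) \<and>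
     (\<forall>A\<in>sets \<mu>. emeasure \<mu> A = \<infinity> \<longrightarrow> (AE \<omega> in P. emeasure (N \<omega>) A = \<infinity>)) \<and>
     (\<forall>(q::nat) A. (\<forall>i<q. A i \<in> sets \<mu>) \<and> disjoint_family_on A {..<q} \<longrightarrow>
        prob_space.indep_vars P (\<lambda>_. borel) (\<lambda>i \<omega>. emeasure (N \<omega>) (A i)) {..<q})"

definition region_below :: "('a \<Rightarrow> real) \<Rightarrow> 'a set \<Rightarrow> ('a \<times> real) set" where
  "region_below f A = {(x, y). x \<in> A \<and> 0 \<le> y \<and> y \<le> f x}"

definition strip_intensity :: "'a measure \<Rightarrow> ('a \<Rightarrow> real) \<Rightarrow> real \<Rightarrow> ('a \<times> real) measure" where
  "strip_intensity \<nu> f \<theta> =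
     density (\<nu> \<Otimes>\<^sub>M restrict_space lborel {0..})
       (\<lambda>z. ennreal \<theta> * indicator (region_below f (space \<nu>)) z)"


section \<open>Essential bounds and averages over a cell\<close>

text \<open>
  The bounds are taken in \<^typ>\<open>ennreal\<close>, so that the infimum over the empty set is \<open>\<infinity>\<close> and the
  supremum of an unbounded set is \<open>\<infinity>\<close>.
\<close>

definition ess_inf_on :: "'a measure \<Rightarrow> ('a \<Rightarrow> real) \<Rightarrow> 'a set \<Rightarrow> ennreal" where
  "ess_inf_on \<nu> f A =
     Sup {ennreal \<alpha> | \<alpha>. 0 < \<alpha> \<and> emeasure \<nu> ({x \<in> space \<nu>. f x < \<alpha>} \<inter> A) = 0}"

definition ess_sup_on :: "'a measure \<Rightarrow> ('a \<Rightarrow> real) \<Rightarrow> 'a set \<Rightarrow> ennreal" where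
  "ess_sup_on \<nu> f A =
     Inf {ennreal \<alpha> | \<alpha>. 0 < \<alpha> \<and> emeasure \<nu> ({x \<in> space \<nu>. f x > \<alpha>} \<inter> A) = 0}"

definition ess_osc_on :: "'a measure \<Rightarrow> ('a \<Rightarrow> real) \<Rightarrow> 'a set \<Rightarrow> real" where
  "ess_osc_on \<nu> f A = enn2real (ess_sup_on \<nu> f A) - enn2real (ess_inf_on \<nu> f A)"

definition cell_mean :: "'a measure \<Rightarrow> ('a \<Rightarrow> real) \<Rightarrow> 'a set \<Rightarrow> real" where
  "cell_mean \<nu> f A = (LINT x:A|\<nu>. f x) / measure \<nu> A"


section \<open>Weights\<close>

definition weight_norm :: "nat \<Rightarrow> (nat \<Rightarrow> 'a \<Rightarrow> real) \<Rightarrow> 'a \<Rightarrow> real" where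
  "weight_norm k \<kappa> x = sqrt (\<Sum>r=1..k. (\<kappa> r x)\<^sup>2)"

definition norm_weight :: "nat \<Rightarrow> (nat \<Rightarrow> 'a \<Rightarrow> real) \<Rightarrow> nat \<Rightarrow> 'a \<Rightarrow> real" where
  "norm_weight k \<kappa> r x = \<kappa> r x / weight_norm k \<kappa> x"


section \<open>The estimators\<close>

text \<open>
  Here \<open>N\<close> is a realisation of the point process, with points \<open>(X i, Y i)\<close> for
  \<open>1 \<le> i \<le> K\<close>; \<open>I 1, \<dots>, I k\<close> is the partition.
\<close>

definition cell_max ::
  "('a \<Rightarrow> real) \<Rightarrow> ('a \<times> real) measure \<Rightarrow> nat \<Rightarrow> (nat \<Rightarrow> 'a) \<Rightarrow> (nat \<Rightarrow> real) \<Rightarrow> 'a set \<Rightarrow> real" where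
  "cell_max f N K X Y A =
     (if measure N (region_below f A) \<noteq> 0
      then Max {Y i | i. i \<in> {1..K} \<and> (X i, Y i) \<in> region_below f A} else 0)"

text \<open>
  On an empty cell the correction factor is \<open>1 + 1 / 0 = 1\<close> and the maximum is \<open>0\<close>, in accordance
  with \<open>0 \<times> \<infinity> = 0\<close>. Likewise \<open>intensity_estimator\<close> is \<open>0 / 0 = 0\<close> when there are no points.
\<close>

definition corrected_max ::
  "('a \<Rightarrow> real) \<Rightarrow> ('a \<times> real) measure \<Rightarrow> nat \<Rightarrow> (nat \<Rightarrow> 'a) \<Rightarrow> (nat \<Rightarrow> real) \<Rightarrow> 'a set \<Rightarrow> real" where
  "corrected_max f N K X Y A =
     (1 + 1 / measure N (region_below f A)) * cell_max f N K X Y A"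

definition edge_estimator ::
  "'a measure \<Rightarrow> ('a \<Rightarrow> real) \<Rightarrow> nat \<Rightarrow> (nat \<Rightarrow> 'a set) \<Rightarrow> (nat \<Rightarrow> 'a \<Rightarrow> real) \<Rightarrow>
   ('a \<times> real) measure \<Rightarrow> nat \<Rightarrow> (nat \<Rightarrow> 'a) \<Rightarrow> (nat \<Rightarrow> real) \<Rightarrow> 'a \<Rightarrow> real" where
  "edge_estimator \<nu> f k I \<kappa> N K X Y x =
     (\<Sum>r=1..k. measure \<nu> (I r) * \<kappa> r x * corrected_max f N K X Y (I r))"

definition area_estimator ::
  "'a measure \<Rightarrow> ('a \<Rightarrow> real) \<Rightarrow> nat \<Rightarrow> (nat \<Rightarrow> 'a set) \<Rightarrow>
   ('a \<times> real) measure \<Rightarrow> nat \<Rightarrow> (nat \<Rightarrow> 'a) \<Rightarrow> (nat \<Rightarrow> real) \<Rightarrow> real" where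
  "area_estimator \<nu> f k I N K X Y =
     (\<Sum>r=1..k. measure \<nu> (I r) * corrected_max f N K X Y (I r))"

definition intensity_estimator ::
  "'a measure \<Rightarrow> ('a \<Rightarrow> real) \<Rightarrow> nat \<Rightarrow> nat \<Rightarrow> (nat \<Rightarrow> 'a set) \<Rightarrow>
   ('a \<times> real) measure \<Rightarrow> nat \<Rightarrow> (nat \<Rightarrow> 'a) \<Rightarrow> (nat \<Rightarrow> real) \<Rightarrow> real" where
  "intensity_estimator \<nu> f n k I N K X Y =
     measure N (region_below f (space \<nu>)) / (real n * area_estimator \<nu> f k I N K X Y)"


section \<open>Centered Gaussian laws and convergence in distribution\<close>

definition covariance_matrix :: "'i set \<Rightarrow> ('i \<Rightarrow> 'i \<Rightarrow> real) \<Rightarrow> bool" where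
  "covariance_matrix J A \<longleftrightarrow>
     (\<forall>i\<in>J. \<forall>j\<in>J. A i j = A j i) \<and>
     (\<forall>t. 0 \<le> (\<Sum>i\<in>J. \<Sum>j\<in>J. t i * t j * A i j))"

text \<open>
  \<open>L\<close> is the law \<open>N(0, \<Sigma>)\<close>: every linear form \<open>z \<mapsto> t \<bullet> z\<close> is univariate centered
  Gaussian with variance \<open>t \<bullet> \<Sigma> t\<close>. The matrix may be singular, and the univariate law of variance
  \<open>0\<close> is the Dirac measure at \<open>0\<close>.
\<close>

definition centered_gaussian :: "real^'p^'p \<Rightarrow> (real^'p) measure \<Rightarrow> bool" where
  "centered_gaussian \<Sigma> L \<longleftrightarrow>
     prob_space L \<and> sets L = sets borel \<and>
     (\<forall>t. distr L borel (\<lambda>z. t \<bullet> z) =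
        (if t \<bullet> (\<Sigma> *v t) = 0 then return borel 0
         else density lborel (\<lambda>u. ennreal (normal_density 0 (sqrt (t \<bullet> (\<Sigma> *v t))) u))))"

text \<open>
  Measurability is required only for large \<open>n\<close>, since the sequences considered start at \<open>n = 1\<close>.
\<close>

definition converges_in_distribution ::
  "'w measure \<Rightarrow> (nat \<Rightarrow> 'w \<Rightarrow> 'b::topological_space) \<Rightarrow> 'b measure \<Rightarrow> bool" where
  "converges_in_distribution P V L \<longleftrightarrow>
     prob_space L \<and> sets L = sets borel \<and>
     (\<forall>\<^sub>F n in sequentially. V n \<in> borel_measurable P) \<and>
     (\<forall>g :: 'b \<Rightarrow> real. continuous_on UNIV g \<and> bounded (range g) \<longrightarrow>
        (\<lambda>n. \<integral>\<omega>. g (V n \<omega>) \<partial>P) \<longlonglongrightarrow> (\<integral>z. g z \<partial>L))"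

end

theory Submission
  imports Defs
begin

text \<open>
  Fix \<open>n\<close> and put \<open>\<theta> = n c\<close>. A cell \<open>A\<close> of the partition has intensity mass
  \<open>\<mu> = \<theta> \<integral>\<^sub>A f d\<nu>\<close>, of which \<open>\<Lambda>(y) = \<theta> \<integral>\<^sub>A min(f, y) d\<nu>\<close> lies below the level \<open>y\<close>. Let \<open>N\<close> be the
  number of points in the cell and \<open>Y*\<close> the height of the highest one. The event \<open>N = k, Y* \<le> y\<close> says that the part
  of the cell below \<open>y\<close> holds \<open>k\<close> points and the part above holds none, so it has probability
  \<open>exp(-\<mu>) \<Lambda>(y)^k / k!\<close>, and such events in disjoint cells are independent. Therefore the pairs
  \<open>(N, \<Lambda>(Y*))\<close> are independent over the cells, with a law that depends on \<open>\<mu>\<close> alone: given \<open>N = k\<close>, the variable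
  \<open>\<Lambda>(Y*) / \<mu>\<close> is the maximum of \<open>k\<close> uniform variables. The shape of \<open>f\<close> inside the cell has disappeared. The
  factor \<open>1 + 1/k\<close> is the one that makes that maximum unbiased, so the deviation \<open>Z = (1 + 1/N) \<Lambda>(Y*) - \<mu>\<close> has mean
  \<open>-\<mu> exp(-\<mu>)\<close> (the bias comes from empty cells only), second moment \<open>1 + O(1/\<mu>)\<close> and bounded
  third absolute moment. Hence its characteristic function is close to that of the standard normal law
  (\<open>deviation_char\<close>).

  The estimator contains \<open>\<theta> \<nu>(A) Y*\<close> in place of \<open>\<Lambda>(Y*)\<close>. The two agree unless a point lies above the essential
  infimum of \<open>f\<close> on \<open>A\<close>. That has probability at most \<open>d = \<theta> \<nu>(A) (sup\<^sub>A f - inf\<^sub>A f)\<close>, and then the difference is at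
  most \<open>d\<close>; since \<open>1 + 1/N \<le> 2\<close>, the error is at most \<open>2 d\<^sup>2\<close> in \<open>L\<^sup>1\<close> (\<open>residual_expectation\<close>). Being
  of second order in the oscillation, it disappears after summation against the weights by the
  condition on \<open>(n \<delta>\<^sub>n)\<^sup>2\<close>; the bias of empty cells disappears by the condition on
  \<open>n \<nu>\<^sub>n exp(-m c n \<nu>\<^sub>n)\<close>.

  What remains is a sum of independent deviations with weights \<open>w\<^sub>n\<^sub>,\<^sub>r(x)\<close> (up to the deterministic bias of the weights, which is negligible by assumption). For every linear form in the errors at the points \<open>x\<^sub>j\<close> the
  product of the characteristic functions converges to that of the Gaussian law (\<open>array_clt\<close>), because the largest weight tends to
  zero. The ratio of the estimated intensity to \<open>c\<close> tends to one in probability: its numerator is a Poisson variable with a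
  large mean, and the estimated area differs from \<open>\<integral> f d\<nu>\<close> by a sum of at most \<open>1/\<nu>\<^sub>n\<close> terms bounded in \<open>L\<^sup>1\<close>,
  divided by \<open>n c\<close>, where \<open>n \<nu>\<^sub>n\<close> tends to infinity. It therefore does not change the limit. Two facts of general use complete the argument: Levy's continuity theorem in
  Euclidean space (\<open>levy_continuity_euclidean\<close>) and the existence of the possibly singular Gaussian law
  (\<open>centered_gaussian_exists\<close>).
\<close>

section \<open>Levy continuity in Euclidean space\<close>

text \<open>
  Trigonometric polynomials in the form in which closure under products is a product-to-sum
  formula, and in which convergence of characteristic functions settles the convergence of integrals term by term.
\<close>
inductive trig_polynomial :: "('b::euclidean_space \<Rightarrow> real) \<Rightarrow> bool" where
  wave: "trig_polynomial (\<lambda>z. a * cos (t \<bullet> z + s))"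
| add: "trig_polynomial g \<Longrightarrow> trig_polynomial h \<Longrightarrow> trig_polynomial (\<lambda>z. g z + h z)"

lemma trig_polynomial_const: "trig_polynomial (\<lambda>z. a)"
  using trig_polynomial.wave[of a 0 0] by simp

lemma trig_polynomial_sum:
  "finite A \<Longrightarrow> (\<And>i. i \<in> A \<Longrightarrow> trig_polynomial (g i)) \<Longrightarrow> trig_polynomial (\<lambda>z. \<Sum>i\<in>A. g i z)"
  by (induction A rule: finite_induct) (auto intro: trig_polynomial_const trig_polynomial.add)

lemma trig_polynomial_mult:
  assumes "trig_polynomial g" "trig_polynomial h"
  shows "trig_polynomial (\<lambda>z. g z * h z)"
  using assms(1)
proof (induction rule: trig_polynomial.induct)
  case (wave a t s)
  from assms(2) show ?case
  proof (induction rule: trig_polynomial.induct)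
    case (wave a' t' s')
    have "trig_polynomial (\<lambda>z. (a * a' / 2) * cos ((t - t') \<bullet> z + (s - s')) +
        (a * a' / 2) * cos ((t + t') \<bullet> z + (s + s')))"
      by (intro trig_polynomial.intros)
    moreover have "(\<lambda>z. a * cos (t \<bullet> z + s) * (a' * cos (t' \<bullet> z + s'))) =
      (\<lambda>z. (a * a' / 2) * cos ((t - t') \<bullet> z + (s - s')) + (a * a' / 2) * cos ((t + t') \<bullet> z + (s + s')))"
    proof
      fix z
      have "cos (t \<bullet> z + s) * cos (t' \<bullet> z + s') =
        (cos ((t - t') \<bullet> z + (s - s')) + cos ((t + t') \<bullet> z + (s + s'))) / 2"
      proof -
        have "(t - t') \<bullet> z + (s - s') = (t \<bullet> z + s) - (t' \<bullet> z + s')"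
          "(t + t') \<bullet> z + (s + s') = (t \<bullet> z + s) + (t' \<bullet> z + s')"
          by (simp_all add: inner_diff_left inner_add_left)
        then show ?thesis using cos_times_cos[of "t \<bullet> z + s" "t' \<bullet> z + s'"] by metis
      qed
      then show "a * cos (t \<bullet> z + s) * (a' * cos (t' \<bullet> z + s')) = (a * a' / 2) * cos ((t - t') \<bullet> z + (s - s')) + (a * a' / 2) * cos ((t + t') \<bullet> z + (s + s'))"
        by (simp add: field_simps)
    qed
    ultimately show ?case by simp
  next
    case (add g h)
    then show ?case using trig_polynomial.add by (fastforce simp: algebra_simps)
  qed
next
  case (add g h')
  then show ?case using trig_polynomial.add by (fastforce simp: algebra_simps)
qed

lemma trig_polynomial_continuous: "trig_polynomial h \<Longrightarrow> continuous_on UNIV h"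
  by (induction rule: trig_polynomial.induct) (auto intro!: continuous_intros)

lemma trig_polynomial_bounded: "trig_polynomial h \<Longrightarrow> \<exists>B. \<forall>z. \<bar>h z\<bar> \<le> B"
proof (induction rule: trig_polynomial.induct)
  case (wave a t s)
  have "\<bar>a * cos (t \<bullet> z + s)\<bar> \<le> \<bar>a\<bar>" for z
    by (simp add: abs_mult mult_left_le)
  then show ?case by blast
next
  case (add g h)
  then obtain B C where "\<forall>z. \<bar>g z\<bar> \<le> B" "\<forall>z. \<bar>h z\<bar> \<le> C" by blast
  then have "\<forall>z. \<bar>g z + h z\<bar> \<le> B + C" by (meson abs_triangle_ineq add_mono order_trans)
  then show ?case by blast
qed

text \<open>
  The sine of a coordinate is a cosine with a shifted phase, hence a wave; products of waves are sums of waves.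
\<close>
lemma trig_polynomial_of_polynomial:
  fixes p :: "'b::euclidean_space \<Rightarrow> real"
  assumes "real_polynomial_function p"
  shows "trig_polynomial (\<lambda>z. p (\<Sum>b\<in>Basis. sin ((z \<bullet> b) / s) *\<^sub>R b))"
  using assms
proof (induction rule: real_polynomial_function.induct)
  case (linear l)
  have "trig_polynomial (\<lambda>z::'b. \<Sum>b\<in>Basis. l b * cos ((b /\<^sub>R s) \<bullet> z + (- (pi / 2))))"
    by (intro trig_polynomial_sum trig_polynomial.wave) auto
  moreover have "l (\<Sum>b\<in>Basis. sin ((z \<bullet> b) / s) *\<^sub>R b) =
      (\<Sum>b\<in>Basis. l b * cos ((b /\<^sub>R s) \<bullet> z + (- (pi / 2))))" for z
  proof -
    interpret bounded_linear l by fact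
    have "sin ((z \<bullet> b) / s) = cos ((b /\<^sub>R s) \<bullet> z + (- (pi / 2)))" for b
    proof -
      have "(b /\<^sub>R s) \<bullet> z = (z \<bullet> b) / s" by (simp add: inner_commute divide_inverse mult.commute)
      moreover have "cos (y + (- (pi / 2))) = sin y" for y :: real by (simp only: cos_add) simp
      ultimately show ?thesis by metis
    qed
    then show ?thesis by (simp add: sum scaleR mult.commute)
  qed
  ultimately show ?case by simp
qed (auto intro: trig_polynomial_const trig_polynomial.add trig_polynomial_mult)

text \<open>
  Read \<open>z\<close> through the coordinates \<open>sin(z\<^sub>b / R)\<close>, which stay in a compact cube. On the box of radius \<open>R\<close>
  they determine \<open>z\<close> by the arcsine, so \<open>g\<close> is there a continuous function \<open>G\<close> of them; Stone and Weierstrass approximate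
  \<open>G\<close> by a polynomial on the cube. The result is close to a periodic modification of \<open>g\<close> on the whole space, which gives the global
  bound \<open>B + e\<close>. Such a bound is what makes the approximation usable outside the box.
\<close>
lemma trig_polynomial_approximation:
  fixes g :: "'b::euclidean_space \<Rightarrow> real"
  assumes g: "continuous_on UNIV g" and B: "\<And>z. \<bar>g z\<bar> \<le> B" and "0 < e" "0 < R"
  obtains h where "trig_polynomial h" "\<And>z. \<bar>h z\<bar> \<le> B + e"
    "\<And>z. (\<And>b. b \<in> Basis \<Longrightarrow> \<bar>z \<bullet> b\<bar> \<le> R) \<Longrightarrow> \<bar>g z - h z\<bar> < e"
proof -
  define G where "G u = g (\<Sum>b\<in>Basis. (R * arcsin (u \<bullet> b)) *\<^sub>R b)" for u :: 'b
  have "continuous_on (cbox (- One) One) G"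
    unfolding G_def
    by (intro continuous_on_compose2[OF g] continuous_intros) (auto simp: mem_box algebra_simps)
  then obtain p where p: "real_polynomial_function p"
    "\<And>u. u \<in> cbox (- One) One \<Longrightarrow> \<bar>G u - p u\<bar> < e"
    using Stone_Weierstrass_real_polynomial_function[OF compact_cbox _ \<open>0 < e\<close>] by blast
  define S where "S z = (\<Sum>b\<in>Basis. sin ((z \<bullet> b) / R) *\<^sub>R b)" for z :: 'b
  have S_in: "S z \<in> cbox (- One) One" for z
    by (auto simp: S_def mem_box)
  have close: "\<bar>G (S z) - p (S z)\<bar> < e" for z using p(2) S_in by blast
  show thesis
  proof
    show "trig_polynomial (\<lambda>z. p (S z))"
      unfolding S_def by (rule trig_polynomial_of_polynomial[OF p(1)])
    show "\<bar>p (S z)\<bar> \<le> B + e" for z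
      using close[of z] B[of "\<Sum>b\<in>Basis. (R * arcsin (S z \<bullet> b)) *\<^sub>R b"] unfolding G_def by linarith
    show "\<bar>g z - p (S z)\<bar> < e" if z: "\<And>b. b \<in> Basis \<Longrightarrow> \<bar>z \<bullet> b\<bar> \<le> R" for z
    proof -
      have "R * arcsin (S z \<bullet> b) = z \<bullet> b" if b: "b \<in> Basis" for b
      proof -
        have "\<bar>(z \<bullet> b) / R\<bar> \<le> 1" using z[OF b] \<open>0 < R\<close> by simp
        then have "arcsin (sin ((z \<bullet> b) / R)) = (z \<bullet> b) / R"
          using pi_gt3 by (intro arcsin_sin) linarith+
        then show ?thesis using b \<open>0 < R\<close> by (simp add: S_def)
      qed
      then have "(\<Sum>b\<in>Basis. (R * arcsin (S z \<bullet> b)) *\<^sub>R b) = (\<Sum>b\<in>Basis. (z \<bullet> b) *\<^sub>R b)"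
        by simp
      then have "G (S z) = g z" by (simp add: G_def euclidean_representation)
      then show ?thesis using close[of z] by simp
    qed
  qed
qed

text \<open>
  The one-dimensional continuity theorem gives weak convergence; integrating a continuous function that vanishes near
  the origin and is \<open>1\<close> far from it turns this into a uniform bound on the tails.
\<close>
lemma tight_of_char_convergence:
  fixes V :: "nat \<Rightarrow> 'w \<Rightarrow> real" and L :: "real measure"
  assumes P: "prob_space P" and L: "prob_space L" "sets L = sets borel"
    and meas: "\<forall>\<^sub>F n in sequentially. V n \<in> borel_measurable P"
    and conv: "\<And>t. (\<lambda>n. CLINT \<omega>|P. iexp (t * V n \<omega>)) \<longlonglongrightarrow> (CLINT z|L. iexp (t * z))"
    and "0 < e"
  obtains R where "0 < R" "\<forall>\<^sub>F n in sequentially. measure P {\<omega>\<in>space P. R < \<bar>V n \<omega>\<bar>} < e"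
    "measure L {z. R < \<bar>z\<bar>} < e"
proof -
  interpret P: prob_space P by fact
  interpret L: real_distribution L
    using L by (simp add: real_distribution_def real_distribution_axioms_def)
  obtain n0 where n0: "\<And>n. n0 \<le> n \<Longrightarrow> V n \<in> borel_measurable P"
    using meas by (auto simp: eventually_sequentially)
  define D where "D n = distr P borel (V (n + n0))" for n
  have V[measurable]: "V (n + n0) \<in> borel_measurable P" for n using n0 by simp
  have rd: "real_distribution (D n)" for n unfolding D_def by (rule P.real_distribution_distr) simp
  have "weak_conv_m D L"
  proof (rule levy_continuity[OF rd L.real_distribution_axioms])
    fix t
    have "char (D n) t = (CLINT \<omega>|P. iexp (t * V (n + n0) \<omega>))" for n
      unfolding D_def char_def by (subst integral_distr) auto
    then show "(\<lambda>n. char (D n) t) \<longlonglongrightarrow> char L t"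
      using LIMSEQ_ignore_initial_segment[OF conv[of t], of n0] by (simp add: char_def)
  qed
  have "(\<lambda>R. measure L {z. real R < \<bar>z\<bar>}) \<longlonglongrightarrow> measure L (\<Inter>R. {z. real R < \<bar>z\<bar>})"
    by (intro L.finite_Lim_measure_decseq) (auto simp: decseq_def intro: order_le_less_trans)
  moreover have "(\<Inter>R. {z::real. real R < \<bar>z\<bar>}) = {}"
  proof -
    have "\<exists>n. \<not> real n < \<bar>z\<bar>" for z :: real
      using reals_Archimedean2[of "\<bar>z\<bar>"] by (metis less_asym)
    then show ?thesis by auto
  qed
  ultimately have "(\<lambda>R. measure L {z. real R < \<bar>z\<bar>}) \<longlonglongrightarrow> 0" by simp
  then have "\<forall>\<^sub>F R in sequentially. measure L {z. real R < \<bar>z\<bar>} < e / 2"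
    using \<open>0 < e\<close> by (intro order_tendstoD) auto
  then obtain R :: nat where R: "measure L {z. real R < \<bar>z\<bar>} < e / 2"
    by (auto simp: eventually_sequentially)
  define h where "h z = min 1 (max 0 (\<bar>z\<bar> - real R))" for z :: real
  have h_cont: "isCont h z" for z unfolding h_def by (intro continuous_intros)
  have h_bd: "norm (h z) \<le> 1" for z unfolding h_def by auto
  have hm[measurable]: "h \<in> borel_measurable borel" unfolding h_def by measurable
  have lim: "(\<lambda>n. \<integral>z. h z \<partial>D n) \<longlonglongrightarrow> (\<integral>z. h z \<partial>L)"
    by (rule weak_conv_imp_integral_bdd_continuous_conv[OF rd L.real_distribution_axioms \<open>weak_conv_m D L\<close> h_cont h_bd])
  have "(\<integral>z. h z \<partial>L) \<le> (\<integral>z. indicator {z. real R < \<bar>z\<bar>} z \<partial>L)"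
    by (intro integral_mono L.integrable_const_bound[where B=1])
       (auto simp: h_def split: split_indicator)
  also have "\<dots> = measure L {z. real R < \<bar>z\<bar>}" by simp
  finally have "(\<integral>z. h z \<partial>L) < e" using R \<open>0 < e\<close> by linarith
  with lim have "\<forall>\<^sub>F n in sequentially. (\<integral>z. h z \<partial>D n) < e" by (rule order_tendstoD)
  moreover have "measure P {\<omega>\<in>space P. real R + 1 < \<bar>V (n + n0) \<omega>\<bar>} \<le> (\<integral>z. h z \<partial>D n)" for n
  proof -
    have "measure P {\<omega>\<in>space P. real R + 1 < \<bar>V (n + n0) \<omega>\<bar>} =
        (\<integral>\<omega>. indicator {\<omega>\<in>space P. real R + 1 < \<bar>V (n + n0) \<omega>\<bar>} \<omega> \<partial>P)"
      by (simp add: Int_def conj_commute)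
    also have "\<dots> \<le> (\<integral>\<omega>. h (V (n + n0) \<omega>) \<partial>P)"
      by (intro integral_mono P.integrable_const_bound[where B=1])
         (auto simp: h_def split: split_indicator)
    also have "\<dots> = (\<integral>z. h z \<partial>D n)" unfolding D_def by (subst integral_distr) auto
    finally show ?thesis .
  qed
  ultimately have "\<forall>\<^sub>F n in sequentially. measure P {\<omega>\<in>space P. real R + 1 < \<bar>V (n + n0) \<omega>\<bar>} < e"
    by (auto elim!: eventually_mono intro: le_less_trans)
  then have "\<forall>\<^sub>F n in sequentially. measure P {\<omega>\<in>space P. real R + 1 < \<bar>V n \<omega>\<bar>} < e"
    by (subst (asm) eventually_sequentially_seg)
  moreover have "measure L {z. real R + 1 < \<bar>z\<bar>} < e"
  proof -
    have "measure L {z. real R + 1 < \<bar>z\<bar>} \<le> measure L {z. real R < \<bar>z\<bar>}"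
      by (intro L.finite_measure_mono) auto
    then show ?thesis using R \<open>0 < e\<close> by linarith
  qed
  ultimately show thesis by (intro that[of "real R + 1"]) auto
qed

lemma trig_polynomial_integral_convergence:
  fixes V :: "nat \<Rightarrow> 'w \<Rightarrow> 'b::euclidean_space"
  assumes P: "prob_space P" and L: "prob_space L" "sets L = sets borel"
    and meas: "\<forall>\<^sub>F n in sequentially. V n \<in> borel_measurable P"
    and conv: "\<And>t. (\<lambda>n. CLINT \<omega>|P. iexp (t \<bullet> V n \<omega>)) \<longlonglongrightarrow> (CLINT z|L. iexp (t \<bullet> z))"
    and h: "trig_polynomial h"
  shows "(\<lambda>n. \<integral>\<omega>. h (V n \<omega>) \<partial>P) \<longlonglongrightarrow> (\<integral>z. h z \<partial>L)"
proof -
  interpret P: prob_space P by fact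
  interpret L: prob_space L by fact
  note [measurable_cong] = L(2)
  from h show ?thesis
  proof (induction rule: trig_polynomial.induct)
    case (wave a t s)
    have eq: "a * cos (u + s) = Re (complex_of_real a * cis s * iexp u)" for u
    proof -
      have "complex_of_real a * cis s * iexp u = complex_of_real a * cis (s + u)"
        by (simp only: cis_conv_exp[symmetric] cis_mult mult.assoc)
      then have "Re (complex_of_real a * cis s * iexp u) = Re (complex_of_real a * cis (s + u))"
        by (rule arg_cong)
      also have "\<dots> = a * cos (u + s)" by (simp add: add.commute)
      finally show ?thesis by (rule sym)
    qed
    have int: "(\<integral>\<omega>. a * cos (t \<bullet> W \<omega> + s) \<partial>M) = Re (complex_of_real a * cis s * (CLINT \<omega>|M. iexp (t \<bullet> W \<omega>)))"
      if "prob_space M" "W \<in> borel_measurable M" for M :: "'c measure" and W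
    proof -
      interpret M: prob_space M by fact
      note [measurable] = that(2)
      have "integrable M (\<lambda>\<omega>. iexp (t \<bullet> W \<omega>))" by (intro M.integrable_const_bound[where B=1]) auto
      then show ?thesis unfolding eq by simp
    qed
    have "(\<lambda>n. Re (complex_of_real a * cis s * (CLINT \<omega>|P. iexp (t \<bullet> V n \<omega>)))) \<longlonglongrightarrow>
        Re (complex_of_real a * cis s * (CLINT z|L. iexp (t \<bullet> z)))"
      by (intro tendsto_intros conv)
    moreover have "\<forall>\<^sub>F n in sequentially. Re (complex_of_real a * cis s * (CLINT \<omega>|P. iexp (t \<bullet> V n \<omega>))) =
        (\<integral>\<omega>. a * cos (t \<bullet> V n \<omega> + s) \<partial>P)"
      using meas by eventually_elim (rule int[OF P, symmetric])
    ultimately have "(\<lambda>n. \<integral>\<omega>. a * cos (t \<bullet> V n \<omega> + s) \<partial>P) \<longlonglongrightarrow>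
        Re (complex_of_real a * cis s * (CLINT z|L. iexp (t \<bullet> z)))"
      by (rule Lim_transform_eventually)
    then show ?case using int[OF L(1), of "\<lambda>z. z"] by simp
  next
    case (add g h)
    have int: "integrable M (\<lambda>\<omega>. h (W \<omega>))"
      if "prob_space M" "W \<in> borel_measurable M" "trig_polynomial h" for M :: "'c measure" and W and h :: "'b \<Rightarrow> real"
    proof -
      interpret M: prob_space M by fact
      note [measurable] = that(2) borel_measurable_continuous_onI[OF trig_polynomial_continuous[OF that(3)]]
      from trig_polynomial_bounded[OF that(3)] obtain B where "\<forall>z. \<bar>h z\<bar> \<le> B" by blast
      then show ?thesis by (intro M.integrable_const_bound[where B=B]) auto
    qed
    have "(\<lambda>n. (\<integral>\<omega>. g (V n \<omega>) \<partial>P) + (\<integral>\<omega>. h (V n \<omega>) \<partial>P)) \<longlonglongrightarrow> (\<integral>z. g z \<partial>L) + (\<integral>z. h z \<partial>L)"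
      by (intro tendsto_add add.IH)
    moreover have "\<forall>\<^sub>F n in sequentially. (\<integral>\<omega>. g (V n \<omega>) \<partial>P) + (\<integral>\<omega>. h (V n \<omega>) \<partial>P) =
        (\<integral>\<omega>. g (V n \<omega>) + h (V n \<omega>) \<partial>P)"
      using meas by eventually_elim (simp add: int[OF P] add.hyps)
    ultimately have "(\<lambda>n. \<integral>\<omega>. g (V n \<omega>) + h (V n \<omega>) \<partial>P) \<longlonglongrightarrow> (\<integral>z. g z \<partial>L) + (\<integral>z. h z \<partial>L)"
      by (rule Lim_transform_eventually)
    moreover have "(\<integral>z. g z + h z \<partial>L) = (\<integral>z. g z \<partial>L) + (\<integral>z. h z \<partial>L)"
      using int[OF L(1), of "\<lambda>z. z"] add.hyps by (intro Bochner_Integration.integral_add) auto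
    ultimately show ?case by simp
  qed
qed

text \<open>
  Inside the box the error is at most \<open>e\<close>, outside it is at most \<open>2 B + e\<close>, and the outside is covered by one
  half-space pair for each coordinate.
\<close>
lemma expectation_approximation_on_box:
  fixes W :: "'w \<Rightarrow> 'b::euclidean_space" and g h :: "'b \<Rightarrow> real"
  assumes M: "prob_space M" and W[measurable]: "W \<in> borel_measurable M"
    and [measurable]: "g \<in> borel_measurable borel" "h \<in> borel_measurable borel"
    and g: "\<And>z. \<bar>g z\<bar> \<le> B" and h: "\<And>z. \<bar>h z\<bar> \<le> B + e" and "0 < e"
    and close: "\<And>z. (\<And>b. b \<in> Basis \<Longrightarrow> \<bar>z \<bullet> b\<bar> \<le> R) \<Longrightarrow> \<bar>g z - h z\<bar> < e"
  shows "\<bar>(\<integral>\<omega>. g (W \<omega>) \<partial>M) - (\<integral>\<omega>. h (W \<omega>) \<partial>M)\<bar> \<le>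
    e + (2 * B + e) * (\<Sum>b\<in>Basis. measure M {\<omega>\<in>space M. R < \<bar>W \<omega> \<bullet> b\<bar>})"
proof -
  interpret M: prob_space M by fact
  have B0: "0 \<le> B" using g[of 0] by linarith
  have int: "integrable M (\<lambda>\<omega>. g (W \<omega>))" "integrable M (\<lambda>\<omega>. h (W \<omega>))"
    using g h by (auto intro!: M.integrable_const_bound[where B="B + e"] AE_I2 simp: order_trans[OF g] \<open>0 < e\<close> less_imp_le)
  have "\<bar>(\<integral>\<omega>. g (W \<omega>) \<partial>M) - (\<integral>\<omega>. h (W \<omega>) \<partial>M)\<bar> = \<bar>\<integral>\<omega>. g (W \<omega>) - h (W \<omega>) \<partial>M\<bar>"
    using int by simp
  also have "\<dots> \<le> (\<integral>\<omega>. \<bar>g (W \<omega>) - h (W \<omega>)\<bar> \<partial>M)" by (rule integral_abs_bound)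
  also have "\<dots> \<le> (\<integral>\<omega>. e + (2 * B + e) * (\<Sum>b\<in>Basis. indicator {\<omega>\<in>space M. R < \<bar>W \<omega> \<bullet> b\<bar>} \<omega>) \<partial>M)"
  proof (rule integral_mono)
    show "integrable M (\<lambda>\<omega>. \<bar>g (W \<omega>) - h (W \<omega>)\<bar>)" using int by auto
    show "integrable M (\<lambda>\<omega>. e + (2 * B + e) * (\<Sum>b\<in>Basis. indicator {\<omega>\<in>space M. R < \<bar>W \<omega> \<bullet> b\<bar>} \<omega>))"
      by (intro Bochner_Integration.integrable_add integrable_mult_right Bochner_Integration.integrable_sum integrable_real_indicator)
         (auto simp: less_top[symmetric])
    fix \<omega> assume \<omega>: "\<omega> \<in> space M"
    show "\<bar>g (W \<omega>) - h (W \<omega>)\<bar> \<le> e + (2 * B + e) * (\<Sum>b\<in>Basis. indicator {\<omega>\<in>space M. R < \<bar>W \<omega> \<bullet> b\<bar>} \<omega>)"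
    proof (cases "\<forall>b\<in>Basis. \<bar>W \<omega> \<bullet> b\<bar> \<le> R")
      case True
      then have "\<bar>g (W \<omega>) - h (W \<omega>)\<bar> < e" using close by blast
      moreover have "0 \<le> (2 * B + e) * (\<Sum>b\<in>Basis. indicator {\<omega>\<in>space M. R < \<bar>W \<omega> \<bullet> b\<bar>} \<omega>)"
        using B0 \<open>0 < e\<close> by (intro mult_nonneg_nonneg sum_nonneg) auto
      ultimately show ?thesis by linarith
    next
      case False
      then obtain b where b: "b \<in> Basis" "R < \<bar>W \<omega> \<bullet> b\<bar>" by auto
      have "(1::real) = indicator {\<omega>\<in>space M. R < \<bar>W \<omega> \<bullet> b\<bar>} \<omega>" using b \<omega> by simp
      also have "\<dots> \<le> (\<Sum>b\<in>Basis. indicator {\<omega>\<in>space M. R < \<bar>W \<omega> \<bullet> b\<bar>} \<omega>)"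
        using b by (intro member_le_sum) auto
      finally have *: "(2 * B + e) * 1 \<le> (2 * B + e) * (\<Sum>b\<in>Basis. indicator {\<omega>\<in>space M. R < \<bar>W \<omega> \<bullet> b\<bar>} \<omega>)"
        using B0 \<open>0 < e\<close> by (intro mult_left_mono) auto
      have "\<bar>g (W \<omega>) - h (W \<omega>)\<bar> \<le> 2 * B + e" using g[of "W \<omega>"] h[of "W \<omega>"] by linarith
      also have "\<dots> = (2 * B + e) * 1" by simp
      also note *
      finally show ?thesis using \<open>0 < e\<close> by simp
    qed
  qed
  also have "\<dots> = e + (2 * B + e) * (\<Sum>b\<in>Basis. measure M {\<omega>\<in>space M. R < \<bar>W \<omega> \<bullet> b\<bar>})"
    by (subst Bochner_Integration.integral_add) (auto simp: Int_def conj_commute M.prob_space less_top[symmetric])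
  finally show ?thesis .
qed

text \<open>
  Each coordinate is tight by the one-dimensional theorem, so only a large box matters; on it a bounded continuous function is close to a
  trigonometric polynomial, whose integrals converge by assumption.
\<close>
theorem levy_continuity_euclidean:
  fixes V :: "nat \<Rightarrow> 'w \<Rightarrow> 'b::euclidean_space"
  assumes P: "prob_space P" and L: "prob_space L" "sets L = sets borel"
    and meas: "\<forall>\<^sub>F n in sequentially. V n \<in> borel_measurable P"
    and conv: "\<And>t. (\<lambda>n. CLINT \<omega>|P. iexp (t \<bullet> V n \<omega>)) \<longlonglongrightarrow> (CLINT z|L. iexp (t \<bullet> z))"
  shows "converges_in_distribution P V L"
  unfolding converges_in_distribution_def
proof (intro conjI allI impI L meas)
  fix g :: "'b \<Rightarrow> real" assume g: "continuous_on UNIV g \<and> bounded (range g)"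
  interpret L: prob_space L by fact
  note [measurable_cong] = L(2)
  note [measurable] = borel_measurable_continuous_onI[OF conjunct1[OF g]]
  obtain B where B: "\<And>z. \<bar>g z\<bar> \<le> B" using g by (auto simp: bounded_iff)
  have B0: "0 \<le> B" using B[of 0] by linarith
  \<comment> \<open>One error \<open>e\<close> for the convergence of the trigonometric integrals, and two box approximations.\<close>
  define C where "C = 3 + 2 * (2 * B + 1) * DIM('b)"
  have C0: "0 < C" using B0 by (simp add: C_def add_pos_nonneg)
  have main: "\<forall>\<^sub>F n in sequentially. \<bar>(\<integral>\<omega>. g (V n \<omega>) \<partial>P) - (\<integral>z. g z \<partial>L)\<bar> < C * e" if e: "0 < e" "e \<le> 1" for e
  proof -
    have ex: "\<exists>R>0. (\<forall>\<^sub>F n in sequentially. measure P {\<omega>\<in>space P. R < \<bar>V n \<omega> \<bullet> b\<bar>} < e) \<and>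
        measure L {z\<in>space L. R < \<bar>z \<bullet> b\<bar>} < e" for b
    proof -
      have pL: "prob_space (distr L borel (\<lambda>z. z \<bullet> b))" by (intro L.prob_space_distr) auto
      have mV: "\<forall>\<^sub>F n in sequentially. (\<lambda>\<omega>. V n \<omega> \<bullet> b) \<in> borel_measurable P"
        using meas by eventually_elim (intro borel_measurable_inner borel_measurable_const)
      have cV: "(\<lambda>n. CLINT \<omega>|P. iexp (t * (V n \<omega> \<bullet> b))) \<longlonglongrightarrow> (CLINT z|distr L borel (\<lambda>z. z \<bullet> b). iexp (t * z))" for t
      proof -
        have eq: "(t *\<^sub>R b) \<bullet> z = t * (z \<bullet> b)" for z :: 'b by (simp add: inner_commute)
        have "(CLINT z|distr L borel (\<lambda>z. z \<bullet> b). iexp (t * z)) = (CLINT z|L. iexp (t * (z \<bullet> b)))"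
          by (rule integral_distr) measurable
        then show ?thesis using conv[of "t *\<^sub>R b"] unfolding eq by (simp only:)
      qed
      obtain R where R: "0 < R" "\<forall>\<^sub>F n in sequentially. measure P {\<omega>\<in>space P. R < \<bar>V n \<omega> \<bullet> b\<bar>} < e"
        "measure (distr L borel (\<lambda>z. z \<bullet> b)) {z. R < \<bar>z\<bar>} < e"
        by (rule tight_of_char_convergence[OF P pL sets_distr mV cV e(1)])
      have "measure (distr L borel (\<lambda>z. z \<bullet> b)) {z. R < \<bar>z\<bar>} = measure L {z\<in>space L. R < \<bar>z \<bullet> b\<bar>}"
        by (subst measure_distr) (auto simp: vimage_def Int_def conj_commute)
      with R show ?thesis by (intro exI[of _ R]) simp
    qed
    define good where "good b R \<longleftrightarrow> 0 < R \<and>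
        (\<forall>\<^sub>F n in sequentially. measure P {\<omega>\<in>space P. R < \<bar>V n \<omega> \<bullet> b\<bar>} < e) \<and>
        measure L {z\<in>space L. R < \<bar>z \<bullet> b\<bar>} < e" for b :: 'b and R
    define R where "R b = (SOME R. good b R)" for b
    have "good b (R b)" for b
      unfolding R_def by (rule someI_ex) (unfold good_def, rule ex)
    then have R: "\<And>b. 0 < R b"
      "\<And>b. \<forall>\<^sub>F n in sequentially. measure P {\<omega>\<in>space P. R b < \<bar>V n \<omega> \<bullet> b\<bar>} < e"
      "\<And>b. measure L {z\<in>space L. R b < \<bar>z \<bullet> b\<bar>} < e"
      unfolding good_def by auto
    define R' where "R' = Max (R ` (Basis :: 'b set))"
    have R'_ge: "R b \<le> R'" if "b \<in> Basis" for b using that by (simp add: R'_def)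
    have R'_pos: "0 < R'" using R'_ge[OF SOME_Basis] R(1) by (rule less_le_trans[rotated])
    obtain h where h: "trig_polynomial h" "\<And>z. \<bar>h z\<bar> \<le> B + e"
      "\<And>z. (\<And>b. b \<in> Basis \<Longrightarrow> \<bar>z \<bullet> b\<bar> \<le> R') \<Longrightarrow> \<bar>g z - h z\<bar> < e"
      using trig_polynomial_approximation[OF conjunct1[OF g] B e(1) R'_pos] by blast
    note [measurable] = borel_measurable_continuous_onI[OF trig_polynomial_continuous[OF h(1)]]
    have close: "\<bar>(\<integral>\<omega>. g (W \<omega>) \<partial>M) - (\<integral>\<omega>. h (W \<omega>) \<partial>M)\<bar> \<le> e + (2 * B + 1) * DIM('b) * e"
      if M: "prob_space M" and W[measurable]: "W \<in> borel_measurable M"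
        and small: "\<And>b. b \<in> Basis \<Longrightarrow> measure M {\<omega>\<in>space M. R b < \<bar>W \<omega> \<bullet> b\<bar>} < e"
      for M :: "'c measure" and W
    proof -
      interpret M: prob_space M by fact
      have "\<bar>(\<integral>\<omega>. g (W \<omega>) \<partial>M) - (\<integral>\<omega>. h (W \<omega>) \<partial>M)\<bar> \<le>
          e + (2 * B + e) * (\<Sum>b\<in>Basis. measure M {\<omega>\<in>space M. R' < \<bar>W \<omega> \<bullet> b\<bar>})"
        by (rule expectation_approximation_on_box[OF M W _ _ B h(2) e(1) h(3)]) auto
      also have "\<dots> \<le> e + (2 * B + e) * (\<Sum>b\<in>(Basis::'b set). e)"
      proof (intro add_left_mono mult_left_mono)
        show "(\<Sum>b\<in>Basis. measure M {\<omega>\<in>space M. R' < \<bar>W \<omega> \<bullet> b\<bar>}) \<le> (\<Sum>b\<in>(Basis::'b set). e)"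
      proof (rule sum_mono)
        fix b :: 'b assume b: "b \<in> Basis"
        have "measure M {\<omega>\<in>space M. R' < \<bar>W \<omega> \<bullet> b\<bar>} \<le> measure M {\<omega>\<in>space M. R b < \<bar>W \<omega> \<bullet> b\<bar>}"
          using R'_ge[OF b] by (intro M.finite_measure_mono) auto
        then show "measure M {\<omega>\<in>space M. R' < \<bar>W \<omega> \<bullet> b\<bar>} \<le> e" using small[OF b] by linarith
        qed
        show "0 \<le> 2 * B + e" using B0 e by simp
      qed
      also have "e + (2 * B + e) * (\<Sum>b\<in>(Basis::'b set). e) \<le> e + (2 * B + 1) * DIM('b) * e"
      proof -
        have "(2 * B + e) * (DIM('b) * e) \<le> (2 * B + 1) * (DIM('b) * e)"
          using e by (intro mult_right_mono) auto
        then show ?thesis by (simp add: mult.assoc)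
      qed
      finally show ?thesis .
    qed
    have closeL: "\<bar>(\<integral>z. g z \<partial>L) - (\<integral>z. h z \<partial>L)\<bar> \<le> e + (2 * B + 1) * DIM('b) * e"
      using close[OF L(1), of "\<lambda>z. z"] R(3) by simp
    have "\<forall>\<^sub>F n in sequentially. \<forall>b\<in>(Basis::'b set). measure P {\<omega>\<in>space P. R b < \<bar>V n \<omega> \<bullet> b\<bar>} < e"
      by (intro eventually_ball_finite) (auto intro: R)
    moreover have "\<forall>\<^sub>F n in sequentially. \<bar>(\<integral>\<omega>. h (V n \<omega>) \<partial>P) - (\<integral>z. h z \<partial>L)\<bar> < e"
      using tendstoD[OF trig_polynomial_integral_convergence[OF P L meas conv h(1)] e(1)]
      by (simp add: dist_real_def)
    moreover note meas
    ultimately show ?thesis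
    proof eventually_elim
      case (elim n)
      have "\<bar>(\<integral>\<omega>. g (V n \<omega>) \<partial>P) - (\<integral>\<omega>. h (V n \<omega>) \<partial>P)\<bar> \<le> e + (2 * B + 1) * DIM('b) * e"
        using close[OF P elim(3)] elim(1) by simp
      with elim(2) closeL have "\<bar>(\<integral>\<omega>. g (V n \<omega>) \<partial>P) - (\<integral>z. g z \<partial>L)\<bar> < 3 * e + 2 * ((2 * B + 1) * DIM('b) * e)"
        by linarith
      then show ?case by (simp add: C_def algebra_simps)
    qed
  qed
  show "(\<lambda>n. \<integral>\<omega>. g (V n \<omega>) \<partial>P) \<longlonglongrightarrow> (\<integral>z. g z \<partial>L)"
  proof (rule tendstoI)
    fix e :: real assume "0 < e"
    have "C * min 1 (e / C) \<le> e" using C0 by (simp add: min_def field_simps)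
    moreover have "0 < min 1 (e / C)" using \<open>0 < e\<close> C0 by simp
    ultimately show "\<forall>\<^sub>F n in sequentially. dist (\<integral>\<omega>. g (V n \<omega>) \<partial>P) (\<integral>z. g z \<partial>L) < e"
      using main[of "min 1 (e / C)"] by (auto simp: dist_real_def elim!: eventually_mono)
  qed
qed

section \<open>Centered Gaussian laws with given covariance\<close>

text \<open>
  Cholesky factorization, one index at a time: if the new diagonal entry \<open>q\<close> is positive, subtract the rank-one matrix
  \<open>S a i * S a j / q\<close>, which leaves a positive semidefinite Schur complement; if \<open>q = 0\<close>, positivity forces the
  whole row to vanish. With \<open>x / 0 = 0\<close> both cases have the same formula.
\<close>
lemma covariance_factorization:
  fixes S :: "'i \<Rightarrow> 'i \<Rightarrow> real"
  assumes "finite J" "\<And>i j. i \<in> J \<Longrightarrow> j \<in> J \<Longrightarrow> S i j = S j i"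
    and "\<And>t. 0 \<le> (\<Sum>i\<in>J. \<Sum>j\<in>J. t i * t j * S i j)"
  shows "\<exists>A. \<forall>i\<in>J. \<forall>j\<in>J. S i j = (\<Sum>l\<in>J. A i l * A j l)"
  using assms
proof (induction J arbitrary: S rule: finite_induct)
  case (insert a J)
  note sym = insert.prems(1)
  have expand: "(\<Sum>i\<in>insert a J. \<Sum>j\<in>insert a J. t i * t j * S i j) =
      t a * t a * S a a + 2 * t a * (\<Sum>i\<in>J. t i * S a i) + (\<Sum>i\<in>J. \<Sum>j\<in>J. t i * t j * S i j)" for t
  proof -
    have "(\<Sum>i\<in>J. t i * t a * S i a) = t a * (\<Sum>i\<in>J. t i * S a i)"
      unfolding sum_distrib_left by (rule sum.cong) (use sym in \<open>auto simp: mult_ac\<close>)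
    moreover have "(\<Sum>j\<in>J. t a * t j * S a j) = t a * (\<Sum>i\<in>J. t i * S a i)"
      unfolding sum_distrib_left by (rule sum.cong) (auto simp: mult_ac)
    ultimately show ?thesis
      using insert.hyps by (simp add: sum.distrib)
  qed
  have psd: "0 \<le> u * u * S a a + 2 * u * (\<Sum>i\<in>J. t i * S a i) + (\<Sum>i\<in>J. \<Sum>j\<in>J. t i * t j * S i j)" for u t
  proof -
    have J: "i \<noteq> a" if "i \<in> J" for i using that insert.hyps by auto
    have "(\<Sum>i\<in>J. (t(a := u)) i * S a i) = (\<Sum>i\<in>J. t i * S a i)"
      by (rule sum.cong) (use J in auto)
    moreover have "(\<Sum>i\<in>J. \<Sum>j\<in>J. (t(a := u)) i * (t(a := u)) j * S i j) = (\<Sum>i\<in>J. \<Sum>j\<in>J. t i * t j * S i j)"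
      by (intro sum.cong refl) (use J in auto)
    ultimately show ?thesis using insert.prems(2)[of "t(a := u)"] unfolding expand by simp
  qed
  define q where "q = S a a"
  have q: "0 \<le> q" using psd[of 1 "\<lambda>_. 0"] by (simp add: q_def)
  define S' where "S' i j = S i j - S a i * S a j / q" for i j
  have zero: "S a i = 0" if "i \<in> J" "q = 0" for i
  proof -
    define t where "t = (\<lambda>j. if j = i then 1 else 0 :: real)"
    have t1: "(\<Sum>j\<in>J. t j * S a j) = S a i"
    proof -
      have "(\<Sum>j\<in>J. t j * S a j) = (\<Sum>j\<in>J. if j = i then S a i else 0)"
        by (rule sum.cong) (auto simp: t_def)
      then show ?thesis using insert.hyps(1) that(1) by simp
    qed
    have t2: "(\<Sum>k\<in>J. \<Sum>j\<in>J. t k * t j * S k j) = S i i"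
    proof -
      have "(\<Sum>j\<in>J. t k * t j * S k j) = (if k = i then S i i else 0)" for k
      proof -
        have "(\<Sum>j\<in>J. t k * t j * S k j) = (\<Sum>j\<in>J. if j = i then t k * S k i else 0)"
          by (rule sum.cong) (auto simp: t_def)
        then show ?thesis using insert.hyps(1) that(1) by (simp add: t_def)
      qed
      then show ?thesis using insert.hyps(1) that(1) by simp
    qed
    \<comment> \<open>An affine function of \<open>u\<close> that is bounded below is constant.\<close>
    have *: "0 \<le> 2 * u * S a i + S i i" for u
      using psd[of u t] that unfolding t1 t2 q_def by simp
    show ?thesis
    proof (rule ccontr)
      assume "S a i \<noteq> 0"
      then have "2 * (- (S i i + 1) / (2 * S a i)) * S a i + S i i = - 1" by (simp add: field_simps)
      then show False using *[of "- (S i i + 1) / (2 * S a i)"] by linarith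
    qed
  qed
  have "\<exists>A. \<forall>i\<in>J. \<forall>j\<in>J. S' i j = (\<Sum>l\<in>J. A i l * A j l)"
  proof (rule insert.IH)
    show "S' i j = S' j i" if "i \<in> J" "j \<in> J" for i j using sym that by (simp add: S'_def mult.commute)
    show "0 \<le> (\<Sum>i\<in>J. \<Sum>j\<in>J. t i * t j * S' i j)" for t
    proof -
      define b where "b = (\<Sum>i\<in>J. t i * S a i)"
      have "(\<Sum>i\<in>J. \<Sum>j\<in>J. t i * t j * (S a i * S a j / q)) = b * b / q"
        unfolding b_def sum_product sum_divide_distrib
        by (intro sum.cong refl) (simp add: mult_ac)
      then have eq: "(\<Sum>i\<in>J. \<Sum>j\<in>J. t i * t j * S' i j) = (\<Sum>i\<in>J. \<Sum>j\<in>J. t i * t j * S i j) - b * b / q"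
        by (simp add: S'_def right_diff_distrib sum_subtractf)
      show ?thesis
      proof (cases "q = 0")
        case True
        then show ?thesis using eq psd[of 0 t] by simp
      next
        case False
        have "(- b / q) * (- b / q) * q + 2 * (- b / q) * b = - (b * b / q)"
          using False by (simp add: field_simps)
        then show ?thesis using eq psd[of "- b / q" t] by (simp add: q_def[symmetric] b_def[symmetric])
      qed
    qed
  qed
  then obtain A where A: "\<And>i j. i \<in> J \<Longrightarrow> j \<in> J \<Longrightarrow> S' i j = (\<Sum>l\<in>J. A i l * A j l)" by blast
  define A' where "A' i l = (if l = a then S a i / sqrt q else if i = a then 0 else A i l)" for i l
  have J: "i \<noteq> a" if "i \<in> J" for i using that insert.hyps by auto
  have "S i j = (\<Sum>l\<in>insert a J. A' i l * A' j l)" if i: "i \<in> insert a J" and j: "j \<in> insert a J" for i j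
  proof -
    have "(\<Sum>l\<in>insert a J. A' i l * A' j l) = S a i * S a j / q + (\<Sum>l\<in>J. A' i l * A' j l)"
      using insert.hyps q by (simp add: A'_def)
    also have "(\<Sum>l\<in>J. A' i l * A' j l) = (if i = a \<or> j = a then 0 else S' i j)"
    proof (cases "i = a \<or> j = a")
      case True
      then have "(\<Sum>l\<in>J. A' i l * A' j l) = (\<Sum>l\<in>J. 0)"
        by (intro sum.cong refl) (use J in \<open>auto simp: A'_def\<close>)
      then show ?thesis using True by simp
    next
      case False
      then have "(\<Sum>l\<in>J. A' i l * A' j l) = (\<Sum>l\<in>J. A i l * A j l)"
        by (intro sum.cong refl) (use J in \<open>auto simp: A'_def\<close>)
      then show ?thesis using False A i j by simp
    qed
    also have "S a i * S a j / q + (if i = a \<or> j = a then 0 else S' i j) = S i j"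
    proof (cases "q = 0")
      case True
      have z: "S a k = 0" if "k \<in> insert a J" for k using zero that True by (auto simp: q_def)
      have "S i a = 0" using z[OF i] sym[OF i, of a] by simp
      then show ?thesis using z[OF j] True by (auto simp: S'_def)
    next
      case False
      show ?thesis
      proof (cases "i = a \<or> j = a")
        case True
        then show ?thesis using False sym[OF i, of a] by (auto simp: q_def)
      qed (simp add: S'_def)
    qed
    finally show ?thesis by simp
  qed
  then show ?case by blast
qed simp

text \<open>
  The univariate law that the definition of \<^const>\<open>centered_gaussian\<close> prescribes for a linear form of variance \<open>v\<close>.
\<close>
definition gaussian_law :: "real \<Rightarrow> real measure" where
  "gaussian_law v = (if v = 0 then return borel 0
     else density lborel (\<lambda>u. ennreal (normal_density 0 (sqrt v) u)))"

lemma gaussian_law_distribution: "0 \<le> v \<Longrightarrow> real_distribution (gaussian_law v)"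
  by (auto simp: gaussian_law_def real_distribution_def real_distribution_axioms_def
      intro!: prob_space_return prob_space_normal_density)

text \<open>
  By scaling the standard normal law.
\<close>
lemma char_gaussian_law:
  assumes "0 \<le> v"
  shows "char (gaussian_law v) u = complex_of_real (exp (- (u\<^sup>2 * v) / 2))"
proof (cases "v = 0")
  case True
  have "char (return borel 0) u = iexp (u * 0)"
    unfolding char_def by (rule integral_return) auto
  then show ?thesis using True by (simp add: gaussian_law_def)
next
  case False
  define s where "s = sqrt v"
  have s: "0 < s" "s\<^sup>2 = v" using assms False by (simp_all add: s_def)
  let ?D = "density lborel (\<lambda>u. ennreal (normal_density 0 s u))"
  interpret D: prob_space ?D by (rule prob_space_normal_density[OF s(1)])
  have "distr ?D lborel (\<lambda>x. x) = ?D" by (rule distr_id2) simp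
  then have "distributed ?D lborel (\<lambda>x. x) (normal_density 0 s)"
    by (simp add: distributed_def)
  then have "distributed ?D lborel (\<lambda>x. (x - 0) / s) std_normal_density"
    by (rule D.normal_standard_normal_convert[OF s(1), THEN iffD1])
  then have "distr ?D lborel (\<lambda>x. (x - 0) / s) = std_normal_distribution"
    by (simp add: distributed_def)
  moreover have "distr ?D borel (\<lambda>x. x / s) = distr ?D lborel (\<lambda>x. (x - 0) / s)"
    by (rule distr_cong) simp_all
  ultimately have std: "distr ?D borel (\<lambda>x. x / s) = std_normal_distribution" by (simp only:)
  have "char std_normal_distribution (u * s) = (CLINT x|?D. iexp (u * s * (x / s)))"
    unfolding std[symmetric] char_def by (rule integral_distr) measurable
  also have "\<dots> = char ?D u" unfolding char_def using s(1) by (simp only: times_divide_eq_right) simp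
  finally show ?thesis
    using False s(2) by (simp add: gaussian_law_def s_def[symmetric] char_std_normal_distribution power_mult_distrib)
qed

lemma char_centered_gaussian:
  assumes "centered_gaussian \<Sigma> L" and "0 \<le> t \<bullet> (\<Sigma> *v t)"
  shows "(CLINT z|L. iexp (t \<bullet> z)) = complex_of_real (exp (- (t \<bullet> (\<Sigma> *v t)) / 2))"
proof -
  have [measurable_cong]: "sets L = sets borel" and
    law: "distr L borel (\<lambda>z. t \<bullet> z) = gaussian_law (t \<bullet> (\<Sigma> *v t))"
    using assms(1) by (simp_all add: centered_gaussian_def gaussian_law_def)
  have "(CLINT z|distr L borel (\<lambda>z. t \<bullet> z). iexp (1 * z)) = (CLINT z|L. iexp (1 * (t \<bullet> z)))"
    by (rule integral_distr) measurable
  then have "(CLINT z|L. iexp (t \<bullet> z)) = char (distr L borel (\<lambda>z. t \<bullet> z)) 1"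
    unfolding char_def by (simp only: mult_1)
  then show ?thesis unfolding law using char_gaussian_law[OF assms(2), of 1] by simp
qed

lemma borel_measurable_vec_components:
  fixes V :: "'w \<Rightarrow> real^'p"
  assumes "\<And>i. (\<lambda>\<omega>. V \<omega> $ i) \<in> borel_measurable M"
  shows "V \<in> borel_measurable M"
  using assms by (subst borel_measurable_euclidean_space) (auto simp: Basis_vec_def inner_axis)

text \<open>
  The image of independent standard normal variables under a matrix \<open>A\<close> with \<open>A A\<^sup>T = \<Sigma>\<close>. Its linear forms are
  identified by their characteristic functions, which treats the degenerate directions like the others.
\<close>
theorem centered_gaussian_exists:
  fixes \<Sigma> :: "real^'p^'p"
  assumes sym: "\<And>i j. \<Sigma> $ i $ j = \<Sigma> $ j $ i" and psd: "\<And>t. 0 \<le> t \<bullet> (\<Sigma> *v t)"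
  shows "\<exists>L. centered_gaussian \<Sigma> L"
proof -
  have quad: "t \<bullet> (\<Sigma> *v t) = (\<Sum>i\<in>UNIV. \<Sum>j\<in>UNIV. t $ i * t $ j * \<Sigma> $ i $ j)" for t
    by (simp add: inner_vec_def matrix_vector_mult_def sum_distrib_left mult_ac)
  obtain A where A: "\<And>i j. \<Sigma> $ i $ j = (\<Sum>l\<in>(UNIV :: 'p set). A i l * A j l)"
  proof -
    have "\<exists>A. \<forall>i\<in>UNIV. \<forall>j\<in>UNIV. \<Sigma> $ i $ j = (\<Sum>l\<in>(UNIV :: 'p set). A i l * A j l)"
    proof (rule covariance_factorization[where S="\<lambda>i j. \<Sigma> $ i $ j" and J=UNIV])
      show "0 \<le> (\<Sum>i\<in>UNIV. \<Sum>j\<in>UNIV. t i * t j * \<Sigma> $ i $ j)" for t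
        using psd[of "\<chi> i. t i"] unfolding quad by simp
    qed (use sym in auto)
    then show ?thesis using that by blast
  qed
  define M where "M = (\<Pi>\<^sub>M l\<in>(UNIV :: 'p set). std_normal_distribution)"
  interpret N: prob_space std_normal_distribution by (rule prob_space_normal_density) simp
  interpret PS: product_prob_space "\<lambda>_::'p. std_normal_distribution" UNIV ..
  interpret M: prob_space M unfolding M_def by (rule PS.prob_space_axioms)
  have coord[measurable]: "(\<lambda>\<omega>. \<omega> l) \<in> borel_measurable M" for l
    unfolding M_def using measurable_component_singleton[of l UNIV "\<lambda>_. std_normal_distribution"] by simp
  have coord_law: "distr M borel (\<lambda>\<omega>. \<omega> l) = std_normal_distribution" for l
  proof -
    have "distr M borel (\<lambda>\<omega>. \<omega> l) = distr M std_normal_distribution (\<lambda>\<omega>. \<omega> l)"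
      by (rule distr_cong) simp_all
    also have "\<dots> = std_normal_distribution"
      unfolding M_def by (rule distr_PiM_component) (auto intro: N.prob_space_axioms)
    finally show ?thesis .
  qed
  have indep: "M.indep_vars (\<lambda>_. borel) (\<lambda>l \<omega>. \<omega> l) UNIV"
  proof (subst M.indep_vars_iff_distr_eq_PiM')
    have "distr M (\<Pi>\<^sub>M i\<in>UNIV. borel) (\<lambda>x. \<lambda>i\<in>UNIV. x i) = distr M M (\<lambda>x. x)"
      by (rule distr_cong) (auto simp: M_def intro!: sets_PiM_cong)
    also have "\<dots> = M" by (rule distr_id)
    finally show "distr M (\<Pi>\<^sub>M i\<in>UNIV. borel) (\<lambda>x. \<lambda>i\<in>UNIV. x i) = (\<Pi>\<^sub>M i\<in>UNIV. distr M borel (\<lambda>\<omega>. \<omega> i))"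
      by (simp only: coord_law M_def[symmetric])
  qed auto
  define Z where "Z \<omega> = (\<chi> i. \<Sum>l\<in>UNIV. A i l * \<omega> l)" for \<omega> :: "'p \<Rightarrow> real"
  have [measurable]: "Z \<in> borel_measurable M"
    by (rule borel_measurable_vec_components) (simp add: Z_def)
  define L where "L = distr M borel Z"
  have law: "distr L borel (\<lambda>z. t \<bullet> z) = gaussian_law (t \<bullet> (\<Sigma> *v t))" for t
  proof (rule Levy_uniqueness)
    define a where "a l = (\<Sum>i\<in>UNIV. t $ i * A i l)" for l
    have tZ: "t \<bullet> Z \<omega> = (\<Sum>l\<in>UNIV. a l * \<omega> l)" for \<omega>
    proof -
      have "t \<bullet> Z \<omega> = (\<Sum>i\<in>UNIV. \<Sum>l\<in>UNIV. t $ i * (A i l * \<omega> l))"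
        by (simp add: Z_def inner_vec_def sum_distrib_left)
      also have "\<dots> = (\<Sum>l\<in>UNIV. \<Sum>i\<in>UNIV. t $ i * (A i l * \<omega> l))" by (rule sum.swap)
      finally show ?thesis by (simp add: a_def sum_distrib_right mult.assoc)
    qed
    have a2: "(\<Sum>l\<in>UNIV. (a l)\<^sup>2) = t \<bullet> (\<Sigma> *v t)"
    proof -
      have "(\<Sum>l\<in>UNIV. (a l)\<^sup>2) = (\<Sum>l\<in>UNIV. \<Sum>i\<in>UNIV. \<Sum>j\<in>UNIV. t $ i * t $ j * (A i l * A j l))"
        unfolding a_def power2_eq_square sum_product by (intro sum.cong refl) (simp add: mult_ac)
      also have "\<dots> = (\<Sum>i\<in>UNIV. \<Sum>l\<in>UNIV. \<Sum>j\<in>UNIV. t $ i * t $ j * (A i l * A j l))" by (rule sum.swap)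
      also have "\<dots> = (\<Sum>i\<in>UNIV. \<Sum>j\<in>UNIV. \<Sum>l\<in>UNIV. t $ i * t $ j * (A i l * A j l))"
        by (intro sum.cong refl sum.swap)
      finally show ?thesis unfolding quad A by (simp add: sum_distrib_left)
    qed
    have eq: "distr L borel (\<lambda>z. t \<bullet> z) = distr M borel (\<lambda>\<omega>. \<Sum>l\<in>UNIV. a l * \<omega> l)"
      unfolding L_def by (subst distr_distr) (auto simp: comp_def tZ)
    show "real_distribution (distr L borel (\<lambda>z. t \<bullet> z))"
      unfolding eq by (rule M.real_distribution_distr) measurable
    show "real_distribution (gaussian_law (t \<bullet> (\<Sigma> *v t)))" by (rule gaussian_law_distribution[OF psd])
    show "char (distr L borel (\<lambda>z. t \<bullet> z)) = char (gaussian_law (t \<bullet> (\<Sigma> *v t)))"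
    proof
      fix u
      have ind: "M.indep_vars (\<lambda>_. borel) (\<lambda>l \<omega>. a l * \<omega> l) UNIV"
        by (rule M.indep_vars_compose2[OF indep]) measurable
      have "char (distr M borel (\<lambda>\<omega>. a l * \<omega> l)) u = complex_of_real (exp (- ((u * a l)\<^sup>2) / 2))" for l
      proof -
        have "char (distr M borel (\<lambda>\<omega>. a l * \<omega> l)) u = (CLINT \<omega>|M. iexp (u * (a l * \<omega> l)))"
          unfolding char_def by (rule integral_distr) measurable
        also have "\<dots> = (CLINT x|distr M borel (\<lambda>\<omega>. \<omega> l). iexp (u * (a l * x)))"
          by (rule integral_distr[symmetric]) measurable
        also have "\<dots> = char std_normal_distribution (u * a l)"
          unfolding coord_law char_def by (simp only: mult.assoc)
        finally show ?thesis by (simp only: char_std_normal_distribution)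
      qed
      then have "char (distr L borel (\<lambda>z. t \<bullet> z)) u = (\<Prod>l\<in>UNIV. complex_of_real (exp (- ((u * a l)\<^sup>2) / 2)))"
        unfolding eq M.char_distr_sum[OF ind] by (simp only:)
      also have "\<dots> = complex_of_real (exp (\<Sum>l\<in>UNIV. - ((u * a l)\<^sup>2) / 2))"
        by (simp only: of_real_prod[symmetric] exp_sum[OF finite, symmetric])
      also have "(\<Sum>l\<in>UNIV. - ((u * a l)\<^sup>2) / 2) = - (u\<^sup>2 * (\<Sum>l\<in>UNIV. (a l)\<^sup>2)) / 2"
        by (simp add: sum_distrib_left sum_divide_distrib sum_negf power_mult_distrib)
      finally show "char (distr L borel (\<lambda>z. t \<bullet> z)) u = char (gaussian_law (t \<bullet> (\<Sigma> *v t))) u"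
        unfolding a2 char_gaussian_law[OF psd] .
    qed
  qed
  have "centered_gaussian \<Sigma> L"
    unfolding centered_gaussian_def
  proof (intro conjI allI)
    show "prob_space L" unfolding L_def by (rule M.prob_space_distr) measurable
  qed (simp_all add: L_def[symmetric] law gaussian_law_def, simp add: L_def)
  then show ?thesis by blast
qed

section \<open>Convergence to zero in probability\<close>

text \<open>
  Convergence to zero in probability. Measurability is part of the notion, so that the rules below need
  no separate side conditions; it is required only eventually, as in \<^const>\<open>converges_in_distribution\<close>.
\<close>
definition null_in_probability :: "'w measure \<Rightarrow> (nat \<Rightarrow> 'w \<Rightarrow> real) \<Rightarrow> bool" where
  "null_in_probability P V \<longleftrightarrow>
     (\<forall>\<^sub>F n in sequentially. V n \<in> borel_measurable P) \<and>
     (\<forall>e>0. (\<lambda>n. measure P {\<omega>\<in>space P. e \<le> \<bar>V n \<omega>\<bar>}) \<longlonglongrightarrow> 0)"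

lemma (in prob_space) null_in_probabilityI:
  assumes "\<forall>\<^sub>F n in sequentially. V n \<in> borel_measurable M"
    and "\<And>e. 0 < e \<Longrightarrow> \<forall>\<^sub>F n in sequentially. prob {\<omega>\<in>space M. e \<le> \<bar>V n \<omega>\<bar>} \<le> p e n"
    and "\<And>e. 0 < e \<Longrightarrow> p e \<longlonglongrightarrow> 0"
  shows "null_in_probability M V"
  unfolding null_in_probability_def
proof (intro conjI allI impI assms(1))
  fix e :: real assume "0 < e"
  show "(\<lambda>n. prob {\<omega>\<in>space M. e \<le> \<bar>V n \<omega>\<bar>}) \<longlonglongrightarrow> 0"
    by (rule tendsto_sandwich[OF _ assms(2)[OF \<open>0 < e\<close>] tendsto_const assms(3)[OF \<open>0 < e\<close>]]) simp
qed

text \<open>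
  Markov's inequality.
\<close>
lemma (in prob_space) null_in_probability_of_L1:
  assumes "\<forall>\<^sub>F n in sequentially. integrable M (V n) \<and> expectation (\<lambda>\<omega>. \<bar>V n \<omega>\<bar>) \<le> p n"
    and "p \<longlonglongrightarrow> 0"
  shows "null_in_probability M V"
proof (rule null_in_probabilityI)
  show "\<forall>\<^sub>F n in sequentially. V n \<in> borel_measurable M"
    using assms(1) by eventually_elim auto
  fix e :: real assume "0 < e"
  show "\<forall>\<^sub>F n in sequentially. prob {\<omega>\<in>space M. e \<le> \<bar>V n \<omega>\<bar>} \<le> p n / e"
    using assms(1)
  proof eventually_elim
    case (elim n)
    have "prob {\<omega>\<in>space M. e \<le> \<bar>V n \<omega>\<bar>} \<le> expectation (\<lambda>\<omega>. \<bar>V n \<omega>\<bar>) / e"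
      by (rule integral_Markov_inequality_measure[where A="space M"]) (use elim \<open>0 < e\<close> in auto)
    also have "\<dots> \<le> p n / e" using elim \<open>0 < e\<close> by (intro divide_right_mono) auto
    finally show ?case .
  qed
  show "(\<lambda>n. p n / e) \<longlonglongrightarrow> 0" using assms(2) by (rule tendsto_divide_zero)
qed

lemma null_in_probability_measurable:
  "null_in_probability P V \<Longrightarrow> \<forall>\<^sub>F n in sequentially. V n \<in> borel_measurable P"
  by (simp add: null_in_probability_def)

text \<open>
  The common pattern of the closure rules: a large value of \<open>U\<close> forces a large value of \<open>V\<close> or of \<open>W\<close>.
\<close>
lemma (in prob_space) null_in_probability_dominated:
  assumes V: "null_in_probability M V" and W: "null_in_probability M W"
    and meas: "\<forall>\<^sub>F n in sequentially. U n \<in> borel_measurable M"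
    and pos: "\<And>e. 0 < e \<Longrightarrow> 0 < g e \<and> 0 < h e"
    and dom: "\<And>e. 0 < e \<Longrightarrow> \<forall>\<^sub>F n in sequentially. \<forall>\<omega>\<in>space M. e \<le> \<bar>U n \<omega>\<bar> \<longrightarrow> g e \<le> \<bar>V n \<omega>\<bar> \<or> h e \<le> \<bar>W n \<omega>\<bar>"
  shows "null_in_probability M U"
proof (rule null_in_probabilityI[OF meas])
  fix e :: real assume e: "0 < e"
  let ?p = "\<lambda>n. prob {\<omega>\<in>space M. g e \<le> \<bar>V n \<omega>\<bar>} + prob {\<omega>\<in>space M. h e \<le> \<bar>W n \<omega>\<bar>}"
  show "\<forall>\<^sub>F n in sequentially. prob {\<omega>\<in>space M. e \<le> \<bar>U n \<omega>\<bar>} \<le> ?p n"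
    using dom[OF e] null_in_probability_measurable[OF V] null_in_probability_measurable[OF W]
  proof eventually_elim
    case (elim n)
    note [measurable] = elim(2,3)
    have "prob {\<omega>\<in>space M. e \<le> \<bar>U n \<omega>\<bar>} \<le> prob ({\<omega>\<in>space M. g e \<le> \<bar>V n \<omega>\<bar>} \<union> {\<omega>\<in>space M. h e \<le> \<bar>W n \<omega>\<bar>})"
      using elim(1) by (intro finite_measure_mono) auto
    also have "\<dots> \<le> ?p n" by (rule measure_Un_le) measurable
    finally show ?case .
  qed
  have "?p \<longlonglongrightarrow> 0 + 0"
    using V W pos[OF e] by (intro tendsto_add) (auto simp: null_in_probability_def)
  then show "?p \<longlonglongrightarrow> 0" by simp
qed

lemma (in prob_space) null_in_probability_add:
  assumes "null_in_probability M V" "null_in_probability M W"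
  shows "null_in_probability M (\<lambda>n \<omega>. V n \<omega> + W n \<omega>)"
proof (rule null_in_probability_dominated[OF assms, where g="\<lambda>e. e / 2" and h="\<lambda>e. e / 2"])
  show "\<forall>\<^sub>F n in sequentially. (\<lambda>\<omega>. V n \<omega> + W n \<omega>) \<in> borel_measurable M"
    using assms[THEN null_in_probability_measurable] by eventually_elim measurable
  fix e :: real assume "0 < e"
  have "e / 2 \<le> \<bar>a\<bar> \<or> e / 2 \<le> \<bar>b\<bar>" if "e \<le> \<bar>a + b\<bar>" for a b using that by linarith
  then show "\<forall>\<^sub>F n in sequentially. \<forall>\<omega>\<in>space M. e \<le> \<bar>V n \<omega> + W n \<omega>\<bar> \<longrightarrow> e / 2 \<le> \<bar>V n \<omega>\<bar> \<or> e / 2 \<le> \<bar>W n \<omega>\<bar>"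
    by (intro always_eventually) blast
qed auto

lemma (in prob_space) null_in_probability_cmult:
  assumes "null_in_probability M V"
  shows "null_in_probability M (\<lambda>n \<omega>. a * V n \<omega>)"
proof (rule null_in_probability_dominated[OF assms assms, where g="\<lambda>e. e / (\<bar>a\<bar> + 1)" and h="\<lambda>e. e / (\<bar>a\<bar> + 1)"])
  show "\<forall>\<^sub>F n in sequentially. (\<lambda>\<omega>. a * V n \<omega>) \<in> borel_measurable M"
    using null_in_probability_measurable[OF assms] by eventually_elim measurable
  fix e :: real assume "0 < e"
  have "e / (\<bar>a\<bar> + 1) \<le> \<bar>v\<bar>" if "e \<le> \<bar>a * v\<bar>" for v
  proof -
    have "e \<le> \<bar>a\<bar> * \<bar>v\<bar>" using that by (simp add: abs_mult)
    also have "\<dots> \<le> (\<bar>a\<bar> + 1) * \<bar>v\<bar>" by (rule mult_right_mono) auto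
    finally show ?thesis by (simp add: pos_divide_le_eq mult.commute add_nonneg_pos)
  qed
  then show "\<forall>\<^sub>F n in sequentially. \<forall>\<omega>\<in>space M. e \<le> \<bar>a * V n \<omega>\<bar> \<longrightarrow> e / (\<bar>a\<bar> + 1) \<le> \<bar>V n \<omega>\<bar> \<or> e / (\<bar>a\<bar> + 1) \<le> \<bar>V n \<omega>\<bar>"
    by (intro always_eventually) blast
qed (auto intro: add_nonneg_pos)

lemma (in prob_space) null_in_probability_sum:
  assumes "finite J" "\<And>j. j \<in> J \<Longrightarrow> null_in_probability M (V j)"
  shows "null_in_probability M (\<lambda>n \<omega>. \<Sum>j\<in>J. V j n \<omega>)"
  using assms
proof (induction J rule: finite_induct)
  case empty
  show ?case by (auto simp: null_in_probability_def)
next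
  case (insert j J)
  then show ?case using null_in_probability_add[of "V j" "\<lambda>n \<omega>. \<Sum>j\<in>J. V j n \<omega>"] by simp
qed

lemma (in prob_space) null_in_probability_deterministic:
  fixes a :: "nat \<Rightarrow> real"
  assumes "a \<longlonglongrightarrow> 0"
  shows "null_in_probability M (\<lambda>n \<omega>. a n)"
proof (rule null_in_probability_of_L1)
  show "(\<lambda>n. \<bar>a n\<bar>) \<longlonglongrightarrow> 0" using assms by (rule tendsto_rabs_zero)
qed (simp add: prob_space)

text \<open>
  On the event \<open>\<bar>T\<bar> \<le> R\<close> a product of size \<open>e\<close> needs a first factor of size \<open>e / R\<close>, and tightness makes the complement of
  that event as unlikely as desired.
\<close>
lemma (in prob_space) null_in_probability_mult_tight:
  assumes V: "null_in_probability M V" and T: "\<forall>\<^sub>F n in sequentially. T n \<in> borel_measurable M"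
    and tight: "\<And>e. 0 < e \<Longrightarrow> \<exists>R>0. \<forall>\<^sub>F n in sequentially. prob {\<omega>\<in>space M. R < \<bar>T n \<omega>\<bar>} < e"
  shows "null_in_probability M (\<lambda>n \<omega>. V n \<omega> * T n \<omega>)"
  unfolding null_in_probability_def
proof (intro conjI allI impI)
  show "\<forall>\<^sub>F n in sequentially. (\<lambda>\<omega>. V n \<omega> * T n \<omega>) \<in> borel_measurable M"
    using null_in_probability_measurable[OF V] T by eventually_elim measurable
  fix e :: real assume e: "0 < e"
  show "(\<lambda>n. prob {\<omega>\<in>space M. e \<le> \<bar>V n \<omega> * T n \<omega>\<bar>}) \<longlonglongrightarrow> 0"
  proof (rule tendstoI)
    fix d :: real assume d: "0 < d"
    obtain R where R: "0 < R" "\<forall>\<^sub>F n in sequentially. prob {\<omega>\<in>space M. R < \<bar>T n \<omega>\<bar>} < d / 2"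
      using tight[of "d / 2"] d by auto
    have "(\<lambda>n. prob {\<omega>\<in>space M. e / R \<le> \<bar>V n \<omega>\<bar>}) \<longlonglongrightarrow> 0"
      using V e R(1) by (simp add: null_in_probability_def)
    then have "\<forall>\<^sub>F n in sequentially. prob {\<omega>\<in>space M. e / R \<le> \<bar>V n \<omega>\<bar>} < d / 2"
      using d by (intro order_tendstoD) auto
    then show "\<forall>\<^sub>F n in sequentially. dist (prob {\<omega>\<in>space M. e \<le> \<bar>V n \<omega> * T n \<omega>\<bar>}) 0 < d"
      using R(2) T null_in_probability_measurable[OF V]
    proof eventually_elim
      case (elim n)
      note [measurable] = elim(3,4)
      have "e / R \<le> \<bar>v\<bar> \<or> R < \<bar>t\<bar>" if "e \<le> \<bar>v * t\<bar>" for v t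
      proof (cases "R < \<bar>t\<bar>")
        case False
        have "e \<le> \<bar>v\<bar> * \<bar>t\<bar>" using that by (simp add: abs_mult)
        also have "\<dots> \<le> \<bar>v\<bar> * R" using False by (intro mult_left_mono) auto
        finally show ?thesis using R(1) by (simp add: pos_divide_le_eq)
      qed simp
      then have "{\<omega>\<in>space M. e \<le> \<bar>V n \<omega> * T n \<omega>\<bar>} \<subseteq> {\<omega>\<in>space M. e / R \<le> \<bar>V n \<omega>\<bar>} \<union> {\<omega>\<in>space M. R < \<bar>T n \<omega>\<bar>}" by blast
      then have "prob {\<omega>\<in>space M. e \<le> \<bar>V n \<omega> * T n \<omega>\<bar>} \<le> prob ({\<omega>\<in>space M. e / R \<le> \<bar>V n \<omega>\<bar>} \<union> {\<omega>\<in>space M. R < \<bar>T n \<omega>\<bar>})"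
        by (intro finite_measure_mono) auto
      also have "\<dots> \<le> prob {\<omega>\<in>space M. e / R \<le> \<bar>V n \<omega>\<bar>} + prob {\<omega>\<in>space M. R < \<bar>T n \<omega>\<bar>}"
        by (rule measure_Un_le) measurable
      finally show ?case using elim(1,2) by simp
    qed
  qed
qed

lemma iexp_lipschitz: "cmod (iexp a - iexp b) \<le> min 2 \<bar>a - b\<bar>"
proof -
  have "iexp a - iexp b = iexp b * (iexp (a - b) - 1)"
    by (simp add: right_diff_distrib exp_add[symmetric])
  then have "cmod (iexp a - iexp b) = cmod (iexp (a - b) - 1)" by (simp only: norm_mult norm_exp_i_times mult_1)
  also have "\<dots> \<le> \<bar>a - b\<bar>" using iexp_approx1[of "a - b" 0] by simp
  finally have "cmod (iexp a - iexp b) \<le> \<bar>a - b\<bar>" .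
  moreover have "cmod (iexp a - iexp b) \<le> cmod (iexp a) + cmod (iexp b)" by (rule norm_triangle_ineq4)
  ultimately show ?thesis by (simp only: norm_exp_i_times min_def) auto
qed

text \<open>
  Slutsky's lemma for characteristic functions: \<open>u \<mapsto> exp(i u)\<close> is Lipschitz and bounded.
\<close>
lemma (in prob_space) char_limit_transfer:
  assumes null: "null_in_probability M (\<lambda>n \<omega>. U n \<omega> - W n \<omega>)"
    and U: "\<forall>\<^sub>F n in sequentially. U n \<in> borel_measurable M"
    and W: "\<forall>\<^sub>F n in sequentially. W n \<in> borel_measurable M"
    and lim: "(\<lambda>n. CLINT \<omega>|M. iexp (W n \<omega>)) \<longlonglongrightarrow> l"
  shows "(\<lambda>n. CLINT \<omega>|M. iexp (U n \<omega>)) \<longlonglongrightarrow> l"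
proof (rule Lim_transform[OF lim], rule tendstoI)
  fix e :: real assume e: "0 < e"
  have "(\<lambda>n. prob {\<omega>\<in>space M. e / 4 \<le> \<bar>U n \<omega> - W n \<omega>\<bar>}) \<longlonglongrightarrow> 0"
    by (rule null[unfolded null_in_probability_def, THEN conjunct2, rule_format]) (use e in simp)
  then have "\<forall>\<^sub>F n in sequentially. prob {\<omega>\<in>space M. e / 4 \<le> \<bar>U n \<omega> - W n \<omega>\<bar>} < e / 4"
    using e by (intro order_tendstoD) auto
  then show "\<forall>\<^sub>F n in sequentially. dist ((CLINT \<omega>|M. iexp (U n \<omega>)) - (CLINT \<omega>|M. iexp (W n \<omega>))) 0 < e"
    using U W
  proof eventually_elim
    case (elim n)
    note [measurable] = elim(2,3)
    let ?B = "{\<omega>\<in>space M. e / 4 \<le> \<bar>U n \<omega> - W n \<omega>\<bar>}"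
    have int: "integrable M (\<lambda>\<omega>. iexp (U n \<omega>))" "integrable M (\<lambda>\<omega>. iexp (W n \<omega>))"
      by (rule integrable_const_bound[where B=1]; simp)+
    have "cmod ((CLINT \<omega>|M. iexp (U n \<omega>)) - (CLINT \<omega>|M. iexp (W n \<omega>))) = cmod (CLINT \<omega>|M. iexp (U n \<omega>) - iexp (W n \<omega>))"
      by (simp only: Bochner_Integration.integral_diff[OF int])
    also have "\<dots> \<le> (\<integral>\<omega>. cmod (iexp (U n \<omega>) - iexp (W n \<omega>)) \<partial>M)" by (rule integral_norm_bound)
    also have "\<dots> \<le> (\<integral>\<omega>. e / 4 + 2 * indicator ?B \<omega> \<partial>M)"
    proof (rule integral_mono)
      show "integrable M (\<lambda>\<omega>. cmod (iexp (U n \<omega>) - iexp (W n \<omega>)))"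
        by (rule integrable_norm[OF Bochner_Integration.integrable_diff[OF int]])
      show "integrable M (\<lambda>\<omega>. e / 4 + 2 * indicator ?B \<omega>)"
        by (intro Bochner_Integration.integrable_add integrable_const integrable_mult_right integrable_real_indicator)
           (auto simp: less_top[symmetric])
      fix \<omega> assume \<omega>: "\<omega> \<in> space M"
      show "cmod (iexp (U n \<omega>) - iexp (W n \<omega>)) \<le> e / 4 + 2 * indicator ?B \<omega>"
      proof (cases "e / 4 \<le> \<bar>U n \<omega> - W n \<omega>\<bar>")
        case True
        have "cmod (iexp (U n \<omega>) - iexp (W n \<omega>)) \<le> 2" using iexp_lipschitz[of "U n \<omega>" "W n \<omega>"] by (simp only: min.bounded_iff)
        moreover have "indicator ?B \<omega> = (1::real)" using True \<omega> by simp
        ultimately show ?thesis using e by linarith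
      next
        case False
        have "cmod (iexp (U n \<omega>) - iexp (W n \<omega>)) \<le> \<bar>U n \<omega> - W n \<omega>\<bar>" using iexp_lipschitz[of "U n \<omega>" "W n \<omega>"] by (simp only: min.bounded_iff)
        moreover have "indicator ?B \<omega> = (0::real)" using False by simp
        ultimately show ?thesis using False by linarith
      qed
    qed
    also have "\<dots> = e / 4 + 2 * prob (?B \<inter> space M)"
      by (subst Bochner_Integration.integral_add) (auto simp: prob_space less_top[symmetric])
    also have "?B \<inter> space M = ?B" by blast
    also have "e / 4 + 2 * prob ?B < e" using elim(1) e by linarith
    finally show ?case by (simp only: dist_norm diff_zero)
  qed
qed

text \<open>
  The ratio minus one is \<open>(H - G) / (a + G)\<close>, and the denominator exceeds \<open>a / 2\<close> with high probability.
\<close>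
lemma (in prob_space) ratio_null_in_probability:
  assumes G: "null_in_probability M G" and H: "null_in_probability M H" and a: "0 < (a::real)"
  shows "null_in_probability M (\<lambda>n \<omega>. (a + H n \<omega>) / (a + G n \<omega>) - 1)"
proof -
  have D: "null_in_probability M (\<lambda>n \<omega>. H n \<omega> + (- 1) * G n \<omega>)"
    by (intro null_in_probability_add null_in_probability_cmult G H)
  show ?thesis
  proof (rule null_in_probability_dominated[OF G D, where g="\<lambda>e. a / 2" and h="\<lambda>e. e * a / 2"])
    show "\<forall>\<^sub>F n in sequentially. (\<lambda>\<omega>. (a + H n \<omega>) / (a + G n \<omega>) - 1) \<in> borel_measurable M"
      using null_in_probability_measurable[OF G] null_in_probability_measurable[OF H]
      by eventually_elim (intro borel_measurable_diff borel_measurable_divide borel_measurable_add borel_measurable_const)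
    fix e :: real assume e: "0 < e"
    have "a / 2 \<le> \<bar>g\<bar> \<or> e * a / 2 \<le> \<bar>h + (- 1) * g\<bar>" if "e \<le> \<bar>(a + h) / (a + g) - 1\<bar>" for g h
    proof (rule ccontr)
      assume no: "\<not> (a / 2 \<le> \<bar>g\<bar> \<or> e * a / 2 \<le> \<bar>h + (- 1) * g\<bar>)"
      then have pos: "a / 2 < a + g" by (auto simp: abs_less_iff)
      have "(a + h) / (a + g) - 1 = (h + (- 1) * g) / (a + g)" using pos a by (simp add: field_simps)
      then have "e \<le> \<bar>h + (- 1) * g\<bar> / (a + g)" using that pos a by (simp add: abs_divide)
      then have "e * (a + g) \<le> \<bar>h + (- 1) * g\<bar>" using pos a by (simp add: pos_le_divide_eq)
      moreover have "e * (a / 2) \<le> e * (a + g)" using pos e by (intro mult_left_mono) auto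
      ultimately show False using no by simp
    qed
    then show "\<forall>\<^sub>F n in sequentially. \<forall>\<omega>\<in>space M. e \<le> \<bar>(a + H n \<omega>) / (a + G n \<omega>) - 1\<bar> \<longrightarrow>
        a / 2 \<le> \<bar>G n \<omega>\<bar> \<or> e * a / 2 \<le> \<bar>H n \<omega> + (- 1) * G n \<omega>\<bar>"
      by (intro always_eventually) blast
  qed (use a in auto)
qed

section \<open>The number of points of a cell and the mass below its peak\<close>

definition poisson_weight :: "real \<Rightarrow> nat \<Rightarrow> real" where
  "poisson_weight \<mu> k = exp (- \<mu>) * \<mu> ^ k / fact k"

lemma poisson_weight_nonneg: "0 \<le> \<mu> \<Longrightarrow> 0 \<le> poisson_weight \<mu> k"
  by (simp add: poisson_weight_def)

lemma poisson_weight_sums: "poisson_weight \<mu> sums 1"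
proof -
  have "(\<lambda>k. exp (- \<mu>) * (\<mu> ^ k /\<^sub>R fact k)) sums (exp (- \<mu>) * exp \<mu>)"
    by (intro sums_mult exp_converges)
  moreover have "(\<lambda>k. exp (- \<mu>) * (\<mu> ^ k /\<^sub>R fact k)) = poisson_weight \<mu>"
    by (rule ext) (simp add: poisson_weight_def field_simps)
  moreover have "exp (- \<mu>) * exp \<mu> = 1" by (simp add: exp_minus)
  ultimately show ?thesis by simp
qed

text \<open>
  Dividing a Poisson weight by a rising factorial shifts it; this is what makes inverse moments of a Poisson variable explicit.
\<close>
lemma poisson_weight_shift:
  "poisson_weight \<mu> (k + j) = poisson_weight \<mu> k * \<mu> ^ j / pochhammer (real k + 1) j"
proof -
  have "fact (k + j) = fact k * pochhammer (real k + 1) j"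
    by (induction j) (simp_all add: pochhammer_Suc algebra_simps)
  then show ?thesis by (simp add: poisson_weight_def power_add)
qed

lemma poisson_inverse_factorial_moment:
  "(\<lambda>k. poisson_weight \<mu> k * \<mu> ^ j / pochhammer (real k + 1) j) sums (1 - (\<Sum>i<j. poisson_weight \<mu> i))"
  unfolding poisson_weight_shift[symmetric]
  by (rule sums_split_initial_segment[OF poisson_weight_sums])

lemma poisson_variance: "(\<lambda>k. (real k - \<mu>)\<^sup>2 * poisson_weight \<mu> k) sums \<mu>"
proof -
  have s1: "real (Suc k) * poisson_weight \<mu> (Suc k) = \<mu> * poisson_weight \<mu> k" for k
    by (simp add: poisson_weight_def divide_simps)
  have "(\<lambda>k. real (Suc k) * poisson_weight \<mu> (Suc k)) sums (\<mu> * 1)"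
    unfolding s1 by (intro sums_mult poisson_weight_sums)
  then have m1: "(\<lambda>k. real k * poisson_weight \<mu> k) sums \<mu>"
    by (subst (asm) sums_Suc_iff) simp
  have s2: "real (Suc k) * (real (Suc k) - 1) * poisson_weight \<mu> (Suc k) = \<mu> * (real k * poisson_weight \<mu> k)" for k
  proof -
    have "real (Suc k) * (real (Suc k) - 1) * poisson_weight \<mu> (Suc k) = real k * (real (Suc k) * poisson_weight \<mu> (Suc k))"
      by (simp only: of_nat_Suc) simp
    then show ?thesis unfolding s1 by (simp only: mult.left_commute)
  qed
  have "(\<lambda>k. real (Suc k) * (real (Suc k) - 1) * poisson_weight \<mu> (Suc k)) sums (\<mu> * \<mu>)"
    unfolding s2 by (intro sums_mult m1)
  then have m2: "(\<lambda>k. real k * (real k - 1) * poisson_weight \<mu> k) sums (\<mu> * \<mu>)"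
    by (subst (asm) sums_Suc_iff[of "\<lambda>k. real k * (real k - 1) * poisson_weight \<mu> k"]) simp
  have "(\<lambda>k. real k * (real k - 1) * poisson_weight \<mu> k + (1 - 2 * \<mu>) * (real k * poisson_weight \<mu> k)
      + \<mu>\<^sup>2 * poisson_weight \<mu> k) sums (\<mu> * \<mu> + (1 - 2 * \<mu>) * \<mu> + \<mu>\<^sup>2 * 1)"
    by (intro sums_add sums_mult m1 m2 poisson_weight_sums)
  moreover have "(\<lambda>k. real k * (real k - 1) * poisson_weight \<mu> k + (1 - 2 * \<mu>) * (real k * poisson_weight \<mu> k)
      + \<mu>\<^sup>2 * poisson_weight \<mu> k) = (\<lambda>k. (real k - \<mu>)\<^sup>2 * poisson_weight \<mu> k)"
    by (rule ext) (simp add: power2_eq_square algebra_simps)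
  moreover have "\<mu> * \<mu> + (1 - 2 * \<mu>) * \<mu> + \<mu>\<^sup>2 * 1 = \<mu>" by (simp add: power2_eq_square algebra_simps)
  ultimately show ?thesis by simp
qed

text \<open>
  The law of total expectation for a variable \<open>N\<close> with values in the natural numbers.
\<close>
lemma (in prob_space) expectation_sums_by_count:
  fixes N :: "'a \<Rightarrow> nat" and X :: "'a \<Rightarrow> real"
  assumes [measurable]: "N \<in> measurable M (count_space UNIV)" and X: "integrable M X"
  shows "(\<lambda>k. expectation (\<lambda>\<omega>. X \<omega> * indicator {\<omega>. N \<omega> = k} \<omega>)) sums expectation X"
proof -
  note [measurable] = borel_measurable_integrable[OF X]
  have int: "integrable M (\<lambda>\<omega>. X \<omega> * indicator {\<omega>. N \<omega> = k} \<omega>)" for k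
    by (rule Bochner_Integration.integrable_bound[OF X]) (auto split: split_indicator)
  have "(\<Sum>k<n. X \<omega> * indicator {\<omega>. N \<omega> = k} \<omega>) = X \<omega> * indicator {\<omega>. N \<omega> < n} \<omega>" for n \<omega>
  proof -
    have "(\<Sum>k<n. X \<omega> * indicator {\<omega>. N \<omega> = k} \<omega>) = (\<Sum>k<n. if N \<omega> = k then X \<omega> else 0)"
      by (intro sum.cong) (auto split: split_indicator)
    then show ?thesis by (auto simp: sum.delta' split: split_indicator)
  qed
  note part = this
  have eq: "(\<Sum>k<n. expectation (\<lambda>\<omega>. X \<omega> * indicator {\<omega>. N \<omega> = k} \<omega>)) =
      expectation (\<lambda>\<omega>. X \<omega> * indicator {\<omega>. N \<omega> < n} \<omega>)" for n
  proof -
    have "expectation (\<lambda>\<omega>. X \<omega> * indicator {\<omega>. N \<omega> < n} \<omega>) =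
        expectation (\<lambda>\<omega>. \<Sum>k<n. X \<omega> * indicator {\<omega>. N \<omega> = k} \<omega>)" by (simp only: part)
    also have "\<dots> = (\<Sum>k<n. expectation (\<lambda>\<omega>. X \<omega> * indicator {\<omega>. N \<omega> = k} \<omega>))"
      by (rule Bochner_Integration.integral_sum) (rule int)
    finally show ?thesis by (rule sym)
  qed
  have "(\<lambda>n. expectation (\<lambda>\<omega>. X \<omega> * indicator {\<omega>. N \<omega> < n} \<omega>)) \<longlonglongrightarrow> expectation X"
  proof (rule integral_dominated_convergence[where w="\<lambda>\<omega>. \<bar>X \<omega>\<bar>"])
    show "AE \<omega> in M. (\<lambda>n. X \<omega> * indicator {\<omega>. N \<omega> < n} \<omega>) \<longlonglongrightarrow> X \<omega>"
    proof (rule AE_I2)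
      fix \<omega>
      have "\<forall>\<^sub>F n in sequentially. X \<omega> * indicator {\<omega>. N \<omega> < n} \<omega> = X \<omega>"
        using eventually_gt_at_top[of "N \<omega>"] by eventually_elim simp
      then show "(\<lambda>n. X \<omega> * indicator {\<omega>. N \<omega> < n} \<omega>) \<longlonglongrightarrow> X \<omega>" by (rule tendsto_eventually)
    qed
  qed (use X in \<open>auto split: split_indicator\<close>)
  then show ?thesis unfolding sums_def eq .
qed

text \<open>
  Chebyshev's inequality, carried out on the Poisson weights.
\<close>
lemma (in prob_space) poisson_concentration:
  fixes N :: "'a \<Rightarrow> nat"
  assumes N[measurable]: "N \<in> measurable M (count_space UNIV)"
    and law: "\<And>k. prob {\<omega>\<in>space M. N \<omega> = k} = poisson_weight \<mu> k"
    and "0 < \<mu>" "0 < e"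
  shows "prob {\<omega>\<in>space M. e * \<mu> \<le> \<bar>real (N \<omega>) - \<mu>\<bar>} \<le> 1 / (e\<^sup>2 * \<mu>)"
proof -
  let ?A = "{\<omega>. e * \<mu> \<le> \<bar>real (N \<omega>) - \<mu>\<bar>}"
  have "(\<lambda>k. expectation (\<lambda>\<omega>. indicator ?A \<omega> * indicator {\<omega>. N \<omega> = k} \<omega> :: real)) sums expectation (indicator ?A :: _ \<Rightarrow> real)"
    by (rule expectation_sums_by_count[OF N]) (rule integrable_const_bound[where B=1], auto)
  moreover have "(\<lambda>k. (1 / (e * \<mu>)\<^sup>2) * ((real k - \<mu>)\<^sup>2 * poisson_weight \<mu> k)) sums ((1 / (e * \<mu>)\<^sup>2) * \<mu>)"
    by (intro sums_mult poisson_variance)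
  moreover have "expectation (\<lambda>\<omega>. indicator ?A \<omega> * indicator {\<omega>. N \<omega> = k} \<omega> :: real) \<le>
      (1 / (e * \<mu>)\<^sup>2) * ((real k - \<mu>)\<^sup>2 * poisson_weight \<mu> k)" for k
  proof (cases "e * \<mu> \<le> \<bar>real k - \<mu>\<bar>")
    case True
    have "expectation (\<lambda>\<omega>. indicator ?A \<omega> * indicator {\<omega>. N \<omega> = k} \<omega> :: real) = expectation (indicator {\<omega>\<in>space M. N \<omega> = k})"
      by (rule Bochner_Integration.integral_cong) (use True in \<open>auto split: split_indicator\<close>)
    also have "\<dots> = prob ({\<omega>\<in>space M. N \<omega> = k} \<inter> space M)"
      by (rule Bochner_Integration.integral_indicator)
    also have "\<dots> = prob {\<omega>\<in>space M. N \<omega> = k}" by (rule arg_cong[where f=prob]) blast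
    also have "\<dots> = poisson_weight \<mu> k" by (rule law)
    also have "\<dots> = (1 / (e * \<mu>)\<^sup>2) * ((e * \<mu>)\<^sup>2 * poisson_weight \<mu> k)" using assms by simp
    also have "\<dots> \<le> (1 / (e * \<mu>)\<^sup>2) * ((real k - \<mu>)\<^sup>2 * poisson_weight \<mu> k)"
    proof (intro mult_left_mono mult_right_mono)
      show "(e * \<mu>)\<^sup>2 \<le> (real k - \<mu>)\<^sup>2" using True assms by (simp add: abs_le_square_iff[symmetric])
    qed (use assms in \<open>auto simp: poisson_weight_nonneg\<close>)
    finally show ?thesis .
  next
    case False
    then have "expectation (\<lambda>\<omega>. indicator ?A \<omega> * indicator {\<omega>. N \<omega> = k} \<omega> :: real) = expectation (\<lambda>\<omega>. 0)"
      by (intro Bochner_Integration.integral_cong) (auto split: split_indicator)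
    then show ?thesis using assms by (simp add: poisson_weight_nonneg)
  qed
  ultimately have "expectation (indicator ?A :: _ \<Rightarrow> real) \<le> (1 / (e * \<mu>)\<^sup>2) * \<mu>"
    by - (rule sums_le)
  moreover have "expectation (indicator ?A :: _ \<Rightarrow> real) = prob {\<omega>\<in>space M. e * \<mu> \<le> \<bar>real (N \<omega>) - \<mu>\<bar>}"
  proof -
    have "expectation (indicator ?A :: _ \<Rightarrow> real) = prob (?A \<inter> space M)"
      by (rule Bochner_Integration.integral_indicator)
    also have "?A \<inter> space M = {\<omega>\<in>space M. e * \<mu> \<le> \<bar>real (N \<omega>) - \<mu>\<bar>}" by blast
    finally show ?thesis .
  qed
  moreover have "(1 / (e * \<mu>)\<^sup>2) * \<mu> = 1 / (e\<^sup>2 * \<mu>)" using assms by (simp add: power2_eq_square)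
  ultimately show ?thesis by simp
qed

text \<open>
  Abstract form of the pair made of the number \<open>N\<close> of points in a cell and of the mass \<open>U\<close> below the highest
  point. The cell enters only through its total mass \<open>\<mu>\<close>, and \<open>U = 0\<close> almost surely when the cell is empty,
  by the law at \<open>u = 0\<close>.
\<close>
locale poisson_record = prob_space M for M :: "'w measure" +
  fixes \<mu> :: real and N :: "'w \<Rightarrow> nat" and U :: "'w \<Rightarrow> real"
  assumes lam_pos: "0 < \<mu>"
    and N_meas[measurable]: "N \<in> measurable M (count_space UNIV)"
    and U_meas[measurable]: "U \<in> borel_measurable M"
    and U_range: "\<And>\<omega>. \<omega> \<in> space M \<Longrightarrow> 0 \<le> U \<omega> \<and> U \<omega> \<le> \<mu>"
    and law: "\<And>k u. 0 \<le> u \<Longrightarrow> u \<le> \<mu> \<Longrightarrow>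
      prob {\<omega>\<in>space M. N \<omega> = k \<and> U \<omega> \<le> u} = exp (- \<mu>) * u ^ k / fact k"
begin

lemma count_law: "prob {\<omega>\<in>space M. N \<omega> = k} = poisson_weight \<mu> k"
proof -
  have "{\<omega>\<in>space M. N \<omega> = k} = {\<omega>\<in>space M. N \<omega> = k \<and> U \<omega> \<le> \<mu>}" using U_range by auto
  then show ?thesis using law[of \<mu> k] lam_pos by (simp add: poisson_weight_def)
qed

lemma tail_law:
  assumes "0 \<le> u" "u \<le> \<mu>"
  shows "prob {\<omega>\<in>space M. N \<omega> = k \<and> u < U \<omega>} = exp (- \<mu>) * (\<mu> ^ k - u ^ k) / fact k"
proof -
  have "prob {\<omega>\<in>space M. N \<omega> = k} =
      prob ({\<omega>\<in>space M. N \<omega> = k \<and> U \<omega> \<le> u} \<union> {\<omega>\<in>space M. N \<omega> = k \<and> u < U \<omega>})"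
    by (rule arg_cong[where f=prob]) auto
  also have "\<dots> = prob {\<omega>\<in>space M. N \<omega> = k \<and> U \<omega> \<le> u} + prob {\<omega>\<in>space M. N \<omega> = k \<and> u < U \<omega>}"
    by (rule finite_measure_Union) auto
  finally show ?thesis
    unfolding count_law law[OF assms] by (simp add: poisson_weight_def diff_divide_distrib right_diff_distrib)
qed

lemma no_points_AE: "AE \<omega> in M. N \<omega> = 0 \<longrightarrow> U \<omega> = 0"
proof (rule AE_I)
  show "{\<omega>\<in>space M. \<not> (N \<omega> = 0 \<longrightarrow> U \<omega> = 0)} \<subseteq> {\<omega>\<in>space M. N \<omega> = 0 \<and> 0 < U \<omega>}"
    using U_range by force
  show "emeasure M {\<omega>\<in>space M. N \<omega> = 0 \<and> 0 < U \<omega>} = 0"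
    using tail_law[of 0 0] lam_pos by (simp add: emeasure_eq_measure)
  show "{\<omega>\<in>space M. N \<omega> = 0 \<and> 0 < U \<omega>} \<in> sets M" by measurable
qed

text \<open>
  Differentiating the law in \<open>u\<close>; both sides give the same mass to every half-line.
\<close>
lemma record_density:
  assumes "0 < k"
  shows "distr (density M (indicator {\<omega>\<in>space M. N \<omega> = k})) borel U =
    density lborel (\<lambda>u. ennreal (exp (- \<mu>) * (real k * u ^ (k - 1)) / fact k) * indicator {0..\<mu>} u)"
    (is "?L = ?R")
proof (rule measure_eqI_lessThan)
  have L: "emeasure ?L {x<..} = ennreal (prob {\<omega>\<in>space M. N \<omega> = k \<and> x < U \<omega>})" for x
  proof -
    have "emeasure ?L {x<..} = emeasure (density M (indicator {\<omega>\<in>space M. N \<omega> = k})) (U -` {x<..} \<inter> space M)"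
      by (subst emeasure_distr) auto
    also have "\<dots> = (\<integral>\<^sup>+\<omega>. indicator {\<omega>\<in>space M. N \<omega> = k} \<omega> * indicator (U -` {x<..} \<inter> space M) \<omega> \<partial>M)"
      by (subst emeasure_density) auto
    also have "\<dots> = (\<integral>\<^sup>+\<omega>. indicator {\<omega>\<in>space M. N \<omega> = k \<and> x < U \<omega>} \<omega> \<partial>M)"
      by (intro nn_integral_cong) (auto split: split_indicator)
    finally show ?thesis by (simp add: emeasure_eq_measure)
  qed
  then show "emeasure ?L {x<..} < \<infinity>" for x by simp
  show "emeasure ?L {x<..} = emeasure ?R {x<..}" for x
  proof (cases "x < \<mu>")
    case True
    define x' where "x' = max 0 x"
    have x': "0 \<le> x'" "x' \<le> \<mu>" "x \<le> x'" using True lam_pos by (auto simp: x'_def)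
    have R: "emeasure ?R {x<..} = ennreal (exp (- \<mu>) * (\<mu> ^ k - x' ^ k) / fact k)"
    proof -
      have "emeasure ?R {x<..} = (\<integral>\<^sup>+u. ennreal (exp (- \<mu>) * (real k * u ^ (k - 1)) / fact k) * indicator {0..\<mu>} u * indicator {x<..} u \<partial>lborel)"
        by (subst emeasure_density) auto
      also have "\<dots> = (\<integral>\<^sup>+u. ennreal (exp (- \<mu>) * (real k * u ^ (k - 1)) / fact k) * indicator {x'..\<mu>} u \<partial>lborel)"
        by (intro nn_integral_cong_AE, use AE_lborel_singleton[of x] in eventually_elim)
           (auto simp: x'_def split: split_indicator)
      also have "\<dots> = ennreal (exp (- \<mu>) * \<mu> ^ k / fact k - exp (- \<mu>) * x' ^ k / fact k)"
        by (rule nn_integral_FTC_Icc[where F="\<lambda>u. exp (- \<mu>) * u ^ k / fact k"])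
           (use x' in \<open>auto intro!: derivative_eq_intros\<close>)
      finally show ?thesis by (simp add: diff_divide_distrib right_diff_distrib)
    qed
    show ?thesis
    proof (cases "0 \<le> x")
      case True
      then show ?thesis using R L[of x] tail_law[of x k] \<open>x < \<mu>\<close> by (simp add: x'_def)
    next
      case False
      then have "{\<omega>\<in>space M. N \<omega> = k \<and> x < U \<omega>} = {\<omega>\<in>space M. N \<omega> = k}" using U_range by force
      then show ?thesis using R L[of x] count_law[of k] False \<open>0 < k\<close>
        by (simp add: x'_def poisson_weight_def max_def zero_power)
    qed
  next
    case False
    have "emeasure ?R {x<..} = (\<integral>\<^sup>+(u::real). 0 \<partial>lborel)"
    proof -
      have "emeasure ?R {x<..} = (\<integral>\<^sup>+u. ennreal (exp (- \<mu>) * (real k * u ^ (k - 1)) / fact k) * indicator {0..\<mu>} u * indicator {x<..} u \<partial>lborel)"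
        by (subst emeasure_density) auto
      also have "\<dots> = (\<integral>\<^sup>+(u::real). 0 \<partial>lborel)"
        by (intro nn_integral_cong) (use False in \<open>auto split: split_indicator\<close>)
      finally show ?thesis .
    qed
    moreover have "{\<omega>\<in>space M. N \<omega> = k \<and> x < U \<omega>} = {}" using U_range False by force
    ultimately show ?thesis using L[of x] by (simp only: measure_empty) simp
  qed
qed auto

text \<open>
  Given \<open>N = k\<close>, the variable \<open>U / \<mu>\<close> has the moments \<open>k / (k + j)\<close> of the maximum of \<open>k\<close> uniform variables. For \<open>k = 0\<close> both sides vanish because \<open>j > 0\<close>.
\<close>
lemma record_moment:
  assumes "0 < j"
  shows "expectation (\<lambda>\<omega>. U \<omega> ^ j * indicator {\<omega>. N \<omega> = k} \<omega>) = poisson_weight \<mu> k * \<mu> ^ j * (real k / real (k + j))"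
proof (cases "k = 0")
  case True
  have "expectation (\<lambda>\<omega>. U \<omega> ^ j * indicator {\<omega>. N \<omega> = k} \<omega>) = expectation (\<lambda>\<omega>. 0)"
    by (intro integral_cong_AE, simp, simp, use no_points_AE in eventually_elim)
       (use assms True in \<open>auto split: split_indicator\<close>)
  then show ?thesis using True by simp
next
  case False
  then have k: "0 < k" by simp
  have "expectation (\<lambda>\<omega>. U \<omega> ^ j * indicator {\<omega>. N \<omega> = k} \<omega>) =
      expectation (\<lambda>\<omega>. indicator {\<omega>\<in>space M. N \<omega> = k} \<omega> *\<^sub>R U \<omega> ^ j)"
    by (rule Bochner_Integration.integral_cong) (auto split: split_indicator)
  also have "\<dots> = (\<integral>\<omega>. U \<omega> ^ j \<partial>density M (\<lambda>\<omega>. ennreal (indicator {\<omega>\<in>space M. N \<omega> = k} \<omega>)))"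
    by (rule integral_density[symmetric]) auto
  also have "\<dots> = (\<integral>u. u ^ j \<partial>distr (density M (indicator {\<omega>\<in>space M. N \<omega> = k})) borel U)"
    by (subst integral_distr) (auto simp: ennreal_indicator)
  also have "\<dots> = (\<integral>u. u ^ j \<partial>density lborel (\<lambda>u. ennreal ((exp (- \<mu>) * (real k * u ^ (k - 1)) / fact k) * indicator {0..\<mu>} u)))"
    unfolding record_density[OF k]
    by (intro arg_cong2[where f=lebesgue_integral] density_cong refl AE_I2) (auto split: split_indicator)
  also have "\<dots> = (\<integral>u. ((exp (- \<mu>) * (real k * u ^ (k - 1)) / fact k) * indicator {0..\<mu>} u) *\<^sub>R u ^ j \<partial>lborel)"
    by (rule integral_density) (auto split: split_indicator)
  also have "\<dots> = (\<integral>u. (exp (- \<mu>) * real k / fact k * u ^ (k + j - 1)) * indicator {0..\<mu>} u \<partial>lborel)"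
  proof (rule Bochner_Integration.integral_cong[OF refl])
    fix u :: real
    have "u ^ (k - 1) * u ^ j = u ^ (k + j - 1)" using k by (simp add: power_add[symmetric])
    then show "((exp (- \<mu>) * (real k * u ^ (k - 1)) / fact k) * indicator {0..\<mu>} u) *\<^sub>R u ^ j =
        (exp (- \<mu>) * real k / fact k * u ^ (k + j - 1)) * indicator {0..\<mu>} u"
      by (auto split: split_indicator simp: field_simps)
  qed
  also have "\<dots> = exp (- \<mu>) * real k / fact k * \<mu> ^ (k + j) / real (k + j) - exp (- \<mu>) * real k / fact k * 0 ^ (k + j) / real (k + j)"
    by (rule integral_FTC_Icc_real[where F="\<lambda>u. exp (- \<mu>) * real k / fact k * u ^ (k + j) / real (k + j)"])
       (use k lam_pos in \<open>auto intro!: derivative_eq_intros continuous_intros simp: divide_simps\<close>)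
  also have "\<dots> = poisson_weight \<mu> k * \<mu> ^ j * (real k / real (k + j))"
  proof -
    have "(0::real) ^ (k + j) = 0" using k by (simp add: zero_power)
    then show ?thesis by (simp only: poisson_weight_def power_add) (simp add: mult.assoc)
  qed
  finally show ?thesis .
qed

text \<open>
  When \<open>N = 0\<close> the factor is \<open>1 + 1 / 0 = 1\<close>, which is harmless because then \<open>U = 0\<close> almost surely.
\<close>
definition deviation :: "'w \<Rightarrow> real" where
  "deviation \<omega> = (1 + 1 / real (N \<omega>)) * U \<omega> - \<mu>"

lemma deviation_meas[measurable]: "deviation \<in> borel_measurable M"
  unfolding deviation_def by measurable

lemma deviation_bounded: "\<omega> \<in> space M \<Longrightarrow> \<bar>deviation \<omega>\<bar> \<le> 2 * \<mu>"
proof -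
  assume \<omega>: "\<omega> \<in> space M"
  have "0 \<le> 1 / real (N \<omega>)" "1 / real (N \<omega>) \<le> 1" by (cases "N \<omega>"; simp)+
  then have "0 \<le> (1 + 1 / real (N \<omega>)) * U \<omega>" "(1 + 1 / real (N \<omega>)) * U \<omega> \<le> 2 * \<mu>"
    using U_range[OF \<omega>] by (auto intro!: mult_mono)
  then show ?thesis unfolding deviation_def using lam_pos by linarith
qed

lemma deviation_power_integrable: "integrable M (\<lambda>\<omega>. deviation \<omega> ^ j)"
proof (rule integrable_const_bound[where B="(2 * \<mu>) ^ j"])
  show "AE \<omega> in M. norm (deviation \<omega> ^ j) \<le> (2 * \<mu>) ^ j"
  proof (rule AE_I2)
    fix \<omega> assume "\<omega> \<in> space M"
    from power_mono[OF deviation_bounded[OF this] abs_ge_zero, of j]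
    show "norm (deviation \<omega> ^ j) \<le> (2 * \<mu>) ^ j" by (simp only: real_norm_def power_abs)
  qed
qed measurable

lemma integrable_on_count: "integrable M (\<lambda>\<omega>. U \<omega> ^ j * indicator {\<omega>. N \<omega> = k} \<omega>)"
proof (rule integrable_const_bound[where B="\<mu> ^ j"])
  show "AE \<omega> in M. norm (U \<omega> ^ j * indicator {\<omega>. N \<omega> = k} \<omega>) \<le> \<mu> ^ j"
    using U_range lam_pos by (auto simp: power_mono split: split_indicator)
qed measurable

lemma expectation_polynomial_on_count:
  "expectation (\<lambda>\<omega>. (a + b * U \<omega> + c * U \<omega> ^ 2 + d * U \<omega> ^ 3) * indicator {\<omega>. N \<omega> = k} \<omega>) =
    poisson_weight \<mu> k * (a + b * \<mu> * (real k / real (k + 1)) + c * \<mu>\<^sup>2 * (real k / real (k + 2)) + d * \<mu> ^ 3 * (real k / real (k + 3)))"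
proof -
  let ?J = "\<lambda>j \<omega>. U \<omega> ^ j * indicator {\<omega>. N \<omega> = k} \<omega> :: real"
  have E0: "expectation (?J 0) = poisson_weight \<mu> k"
  proof -
    have "expectation (?J 0) = expectation (indicator {\<omega>. N \<omega> = k})" by simp
    also have "\<dots> = prob ({\<omega>. N \<omega> = k} \<inter> space M)" by (rule Bochner_Integration.integral_indicator)
    also have "{\<omega>. N \<omega> = k} \<inter> space M = {\<omega>\<in>space M. N \<omega> = k}" by blast
    finally show ?thesis using count_law by simp
  qed
  have "expectation (\<lambda>\<omega>. (a + b * U \<omega> + c * U \<omega> ^ 2 + d * U \<omega> ^ 3) * indicator {\<omega>. N \<omega> = k} \<omega>) =
      expectation (\<lambda>\<omega>. a * ?J 0 \<omega> + b * ?J 1 \<omega> + c * ?J 2 \<omega> + d * ?J 3 \<omega>)"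
    by (rule Bochner_Integration.integral_cong[OF refl]) (simp add: algebra_simps)
  also have "\<dots> = a * expectation (?J 0) + b * expectation (?J 1) + c * expectation (?J 2) + d * expectation (?J 3)"
    by (simp only: Bochner_Integration.integral_add Bochner_Integration.integrable_add integrable_mult_right integral_mult_right_zero integrable_on_count)
  also have "\<dots> = poisson_weight \<mu> k * (a + b * \<mu> * (real k / real (k + 1)) + c * \<mu>\<^sup>2 * (real k / real (k + 2)) + d * \<mu> ^ 3 * (real k / real (k + 3)))"
    unfolding E0 using record_moment[of 1 k] record_moment[of 2 k] record_moment[of 3 k]
    by (simp add: algebra_simps)
  finally show ?thesis .
qed

text \<open>
  For \<open>k \<ge> 1\<close> the factor \<open>1 + 1/k\<close> removes the bias of the maximum exactly; only empty cells contribute.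
\<close>
lemma deviation_mean: "expectation deviation = - (\<mu> * exp (- \<mu>))"
proof -
  have "(\<lambda>k. expectation (\<lambda>\<omega>. deviation \<omega> * indicator {\<omega>. N \<omega> = k} \<omega>)) sums expectation deviation"
    using expectation_sums_by_count[OF N_meas deviation_power_integrable[of 1]] by simp
  moreover have "expectation (\<lambda>\<omega>. deviation \<omega> * indicator {\<omega>. N \<omega> = k} \<omega>) =
      (if k = 0 then - (\<mu> * exp (- \<mu>)) else 0)" for k
  proof -
    have "expectation (\<lambda>\<omega>. deviation \<omega> * indicator {\<omega>. N \<omega> = k} \<omega>) =
        expectation (\<lambda>\<omega>. (- \<mu> + (1 + 1 / real k) * U \<omega> + 0 * U \<omega> ^ 2 + 0 * U \<omega> ^ 3) * indicator {\<omega>. N \<omega> = k} \<omega>)"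
      by (rule Bochner_Integration.integral_cong[OF refl]) (auto simp: deviation_def split: split_indicator)
    also have "\<dots> = (if k = 0 then - (\<mu> * exp (- \<mu>)) else 0)"
      unfolding expectation_polynomial_on_count by (simp add: poisson_weight_def divide_simps)
    finally show ?thesis .
  qed
  ultimately have "(\<lambda>k. if k = 0 then - (\<mu> * exp (- \<mu>)) else 0) sums expectation deviation" by simp
  then show ?thesis using sums_single[of 0 "\<lambda>_. - (\<mu> * exp (- \<mu>))"] sums_unique2 by blast
qed

text \<open>
  Given \<open>N = k \<ge> 1\<close> the second moment is \<open>\<mu>\<^sup>2 / (k (k + 2))\<close>. It lies between \<open>\<mu>\<^sup>2 / ((k + 1) (k + 2))\<close> and the same plus
  \<open>4 \<mu>\<^sup>2 / ((k + 1) (k + 2) (k + 3))\<close>, and these two average to shifted Poisson probabilities.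
\<close>
lemma deviation_second_moment: "\<bar>expectation (\<lambda>\<omega>. (deviation \<omega>)\<^sup>2) - 1\<bar> \<le> 4 / \<mu>"
proof -
  let ?a = "\<lambda>k. expectation (\<lambda>\<omega>. (deviation \<omega>)\<^sup>2 * indicator {\<omega>. N \<omega> = k} \<omega>)"
  let ?b = "\<lambda>j k. poisson_weight \<mu> k * \<mu> ^ j / pochhammer (real k + 1) j"
  have sums: "?a sums expectation (\<lambda>\<omega>. (deviation \<omega>)\<^sup>2)"
    by (rule expectation_sums_by_count[OF N_meas deviation_power_integrable])
  have a: "?a k = poisson_weight \<mu> k * \<mu>\<^sup>2 * (if k = 0 then 1 else 1 / (real k * (real k + 2)))" for k
  proof -
    have "?a k = expectation (\<lambda>\<omega>. (\<mu>\<^sup>2 + (- 2 * \<mu> * (1 + 1 / real k)) * U \<omega> + (1 + 1 / real k)\<^sup>2 * U \<omega> ^ 2 + 0 * U \<omega> ^ 3) * indicator {\<omega>. N \<omega> = k} \<omega>)"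
      by (rule Bochner_Integration.integral_cong[OF refl])
         (auto simp: deviation_def power2_eq_square algebra_simps split: split_indicator)
    also have "\<dots> = poisson_weight \<mu> k * (\<mu>\<^sup>2 * (1 - 2 * ((1 + 1 / real k) * (real k / real (k + 1))) + (1 + 1 / real k)\<^sup>2 * (real k / real (k + 2))))"
    proof -
      have "p * (\<mu>\<^sup>2 + (- 2 * \<mu> * c) * \<mu> * A + c\<^sup>2 * \<mu>\<^sup>2 * B + 0 * \<mu> ^ 3 * D) =
          p * (\<mu>\<^sup>2 * (1 - 2 * (c * A) + c\<^sup>2 * B))" for p c A B D
        by (simp add: power2_eq_square algebra_simps)
      then show ?thesis unfolding expectation_polynomial_on_count .
    qed
    also have "1 - 2 * ((1 + 1 / real k) * (real k / real (k + 1))) + (1 + 1 / real k)\<^sup>2 * (real k / real (k + 2)) =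
        (if k = 0 then 1 else 1 / (real k * (real k + 2)))"
    proof (cases "k = 0")
      case False
      then have "real k > 0" by simp
      then have "1 + 1 / real k = real (k + 1) / real k" by (simp add: field_simps)
      then have X: "(1 + 1 / real k) * (real k / real (k + 1)) = 1" using \<open>real k > 0\<close> by simp
      have Y: "(1 + 1 / real k)\<^sup>2 * (real k / real (k + 2)) = 1 + 1 / (real k * (real k + 2))"
      proof -
        define y where "y = real k"
        have y: "0 < y" using \<open>real k > 0\<close> by (simp add: y_def)
        have "(1 + 1 / y)\<^sup>2 * (y / (y + 2)) = ((y + 1) / y)\<^sup>2 * (y / (y + 2))" using y by (simp add: add_divide_distrib)
        also have "\<dots> = (y + 1)\<^sup>2 / (y * (y + 2))" using y by (simp add: power2_eq_square)
        also have "(y + 1)\<^sup>2 = y * (y + 2) + 1" by (simp add: power2_eq_square algebra_simps)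
        also have "(y * (y + 2) + 1) / (y * (y + 2)) = 1 + 1 / (y * (y + 2))" using y by (simp only: add_divide_distrib) simp
        finally show ?thesis by (simp only: y_def of_nat_add of_nat_numeral)
      qed
      show ?thesis unfolding X Y using False by simp
    qed simp
    finally show ?thesis by simp
  qed
  have poch: "pochhammer (real k + 1) 2 = (real k + 1) * (real k + 2)"
    "pochhammer (real k + 1) 3 = (real k + 1) * (real k + 2) * (real k + 3)" for k
    by (simp_all add: numeral_eq_Suc pochhammer_Suc algebra_simps)
  have pw: "0 \<le> poisson_weight \<mu> k" for k using lam_pos by (simp add: poisson_weight_nonneg)
  have lower: "?b 2 k \<le> ?a k" for k
  proof -
    have "1 / ((real k + 1) * (real k + 2)) \<le> (if k = 0 then 1 else 1 / (real k * (real k + 2)))"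
      by (auto intro!: divide_left_mono mult_right_mono)
    then have "poisson_weight \<mu> k * \<mu>\<^sup>2 * (1 / ((real k + 1) * (real k + 2))) \<le> ?a k"
      unfolding a by (intro mult_left_mono) (use pw in auto)
    then show ?thesis by (simp add: poch)
  qed
  have upper: "?a k \<le> ?b 2 k + 4 / \<mu> * ?b 3 k" for k
  proof -
    have "(if k = 0 then 1 else 1 / (real k * (real k + 2))) \<le>
      1 / ((real k + 1) * (real k + 2)) + 4 / ((real k + 1) * (real k + 2) * (real k + 3))"
    proof (cases "k = 0")
      case False
      then have k: "1 \<le> real k" by simp
      have "1 / (real k * (real k + 2)) - 1 / ((real k + 1) * (real k + 2)) = 1 / (real k * (real k + 1) * (real k + 2))"
        using k by (simp add: divide_simps)
      also have "\<dots> = (real k + 3) / (real k * ((real k + 1) * (real k + 2) * (real k + 3)))"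
        using k by (simp add: divide_simps)
      also have "\<dots> \<le> (4 * real k) / (real k * ((real k + 1) * (real k + 2) * (real k + 3)))"
        using k by (intro divide_right_mono) auto
      also have "\<dots> = 4 / ((real k + 1) * (real k + 2) * (real k + 3))"
        using k by simp
      finally show ?thesis using False by simp
    qed simp
    then have "?a k \<le> poisson_weight \<mu> k * \<mu>\<^sup>2 * (1 / ((real k + 1) * (real k + 2)) + 4 / ((real k + 1) * (real k + 2) * (real k + 3)))"
      unfolding a by (intro mult_left_mono) (use pw in auto)
    also have "\<dots> = ?b 2 k + 4 / \<mu> * ?b 3 k"
      unfolding poch using lam_pos by (simp add: power2_eq_square power3_eq_cube distrib_left)
    finally show ?thesis .
  qed
  have b2: "?b 2 sums (1 - (exp (- \<mu>) + exp (- \<mu>) * \<mu>))"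
    using poisson_inverse_factorial_moment[of \<mu> 2] by (simp add: numeral_eq_Suc poisson_weight_def)
  have b3: "?b 3 sums (1 - (\<Sum>i<3. poisson_weight \<mu> i))"
    by (rule poisson_inverse_factorial_moment)
  have "1 - (exp (- \<mu>) + exp (- \<mu>) * \<mu>) \<le> expectation (\<lambda>\<omega>. (deviation \<omega>)\<^sup>2)"
    by (rule sums_le[OF lower b2 sums])
  moreover have "exp (- \<mu>) + exp (- \<mu>) * \<mu> \<le> 4 / \<mu>"
  proof -
    have "(1 + \<mu>) * \<mu> \<le> 4 * (1 + \<mu> + \<mu>\<^sup>2 / 2)" using lam_pos by (simp add: power2_eq_square algebra_simps)
    also have "\<dots> \<le> 4 * exp \<mu>" using exp_lower_Taylor_quadratic[of \<mu>] lam_pos by simp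
    finally have "(1 + \<mu>) / exp \<mu> \<le> 4 / \<mu>" using lam_pos by (simp add: field_simps)
    then show ?thesis by (simp add: exp_minus field_simps)
  qed
  moreover have "expectation (\<lambda>\<omega>. (deviation \<omega>)\<^sup>2) \<le> 1 - (exp (- \<mu>) + exp (- \<mu>) * \<mu>) + 4 / \<mu> * (1 - (\<Sum>i<3. poisson_weight \<mu> i))"
    by (rule sums_le[OF upper sums sums_add[OF b2 sums_mult[OF b3]]])
  moreover have "4 / \<mu> * (1 - (\<Sum>i<3. poisson_weight \<mu> i)) \<le> 4 / \<mu> * 1"
    using lam_pos pw by (intro mult_left_mono) (auto intro!: sum_nonneg)
  moreover have "0 \<le> exp (- \<mu>) + exp (- \<mu>) * \<mu>" using lam_pos by simp
  ultimately show ?thesis by linarith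
qed

lemma cube_sum_le: "(x + y) ^ 3 \<le> 4 * (x ^ 3 + y ^ 3)" if "0 \<le> x" "0 \<le> y" for x y :: real
proof -
  have "0 \<le> 3 * (x + y) * (x - y)\<^sup>2" using that by simp
  also have "\<dots> = 4 * (x ^ 3 + y ^ 3) - (x + y) ^ 3" by (simp add: power2_eq_square power3_eq_cube algebra_simps)
  finally show ?thesis by simp
qed

text \<open>
  The deviation is at most \<open>(\<mu> - U) + U / N\<close> in absolute value. Given \<open>N = k\<close>, the cubes of both terms have a mean of order
  \<open>\<mu>\<^sup>3 / ((k + 1) (k + 2) (k + 3))\<close>, which averages to a constant.
\<close>
lemma deviation_third_moment: "expectation (\<lambda>\<omega>. \<bar>deviation \<omega>\<bar> ^ 3) \<le> 48"
proof -
  let ?a = "\<lambda>k. expectation (\<lambda>\<omega>. \<bar>deviation \<omega>\<bar> ^ 3 * indicator {\<omega>. N \<omega> = k} \<omega>)"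
  let ?b = "\<lambda>k. poisson_weight \<mu> k * \<mu> ^ 3 / pochhammer (real k + 1) 3"
  have int: "integrable M (\<lambda>\<omega>. \<bar>deviation \<omega>\<bar> ^ 3)"
    using integrable_abs[OF deviation_power_integrable[of 3]] by (simp add: power_abs)
  have sums: "?a sums expectation (\<lambda>\<omega>. \<bar>deviation \<omega>\<bar> ^ 3)"
    by (rule expectation_sums_by_count[OF N_meas int])
  have poch: "pochhammer (real k + 1) 3 = (real k + 1) * (real k + 2) * (real k + 3)" for k
    by (simp add: numeral_eq_Suc pochhammer_Suc algebra_simps)
  have pw: "0 \<le> poisson_weight \<mu> k" for k using lam_pos by (simp add: poisson_weight_nonneg)
  have le: "?a k \<le> 48 * ?b k" for k
  proof -
    let ?c = "1 / real k ^ 3"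
    have dev: "\<bar>deviation \<omega>\<bar> ^ 3 \<le> 4 * \<mu> ^ 3 + (- 12 * \<mu>\<^sup>2) * U \<omega> + (12 * \<mu>) * U \<omega> ^ 2 + (4 * (?c - 1)) * U \<omega> ^ 3"
      if "\<omega> \<in> space M" "N \<omega> = k" for \<omega>
    proof -
      have r: "0 \<le> U \<omega>" "U \<omega> \<le> \<mu>" using U_range that by auto
      have "\<bar>deviation \<omega>\<bar> \<le> (\<mu> - U \<omega>) + U \<omega> / real k"
      proof -
        have "deviation \<omega> = U \<omega> + U \<omega> / real k - \<mu>" using that by (simp add: deviation_def distrib_right)
        moreover have "0 \<le> U \<omega> / real k" using r by simp
        ultimately show ?thesis using r by linarith
      qed
      then have "\<bar>deviation \<omega>\<bar> ^ 3 \<le> ((\<mu> - U \<omega>) + U \<omega> / real k) ^ 3" by (intro power_mono) auto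
      also have "\<dots> \<le> 4 * ((\<mu> - U \<omega>) ^ 3 + (U \<omega> / real k) ^ 3)" using r by (intro cube_sum_le) auto
      also have "\<dots> = 4 * \<mu> ^ 3 + (- 12 * \<mu>\<^sup>2) * U \<omega> + (12 * \<mu>) * U \<omega> ^ 2 + (4 * (?c - 1)) * U \<omega> ^ 3"
        by (simp add: power2_eq_square power3_eq_cube algebra_simps)
      finally show ?thesis .
    qed
    have "?a k \<le> expectation (\<lambda>\<omega>. (4 * \<mu> ^ 3 + (- 12 * \<mu>\<^sup>2) * U \<omega> + (12 * \<mu>) * U \<omega> ^ 2 + (4 * (?c - 1)) * U \<omega> ^ 3) * indicator {\<omega>. N \<omega> = k} \<omega>)"
    proof (rule integral_mono)
      show "integrable M (\<lambda>\<omega>. \<bar>deviation \<omega>\<bar> ^ 3 * indicator {\<omega>. N \<omega> = k} \<omega>)"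
        by (rule Bochner_Integration.integrable_bound[OF int]) (auto split: split_indicator)
      have "integrable M (\<lambda>\<omega>. 4 * \<mu> ^ 3 * (U \<omega> ^ 0 * indicator {\<omega>. N \<omega> = k} \<omega>) + (- 12 * \<mu>\<^sup>2) * (U \<omega> ^ 1 * indicator {\<omega>. N \<omega> = k} \<omega>)
          + (12 * \<mu>) * (U \<omega> ^ 2 * indicator {\<omega>. N \<omega> = k} \<omega>) + (4 * (?c - 1)) * (U \<omega> ^ 3 * indicator {\<omega>. N \<omega> = k} \<omega>))"
        by (intro Bochner_Integration.integrable_add integrable_mult_right integrable_on_count)
      then show "integrable M (\<lambda>\<omega>. (4 * \<mu> ^ 3 + (- 12 * \<mu>\<^sup>2) * U \<omega> + (12 * \<mu>) * U \<omega> ^ 2 + (4 * (?c - 1)) * U \<omega> ^ 3) * indicator {\<omega>. N \<omega> = k} \<omega>)"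
        by (simp only: power_0 power_one_right mult_1_left distrib_right mult.assoc)
    qed (use dev in \<open>auto split: split_indicator\<close>)
    also have "\<dots> = poisson_weight \<mu> k * \<mu> ^ 3 * (4 * (1 - 3 * (real k / real (k + 1)) + 3 * (real k / real (k + 2)) - real k / real (k + 3))
        + 4 * (?c * (real k / real (k + 3))))"
    proof -
      have "p * (4 * \<mu> ^ 3 + (- 12 * \<mu>\<^sup>2) * \<mu> * A + (12 * \<mu>) * \<mu>\<^sup>2 * B + (4 * (c - 1)) * \<mu> ^ 3 * D) =
          p * \<mu> ^ 3 * (4 * (1 - 3 * A + 3 * B - D) + 4 * (c * D))" for p c A B D
        by (simp add: power2_eq_square power3_eq_cube algebra_simps)
      then show ?thesis unfolding expectation_polynomial_on_count .
    qed
    also have "\<dots> \<le> poisson_weight \<mu> k * \<mu> ^ 3 * (48 / ((real k + 1) * (real k + 2) * (real k + 3)))"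
    proof (intro mult_left_mono)
      have 1: "1 - 3 * (real k / real (k + 1)) + 3 * (real k / real (k + 2)) - real k / real (k + 3) =
          6 / ((real k + 1) * (real k + 2) * (real k + 3))"
        by (simp add: divide_simps) (simp add: algebra_simps)
      have 2: "?c * (real k / real (k + 3)) \<le> 6 / ((real k + 1) * (real k + 2) * (real k + 3))"
      proof (cases "k = 0")
        case False
        then have k: "1 \<le> real k" by simp
        have "(real k + 1) * (real k + 2) \<le> (2 * real k) * (3 * real k)"
          using k by (intro mult_mono) auto
        then have "1 / (real k * real k) \<le> 6 / ((real k + 1) * (real k + 2))"
          using k by (simp add: divide_simps)
        then have "1 / (real k * real k) / (real k + 3) \<le> 6 / ((real k + 1) * (real k + 2)) / (real k + 3)"
          by (intro divide_right_mono) auto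
        moreover have "?c * (real k / real (k + 3)) = 1 / (real k * real k) / (real k + 3)"
          using k by (simp add: power3_eq_cube)
        ultimately show ?thesis by simp
      qed simp
      show "4 * (1 - 3 * (real k / real (k + 1)) + 3 * (real k / real (k + 2)) - real k / real (k + 3))
        + 4 * (?c * (real k / real (k + 3))) \<le> 48 / ((real k + 1) * (real k + 2) * (real k + 3))"
        unfolding 1 using 2 by linarith
    qed (use pw lam_pos in auto)
    finally show ?thesis by (simp add: poch mult.commute mult.left_commute)
  qed
  have "expectation (\<lambda>\<omega>. \<bar>deviation \<omega>\<bar> ^ 3) \<le> 48 * (1 - (\<Sum>i<3. poisson_weight \<mu> i))"
    by (rule sums_le[OF le sums sums_mult[OF poisson_inverse_factorial_moment]])
  also have "\<dots> \<le> 48 * 1" using pw by (intro mult_left_mono) (auto intro!: sum_nonneg)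
  finally show ?thesis by simp
qed

lemma deviation_abs_moment: "expectation (\<lambda>\<omega>. \<bar>deviation \<omega>\<bar>) \<le> 49"
proof -
  have int: "integrable M (\<lambda>\<omega>. \<bar>deviation \<omega>\<bar> ^ 3)" "integrable M (\<lambda>\<omega>. \<bar>deviation \<omega>\<bar>)"
    using integrable_abs[OF deviation_power_integrable[of 3]] integrable_abs[OF deviation_power_integrable[of 1]]
    by (simp_all add: power_abs)
  have "expectation (\<lambda>\<omega>. \<bar>deviation \<omega>\<bar>) \<le> expectation (\<lambda>\<omega>. 1 + \<bar>deviation \<omega>\<bar> ^ 3)"
  proof (rule integral_mono)
    fix \<omega>
    show "\<bar>deviation \<omega>\<bar> \<le> 1 + \<bar>deviation \<omega>\<bar> ^ 3"
    proof (cases "\<bar>deviation \<omega>\<bar> \<le> 1")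
      case False
      then have "\<bar>deviation \<omega>\<bar> \<le> \<bar>deviation \<omega>\<bar> ^ 3" by (intro self_le_power) auto
      then show ?thesis by simp
    qed (simp add: add_increasing2)
  qed (use int in auto)
  also have "\<dots> = 1 + expectation (\<lambda>\<omega>. \<bar>deviation \<omega>\<bar> ^ 3)"
    using int by (subst Bochner_Integration.integral_add) (auto simp: prob_space)
  finally show ?thesis using deviation_third_moment by simp
qed

lemma exp_minus_linear_approx: "\<bar>exp (- y) - (1 - y)\<bar> \<le> y\<^sup>2 / 2" if "0 \<le> y" for y :: real
proof -
  have "1 - y \<le> exp (- y)" using exp_ge_add_one_self[of "- y"] by simp
  moreover have "exp (- y) \<le> 1 - y + y\<^sup>2 / 2"
  proof -
    have "1 \<le> 1 + y ^ 4 / 4" by simp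
    also have "\<dots> = (1 - y + y\<^sup>2 / 2) * (1 + y + y\<^sup>2 / 2)"
      by (simp add: power2_eq_square power4_eq_xxxx algebra_simps)
    also have "\<dots> \<le> (1 - y + y\<^sup>2 / 2) * exp y"
    proof (rule mult_left_mono)
      have "0 \<le> ((1 - y)\<^sup>2 + 1) / 2" by simp
      then show "0 \<le> 1 - y + y\<^sup>2 / 2" by (simp add: power2_eq_square algebra_simps diff_divide_distrib add_divide_distrib)
    qed (use exp_lower_Taylor_quadratic[OF that] in simp)
    finally show ?thesis by (simp add: exp_minus field_simps)
  qed
  ultimately show ?thesis by linarith
qed

text \<open>
  Second-order expansion of the characteristic function. The four terms come from the mean, from the defect of the variance, from the third moment
  and from the expansion of the Gaussian exponential.
\<close>
lemma deviation_char:
  "cmod (char (distr M borel deviation) t - complex_of_real (exp (- t\<^sup>2 / 2))) \<le>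
    \<bar>t\<bar> * (\<mu> * exp (- \<mu>)) + 2 * t\<^sup>2 / \<mu> + 8 * \<bar>t\<bar> ^ 3 + t ^ 4 / 8"
proof -
  let ?D = "distr M borel deviation"
  interpret D: real_distribution ?D by (rule real_distribution_distr) measurable
  have int: "integrable ?D (\<lambda>x. x ^ j)" for j
    by (subst integrable_distr_eq) (auto intro: deviation_power_integrable)
  have moment: "D.expectation (\<lambda>x. x ^ j) = expectation (\<lambda>\<omega>. deviation \<omega> ^ j)" for j
    by (subst integral_distr) auto
  define m2 where "m2 = expectation (\<lambda>\<omega>. (deviation \<omega>)\<^sup>2)"
  define T where "T = (\<Sum>j\<le>2. ((\<i> * complex_of_real t) ^ j / fact j) * complex_of_real (D.expectation (\<lambda>x. x ^ j)))"
  have T: "T = complex_of_real (1 - t\<^sup>2 / 2 * m2) + \<i> * complex_of_real (- (t * (\<mu> * exp (- \<mu>))))"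
    unfolding T_def moment using deviation_mean
    by (simp add: numeral_eq_Suc m2_def prob_space power_mult_distrib)
  have third: "integrable ?D (\<lambda>x. \<bar>t\<bar> * \<bar>x\<bar> ^ 3)"
    using integrable_abs[OF int[of 3]] by (simp add: power_abs)
  have "cmod (char ?D t - T) \<le> \<bar>t\<bar>\<^sup>2 / fact (Suc 2) * D.expectation (\<lambda>x. min (2 * \<bar>x\<bar>\<^sup>2 * real (Suc 2)) (\<bar>t\<bar> * \<bar>x\<bar> ^ Suc 2))"
    unfolding T_def by (rule D.char_approx2) (rule int)
  also have "\<dots> \<le> \<bar>t\<bar>\<^sup>2 / fact (Suc 2) * D.expectation (\<lambda>x. \<bar>t\<bar> * \<bar>x\<bar> ^ 3)"
  proof (rule mult_left_mono, rule integral_mono_AE)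
    show "integrable ?D (\<lambda>x. min (2 * \<bar>x\<bar>\<^sup>2 * real (Suc 2)) (\<bar>t\<bar> * \<bar>x\<bar> ^ Suc 2))"
      by (rule Bochner_Integration.integrable_bound[OF third]) (auto simp: numeral_eq_Suc)
  qed (use third in \<open>auto simp: numeral_eq_Suc\<close>)
  also have "D.expectation (\<lambda>x. \<bar>t\<bar> * \<bar>x\<bar> ^ 3) = \<bar>t\<bar> * expectation (\<lambda>\<omega>. \<bar>deviation \<omega>\<bar> ^ 3)"
    by (subst integral_distr) auto
  also have "\<bar>t\<bar>\<^sup>2 / fact (Suc 2) * (\<bar>t\<bar> * expectation (\<lambda>\<omega>. \<bar>deviation \<omega>\<bar> ^ 3)) \<le> \<bar>t\<bar>\<^sup>2 / fact (Suc 2) * (\<bar>t\<bar> * 48)"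
    by (intro mult_left_mono deviation_third_moment) auto
  also have "\<dots> = 8 * \<bar>t\<bar> ^ 3" by (simp add: fact_numeral power2_eq_square power3_eq_cube)
  finally have 1: "cmod (char ?D t - T) \<le> 8 * \<bar>t\<bar> ^ 3" .
  have "T - complex_of_real (exp (- t\<^sup>2 / 2)) = complex_of_real ((1 - t\<^sup>2 / 2) - exp (- t\<^sup>2 / 2)) + complex_of_real (t\<^sup>2 / 2 * (1 - m2))
      + \<i> * complex_of_real (- (t * (\<mu> * exp (- \<mu>))))"
  proof -
    have "(1 - t\<^sup>2 / 2 * m2) - exp (- t\<^sup>2 / 2) = ((1 - t\<^sup>2 / 2) - exp (- t\<^sup>2 / 2)) + t\<^sup>2 / 2 * (1 - m2)"
      by (simp only: right_diff_distrib)
    then have "complex_of_real (1 - t\<^sup>2 / 2 * m2) - complex_of_real (exp (- t\<^sup>2 / 2)) =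
        complex_of_real ((1 - t\<^sup>2 / 2) - exp (- t\<^sup>2 / 2)) + complex_of_real (t\<^sup>2 / 2 * (1 - m2))"
      by (simp only: of_real_diff[symmetric] of_real_add[symmetric])
    moreover have "a + d - b = e + d" if "a - b = e" for a b d e :: complex using that by auto
    ultimately show ?thesis unfolding T by blast
  qed
  also have "cmod \<dots> \<le> cmod (complex_of_real ((1 - t\<^sup>2 / 2) - exp (- t\<^sup>2 / 2))) + cmod (complex_of_real (t\<^sup>2 / 2 * (1 - m2)))
      + cmod (\<i> * complex_of_real (- (t * (\<mu> * exp (- \<mu>)))))"
    by (intro norm_triangle_le add_mono) auto
  also have "\<dots> = \<bar>exp (- (t\<^sup>2 / 2)) - (1 - t\<^sup>2 / 2)\<bar> + t\<^sup>2 / 2 * \<bar>m2 - 1\<bar> + \<bar>t\<bar> * (\<mu> * exp (- \<mu>))"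
    using lam_pos by (simp add: norm_mult abs_mult abs_minus_commute del: of_real_diff of_real_mult of_real_minus)
  also have "\<dots> \<le> t ^ 4 / 8 + t\<^sup>2 / 2 * (4 / \<mu>) + \<bar>t\<bar> * (\<mu> * exp (- \<mu>))"
  proof (intro add_mono mult_left_mono)
    show "\<bar>exp (- (t\<^sup>2 / 2)) - (1 - t\<^sup>2 / 2)\<bar> \<le> t ^ 4 / 8"
      using exp_minus_linear_approx[of "t\<^sup>2 / 2"] by (simp add: power_divide)
    show "\<bar>m2 - 1\<bar> \<le> 4 / \<mu>" unfolding m2_def by (rule deviation_second_moment)
  qed (use lam_pos in auto)
  finally have 2: "cmod (T - complex_of_real (exp (- t\<^sup>2 / 2))) \<le> t ^ 4 / 8 + t\<^sup>2 / 2 * (4 / \<mu>) + \<bar>t\<bar> * (\<mu> * exp (- \<mu>))" .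
  have "cmod (char ?D t - complex_of_real (exp (- t\<^sup>2 / 2))) \<le> cmod (char ?D t - T) + cmod (T - complex_of_real (exp (- t\<^sup>2 / 2)))"
    using norm_triangle_ineq[of "char ?D t - T" "T - complex_of_real (exp (- t\<^sup>2 / 2))"] by simp
  with 1 2 show ?thesis by simp
qed

end

section \<open>A central limit theorem for rows of deviations\<close>

text \<open>
  Products of numbers in the unit disc differ by at most the sum of the differences of the factors. The mean term is bounded
  by \<open>m exp(-m)\<close> because \<open>y exp(-y)\<close> decreases for \<open>y \<ge> 1\<close>.
\<close>
lemma (in prob_space) array_char_bound:
  fixes Z :: "nat \<Rightarrow> 'a \<Rightarrow> real" and b \<mu> :: "nat \<Rightarrow> real"
  assumes J: "finite J" and indep: "indep_vars (\<lambda>_. borel) Z J"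
    and char: "\<And>r t. r \<in> J \<Longrightarrow> cmod (char (distr M borel (Z r)) t - complex_of_real (exp (- t\<^sup>2 / 2))) \<le>
      \<bar>t\<bar> * (\<mu> r * exp (- \<mu> r)) + 2 * t\<^sup>2 / \<mu> r + 8 * \<bar>t\<bar> ^ 3 + t ^ 4 / 8"
    and \<mu>: "\<And>r. r \<in> J \<Longrightarrow> m \<le> \<mu> r" and m: "1 \<le> m"
    and b: "\<And>r. r \<in> J \<Longrightarrow> \<bar>b r\<bar> \<le> \<beta>"
  shows "cmod ((CLINT \<omega>|M. iexp (\<Sum>r\<in>J. b r * Z r \<omega>)) - complex_of_real (exp (- (\<Sum>r\<in>J. (b r)\<^sup>2) / 2))) \<le>
    (\<Sum>r\<in>J. \<bar>b r\<bar>) * (m * exp (- m)) + (\<Sum>r\<in>J. (b r)\<^sup>2) * (2 / m + 8 * \<beta> + \<beta>\<^sup>2 / 8)"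
proof -
  have meas[measurable]: "Z r \<in> borel_measurable M" if "r \<in> J" for r
    using indep that by (simp add: indep_vars_def2)
  have dec: "y * exp (- y) \<le> m * exp (- m)" if "m \<le> y" for y
  proof -
    have "1 + (y - m) \<le> exp (y - m)" by (rule exp_ge_add_one_self)
    moreover have "y \<le> m * (1 + (y - m))"
    proof -
      have "1 * (y - m) \<le> m * (y - m)" using m that by (intro mult_right_mono) auto
      then show ?thesis by (simp add: algebra_simps)
    qed
    ultimately have "y \<le> m * exp (y - m)" using m by (meson mult_left_mono order_trans zero_le_one)
    then have "y * exp (- y) \<le> (m * exp (y - m)) * exp (- y)" by (intro mult_right_mono) auto
    also have "\<dots> = m * exp (- m)" by (simp add: mult.assoc exp_add[symmetric])
    finally show ?thesis .
  qed
  have ind: "indep_vars (\<lambda>_. borel) (\<lambda>r \<omega>. b r * Z r \<omega>) J"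
    by (rule indep_vars_compose2[OF indep]) measurable
  have scale: "char (distr M borel (\<lambda>\<omega>. b r * Z r \<omega>)) 1 = char (distr M borel (Z r)) (b r)" if "r \<in> J" for r
  proof -
    note [measurable] = meas[OF that]
    have "char (distr M borel (\<lambda>\<omega>. b r * Z r \<omega>)) 1 = (CLINT \<omega>|M. iexp (1 * (b r * Z r \<omega>)))"
      unfolding char_def by (rule integral_distr) measurable
    also have "\<dots> = char (distr M borel (Z r)) (b r)"
      unfolding char_def mult_1 by (rule integral_distr[symmetric]) measurable
    finally show ?thesis .
  qed
  have sm: "(\<lambda>\<omega>. \<Sum>r\<in>J. b r * Z r \<omega>) \<in> borel_measurable M"
    by (intro borel_measurable_sum borel_measurable_times borel_measurable_const meas)
  have "(CLINT \<omega>|M. iexp (\<Sum>r\<in>J. b r * Z r \<omega>)) = char (distr M borel (\<lambda>\<omega>. \<Sum>r\<in>J. b r * Z r \<omega>)) 1"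
    unfolding char_def using sm by (subst integral_distr) simp_all
  also have "\<dots> = (\<Prod>r\<in>J. char (distr M borel (Z r)) (b r))"
    unfolding char_distr_sum[OF ind] by (rule prod.cong[OF refl scale])
  finally have lhs: "(CLINT \<omega>|M. iexp (\<Sum>r\<in>J. b r * Z r \<omega>)) = (\<Prod>r\<in>J. char (distr M borel (Z r)) (b r))" .
  have rhs: "complex_of_real (exp (- (\<Sum>r\<in>J. (b r)\<^sup>2) / 2)) = (\<Prod>r\<in>J. complex_of_real (exp (- (b r)\<^sup>2 / 2)))"
    by (simp only: of_real_prod[symmetric] exp_sum[OF J, symmetric] sum_divide_distrib[symmetric] sum_negf)
  have "cmod ((\<Prod>r\<in>J. char (distr M borel (Z r)) (b r)) - (\<Prod>r\<in>J. complex_of_real (exp (- (b r)\<^sup>2 / 2)))) \<le>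
      (\<Sum>r\<in>J. cmod (char (distr M borel (Z r)) (b r) - complex_of_real (exp (- (b r)\<^sup>2 / 2))))"
  proof (rule norm_prod_diff)
    fix r assume r: "r \<in> J"
    interpret D: real_distribution "distr M borel (Z r)"
      by (rule real_distribution_distr[OF meas[OF r]])
    show "cmod (char (distr M borel (Z r)) (b r)) \<le> 1" by (rule D.cmod_char_le_1)
  qed simp
  also have "\<dots> \<le> (\<Sum>r\<in>J. \<bar>b r\<bar> * (m * exp (- m)) + (b r)\<^sup>2 * (2 / m + 8 * \<beta> + \<beta>\<^sup>2 / 8))"
  proof (rule sum_mono)
    fix r assume r: "r \<in> J"
    have \<beta>: "0 \<le> \<beta>" using b[OF r] by linarith
    have "\<bar>b r\<bar> * (\<mu> r * exp (- \<mu> r)) \<le> \<bar>b r\<bar> * (m * exp (- m))"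
      by (intro mult_left_mono dec[OF \<mu>[OF r]]) simp
    moreover have "2 * (b r)\<^sup>2 / \<mu> r \<le> (b r)\<^sup>2 * (2 / m)"
    proof -
      have "2 / \<mu> r \<le> 2 / m" using \<mu>[OF r] m by (intro divide_left_mono) auto
      then have "(b r)\<^sup>2 * (2 / \<mu> r) \<le> (b r)\<^sup>2 * (2 / m)" by (intro mult_left_mono) auto
      then show ?thesis by (simp add: mult.commute)
    qed
    moreover have "8 * \<bar>b r\<bar> ^ 3 \<le> (b r)\<^sup>2 * (8 * \<beta>)"
    proof -
      have "(b r)\<^sup>2 * \<bar>b r\<bar> \<le> (b r)\<^sup>2 * \<beta>" using b[OF r] by (intro mult_left_mono) auto
      moreover have "(b r)\<^sup>2 * \<bar>b r\<bar> = \<bar>b r\<bar> ^ 3" by (simp add: power3_eq_cube power2_eq_square abs_mult[symmetric])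
      ultimately show ?thesis by simp
    qed
    moreover have "(b r) ^ 4 / 8 \<le> (b r)\<^sup>2 * (\<beta>\<^sup>2 / 8)"
    proof -
      have "(b r)\<^sup>2 \<le> \<beta>\<^sup>2" using b[OF r] \<beta> by (simp add: abs_le_square_iff[symmetric])
      then have "(b r)\<^sup>2 * (b r)\<^sup>2 \<le> (b r)\<^sup>2 * \<beta>\<^sup>2" by (intro mult_left_mono) auto
      then show ?thesis by (simp add: power4_eq_xxxx power2_eq_square mult.assoc)
    qed
    ultimately show "cmod (char (distr M borel (Z r)) (b r) - complex_of_real (exp (- (b r)\<^sup>2 / 2))) \<le>
        \<bar>b r\<bar> * (m * exp (- m)) + (b r)\<^sup>2 * (2 / m + 8 * \<beta> + \<beta>\<^sup>2 / 8)"
      using char[OF r, of "b r"] unfolding distrib_left by linarith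
  qed
  also have "\<dots> = (\<Sum>r\<in>J. \<bar>b r\<bar>) * (m * exp (- m)) + (\<Sum>r\<in>J. (b r)\<^sup>2) * (2 / m + 8 * \<beta> + \<beta>\<^sup>2 / 8)"
    by (simp only: sum.distrib sum_distrib_right)
  finally show ?thesis unfolding lhs rhs .
qed

text \<open>
  Central limit theorem for rows of independent deviations. Letting \<open>m\<close> tend to infinity removes the variance defect, \<open>\<beta>\<close> tending to
  zero takes the place of the Lindeberg condition, and the hypothesis on \<open>m exp(-m)\<close> removes the means.
\<close>
lemma (in prob_space) array_clt:
  fixes Z :: "nat \<Rightarrow> nat \<Rightarrow> 'a \<Rightarrow> real" and b \<mu> :: "nat \<Rightarrow> nat \<Rightarrow> real" and k :: "nat \<Rightarrow> nat"
  assumes indep: "\<And>n. 1 \<le> n \<Longrightarrow> indep_vars (\<lambda>_. borel) (Z n) {1..k n}"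
    and char: "\<And>n r t. 1 \<le> n \<Longrightarrow> r \<in> {1..k n} \<Longrightarrow>
      cmod (char (distr M borel (Z n r)) t - complex_of_real (exp (- t\<^sup>2 / 2))) \<le>
      \<bar>t\<bar> * (\<mu> n r * exp (- \<mu> n r)) + 2 * t\<^sup>2 / \<mu> n r + 8 * \<bar>t\<bar> ^ 3 + t ^ 4 / 8"
    and \<mu>: "\<And>n r. 1 \<le> n \<Longrightarrow> r \<in> {1..k n} \<Longrightarrow> m n \<le> \<mu> n r" and m: "filterlim m at_top sequentially"
    and b: "\<And>n r. 1 \<le> n \<Longrightarrow> r \<in> {1..k n} \<Longrightarrow> \<bar>b n r\<bar> \<le> \<beta> n" and \<beta>: "\<beta> \<longlonglongrightarrow> 0"
    and bias: "(\<lambda>n. (\<Sum>r=1..k n. \<bar>b n r\<bar>) * (m n * exp (- m n))) \<longlonglongrightarrow> 0"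
    and var: "(\<lambda>n. \<Sum>r=1..k n. (b n r)\<^sup>2) \<longlonglongrightarrow> s"
  shows "(\<lambda>n. CLINT \<omega>|M. iexp (\<Sum>r=1..k n. b n r * Z n r \<omega>)) \<longlonglongrightarrow> complex_of_real (exp (- s / 2))"
proof -
  let ?B = "\<lambda>n. \<Sum>r=1..k n. (b n r)\<^sup>2"
  let ?err = "\<lambda>n. (\<Sum>r=1..k n. \<bar>b n r\<bar>) * (m n * exp (- m n)) + ?B n * (2 / m n + 8 * \<beta> n + (\<beta> n)\<^sup>2 / 8)"
  have inv: "(\<lambda>n. 2 / m n) \<longlonglongrightarrow> 0" by (rule real_tendsto_divide_at_top[OF tendsto_const m])
  have "?err \<longlonglongrightarrow> 0 + s * (0 + 8 * 0 + 0\<^sup>2 / 8)" by (intro tendsto_intros bias var inv \<beta>) simp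
  then have err: "?err \<longlonglongrightarrow> 0" by simp
  have "(\<lambda>n. (CLINT \<omega>|M. iexp (\<Sum>r=1..k n. b n r * Z n r \<omega>)) - complex_of_real (exp (- ?B n / 2))) \<longlonglongrightarrow> 0"
  proof (rule Lim_null_comparison[OF _ err])
    show "\<forall>\<^sub>F n in sequentially. cmod ((CLINT \<omega>|M. iexp (\<Sum>r=1..k n. b n r * Z n r \<omega>)) - complex_of_real (exp (- ?B n / 2))) \<le> ?err n"
      using eventually_ge_at_top[of "1::nat"] m[unfolded filterlim_at_top, rule_format, of 1]
    proof eventually_elim
      case (elim n)
      show ?case by (rule array_char_bound[OF finite_atLeastAtMost indep char \<mu> _ b]) (use elim in auto)
    qed
  qed
  moreover have "(\<lambda>n. complex_of_real (exp (- ?B n / 2))) \<longlonglongrightarrow> complex_of_real (exp (- s / 2))"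
    by (intro tendsto_intros var) simp
  ultimately have "(\<lambda>n. ((CLINT \<omega>|M. iexp (\<Sum>r=1..k n. b n r * Z n r \<omega>)) - complex_of_real (exp (- ?B n / 2)))
      + complex_of_real (exp (- ?B n / 2))) \<longlonglongrightarrow> 0 + complex_of_real (exp (- s / 2))"
    by (rule tendsto_add)
  then show ?thesis by (simp only: diff_add_cancel add_0)
qed

section \<open>Essential bounds of the edge on a cell\<close>

text \<open>
  The infimum is approached by countably many thresholds \<open>\<alpha>\<close>, each exceeded on a null set only.
\<close>
lemma AE_le_ess_sup_on:
  assumes [measurable]: "f \<in> borel_measurable \<nu>" "A \<in> sets \<nu>" and fin: "ess_sup_on \<nu> f A < \<infinity>"
  shows "AE x in \<nu>. x \<in> A \<longrightarrow> f x \<le> enn2real (ess_sup_on \<nu> f A)"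
proof -
  define s where "s = enn2real (ess_sup_on \<nu> f A)"
  have s: "ess_sup_on \<nu> f A = ennreal s" using fin by (simp add: s_def less_top)
  have "AE x in \<nu>. x \<in> A \<longrightarrow> f x \<le> s + 1 / real (Suc n)" for n
  proof -
    have "ennreal s < ennreal (s + 1 / real (Suc n))"
      by (rule ennreal_lessI) (simp_all add: s_def add_nonneg_pos)
    then have "Inf {ennreal \<alpha> | \<alpha>. 0 < \<alpha> \<and> emeasure \<nu> ({x \<in> space \<nu>. f x > \<alpha>} \<inter> A) = 0} < ennreal (s + 1 / real (Suc n))"
      unfolding s[symmetric] ess_sup_on_def .
    then obtain \<alpha> where \<alpha>: "0 < \<alpha>" "emeasure \<nu> ({x \<in> space \<nu>. f x > \<alpha>} \<inter> A) = 0" "ennreal \<alpha> < ennreal (s + 1 / real (Suc n))"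
      by (auto simp: Inf_less_iff)
    have lt: "\<alpha> < s + 1 / real (Suc n)" using \<alpha>(1,3) by (simp add: ennreal_less_iff)
    have "AE x in \<nu>. \<not> (x \<in> {x \<in> space \<nu>. f x > \<alpha>} \<inter> A)"
      by (rule AE_not_in) (use \<alpha>(2) in \<open>auto simp: null_sets_def\<close>)
    with AE_space show ?thesis by eventually_elim (use lt in auto)
  qed
  then have "AE x in \<nu>. \<forall>n. x \<in> A \<longrightarrow> f x \<le> s + 1 / real (Suc n)" unfolding AE_all_countable by blast
  then show ?thesis
  proof eventually_elim
    case (elim x)
    show ?case
    proof
      assume "x \<in> A"
      have "(\<lambda>n. s + 1 / real (Suc n)) \<longlonglongrightarrow> s + 0"
        by (intro tendsto_add tendsto_const LIMSEQ_Suc[OF lim_1_over_n])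
      then show "f x \<le> enn2real (ess_sup_on \<nu> f A)"
        unfolding s_def[symmetric] using elim \<open>x \<in> A\<close> by (intro LIMSEQ_le_const) auto
    qed
  qed
qed

text \<open>
  If the supremum is infinite, its conversion to a real number is \<open>0\<close>, and the claim is the positivity of \<open>f\<close>.
\<close>
lemma AE_ess_inf_on_le:
  assumes [measurable]: "f \<in> borel_measurable \<nu>" "A \<in> sets \<nu>" and nonneg: "\<And>x. x \<in> space \<nu> \<Longrightarrow> 0 \<le> f x"
  shows "AE x in \<nu>. x \<in> A \<longrightarrow> enn2real (ess_inf_on \<nu> f A) \<le> f x"
proof (cases "ess_inf_on \<nu> f A = \<infinity> \<or> ess_inf_on \<nu> f A = 0")
  case True
  then show ?thesis using nonneg by auto
next
  case False
  define s where "s = enn2real (ess_inf_on \<nu> f A)"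
  have s: "ess_inf_on \<nu> f A = ennreal s" using False by (simp add: s_def less_top)
  have s_pos: "0 < s" using False s by (auto intro: ccontr simp: ennreal_neg not_less)
  have "AE x in \<nu>. x \<in> A \<longrightarrow> s - 1 / real (Suc n) \<le> f x" for n
  proof -
    have "ennreal (s - 1 / real (Suc n)) < ennreal s"
      using s_pos by (cases "0 \<le> s - 1 / real (Suc n)") (simp_all add: ennreal_less_iff ennreal_neg)
    then have "ennreal (s - 1 / real (Suc n)) < Sup {ennreal \<alpha> | \<alpha>. 0 < \<alpha> \<and> emeasure \<nu> ({x \<in> space \<nu>. f x < \<alpha>} \<inter> A) = 0}"
      unfolding s[symmetric] ess_inf_on_def .
    then obtain \<alpha> where \<alpha>: "0 < \<alpha>" "emeasure \<nu> ({x \<in> space \<nu>. f x < \<alpha>} \<inter> A) = 0" "ennreal (s - 1 / real (Suc n)) < ennreal \<alpha>"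
      by (auto simp: less_Sup_iff)
    have lt: "s - 1 / real (Suc n) < \<alpha>" using \<alpha>(1,3)
      by (cases "0 \<le> s - 1 / real (Suc n)") (simp_all add: ennreal_less_iff)
    have "AE x in \<nu>. \<not> (x \<in> {x \<in> space \<nu>. f x < \<alpha>} \<inter> A)"
      by (rule AE_not_in) (use \<alpha>(2) in \<open>auto simp: null_sets_def\<close>)
    with AE_space show ?thesis by eventually_elim (use lt in auto)
  qed
  then have "AE x in \<nu>. \<forall>n. x \<in> A \<longrightarrow> s - 1 / real (Suc n) \<le> f x" unfolding AE_all_countable by blast
  then show ?thesis
  proof eventually_elim
    case (elim x)
    show ?case
    proof
      assume "x \<in> A"
      have "(\<lambda>n. s - 1 / real (Suc n)) \<longlonglongrightarrow> s - 0"
        by (intro tendsto_diff tendsto_const LIMSEQ_Suc[OF lim_1_over_n])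
      then show "enn2real (ess_inf_on \<nu> f A) \<le> f x"
        unfolding s_def[symmetric] using elim \<open>x \<in> A\<close> by (intro LIMSEQ_le_const2) auto
    qed
  qed
qed

lemma ess_sup_on_mono:
  assumes [measurable]: "f \<in> borel_measurable \<nu>" "A \<in> sets \<nu>" "B \<in> sets \<nu>" and "A \<subseteq> B"
  shows "ess_sup_on \<nu> f A \<le> ess_sup_on \<nu> f B"
proof -
  have "emeasure \<nu> ({x \<in> space \<nu>. f x > \<alpha>} \<inter> A) = 0" if "emeasure \<nu> ({x \<in> space \<nu>. f x > \<alpha>} \<inter> B) = 0" for \<alpha>
  proof -
    have "emeasure \<nu> ({x \<in> space \<nu>. f x > \<alpha>} \<inter> A) \<le> emeasure \<nu> ({x \<in> space \<nu>. f x > \<alpha>} \<inter> B)"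
      using \<open>A \<subseteq> B\<close> by (intro emeasure_mono) auto
    then show ?thesis using that by simp
  qed
  then show ?thesis unfolding ess_sup_on_def by (intro Inf_superset_mono) auto
qed

lemma ess_inf_on_mono:
  assumes [measurable]: "f \<in> borel_measurable \<nu>" "A \<in> sets \<nu>" "B \<in> sets \<nu>" and "A \<subseteq> B"
  shows "ess_inf_on \<nu> f B \<le> ess_inf_on \<nu> f A"
proof -
  have "emeasure \<nu> ({x \<in> space \<nu>. f x < \<alpha>} \<inter> A) = 0" if "emeasure \<nu> ({x \<in> space \<nu>. f x < \<alpha>} \<inter> B) = 0" for \<alpha>
  proof -
    have "emeasure \<nu> ({x \<in> space \<nu>. f x < \<alpha>} \<inter> A) \<le> emeasure \<nu> ({x \<in> space \<nu>. f x < \<alpha>} \<inter> B)"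
      using \<open>A \<subseteq> B\<close> by (intro emeasure_mono) auto
    then show ?thesis using that by simp
  qed
  then show ?thesis unfolding ess_inf_on_def by (intro Sup_subset_mono) auto
qed

locale bounded_edge = prob_space \<nu> for \<nu> :: "'a measure" +
  fixes f :: "'a \<Rightarrow> real"
  assumes f_meas[measurable]: "f \<in> borel_measurable \<nu>"
    and f_nonneg: "\<And>x. x \<in> space \<nu> \<Longrightarrow> 0 \<le> f x"
    and inf_pos: "0 < ess_inf_on \<nu> f (space \<nu>)"
    and sup_finite: "ess_sup_on \<nu> f (space \<nu>) < \<infinity>"
begin

abbreviation "lo A \<equiv> enn2real (ess_inf_on \<nu> f A)"
abbreviation "hi A \<equiv> enn2real (ess_sup_on \<nu> f A)"

lemma cell_sup_finite: "A \<in> sets \<nu> \<Longrightarrow> ess_sup_on \<nu> f A < \<infinity>"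
  using ess_sup_on_mono[OF f_meas, of A "space \<nu>"] sup_finite sets.sets_into_space by (force intro: le_less_trans)

lemma AE_le_hi: "A \<in> sets \<nu> \<Longrightarrow> AE x in \<nu>. x \<in> A \<longrightarrow> f x \<le> hi A"
  by (rule AE_le_ess_sup_on[OF f_meas _ cell_sup_finite])

lemma AE_lo_le: "A \<in> sets \<nu> \<Longrightarrow> AE x in \<nu>. x \<in> A \<longrightarrow> lo A \<le> f x"
  by (rule AE_ess_inf_on_le[OF f_meas _ f_nonneg])

lemma AE_le_max: "AE x in \<nu>. f x \<le> hi (space \<nu>)"
  using AE_le_hi[OF sets.top] by (auto elim!: AE_mp intro!: AE_I2)

text \<open>
  On a cell of positive measure every admissible lower threshold is below some value of \<open>f\<close>, hence below the essential supremum.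
\<close>
lemma cell_inf_finite:
  assumes A[measurable]: "A \<in> sets \<nu>" and pos: "0 < measure \<nu> A"
  shows "ess_inf_on \<nu> f A \<le> ennreal (hi A)"
  unfolding ess_inf_on_def
proof (rule Sup_least)
  fix a assume "a \<in> {ennreal \<alpha> | \<alpha>. 0 < \<alpha> \<and> emeasure \<nu> ({x \<in> space \<nu>. f x < \<alpha>} \<inter> A) = 0}"
  then obtain \<alpha> where \<alpha>: "a = ennreal \<alpha>" "emeasure \<nu> ({x \<in> space \<nu>. f x < \<alpha>} \<inter> A) = 0" by auto
  have "AE x in \<nu>. \<not> (x \<in> {x \<in> space \<nu>. f x < \<alpha>} \<inter> A)"
    by (rule AE_not_in) (use \<alpha>(2) in \<open>auto simp: null_sets_def\<close>)
  then have "AE x in \<nu>. x \<in> A \<longrightarrow> \<alpha> \<le> hi A"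
    using AE_le_hi[OF A] AE_space by eventually_elim auto
  then have "\<alpha> \<le> hi A"
  proof (rule contrapos_pp)
    assume "\<not> \<alpha> \<le> hi A"
    then show "\<not> (AE x in \<nu>. x \<in> A \<longrightarrow> \<alpha> \<le> hi A)"
      using pos AE_iff_null_sets[OF A] by (auto simp: null_sets_def emeasure_eq_measure)
  qed
  then show "a \<le> ennreal (hi A)" unfolding \<alpha> by (rule ennreal_leI)
qed

lemma lo_space_pos: "0 < lo (space \<nu>)"
proof -
  have "ess_inf_on \<nu> f (space \<nu>) \<le> ennreal (hi (space \<nu>))"
    by (rule cell_inf_finite) (simp_all add: prob_space)
  then show ?thesis using inf_pos by (simp add: enn2real_positive_iff le_less_trans[OF _ ennreal_less_top])
qed

lemma lo_mono:
  assumes "A \<in> sets \<nu>" "0 < measure \<nu> A"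
  shows "lo (space \<nu>) \<le> lo A"
proof (rule enn2real_mono)
  show "ess_inf_on \<nu> f (space \<nu>) \<le> ess_inf_on \<nu> f A"
    using assms by (intro ess_inf_on_mono) (auto dest: sets.sets_into_space)
  show "ess_inf_on \<nu> f A < top"
    by (rule le_less_trans[OF cell_inf_finite[OF assms]]) simp
qed

lemma lo_pos: "A \<in> sets \<nu> \<Longrightarrow> 0 < measure \<nu> A \<Longrightarrow> 0 < lo A"
  using lo_mono lo_space_pos by (rule less_le_trans[rotated])

lemma lo_le_hi:
  assumes "A \<in> sets \<nu>" "0 < measure \<nu> A"
  shows "lo A \<le> hi A"
  using enn2real_mono[OF cell_inf_finite[OF assms]] by simp

lemma osc_eq: "ess_osc_on \<nu> f A = hi A - lo A"
  by (simp add: ess_osc_on_def)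

lemma integrable_below:
  assumes [measurable]: "g \<in> borel_measurable \<nu>" and g: "\<And>x. x \<in> space \<nu> \<Longrightarrow> 0 \<le> g x \<and> g x \<le> f x"
    and [measurable]: "A \<in> sets \<nu>"
  shows "set_integrable \<nu> A g"
  unfolding set_integrable_def
proof (rule integrable_const_bound[where B="hi (space \<nu>)"])
  show "AE x in \<nu>. norm (indicat_real A x *\<^sub>R g x) \<le> hi (space \<nu>)"
    using AE_le_max AE_space
  proof eventually_elim
    case (elim x)
    then show ?case using g[of x] by (auto split: split_indicator)
  qed
qed measurable

lemma set_integral_const: "A \<in> sets \<nu> \<Longrightarrow> (LINT x:A|\<nu>. c) = measure \<nu> A * (c::real)"
  by (simp add: set_lebesgue_integral_def)

lemma set_integrable_const: "A \<in> sets \<nu> \<Longrightarrow> set_integrable \<nu> A (\<lambda>x. c::real)"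
  unfolding set_integrable_def
  by (rule integrable_const_bound[where B="\<bar>c\<bar>"]) (auto split: split_indicator)

end

section \<open>Poisson points below the edge\<close>

text \<open>
  The situation for one fixed \<open>n\<close>; the number \<open>\<theta>\<close> stands for \<open>n c\<close>.
\<close>
locale strip_process = bounded_edge \<nu> f + P: prob_space P
  for \<nu> :: "'a measure" and f :: "'a \<Rightarrow> real" and P :: "'w measure" +
  fixes \<theta> :: real and N :: "'w \<Rightarrow> ('a \<times> real) measure" and K :: "'w \<Rightarrow> nat"
    and X :: "'w \<Rightarrow> nat \<Rightarrow> 'a" and Y :: "'w \<Rightarrow> nat \<Rightarrow> real"
  assumes theta_pos: "0 < \<theta>"
    and poisson: "poisson_point_process P (strip_intensity \<nu> f \<theta>) N"
    and points_total: "\<And>\<omega>. \<omega> \<in> space P \<Longrightarrow> emeasure (N \<omega>) (region_below f (space \<nu>)) = of_nat (K \<omega>)"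
    and points: "\<And>\<omega> E. \<omega> \<in> space P \<Longrightarrow> E \<in> sets (\<nu> \<Otimes>\<^sub>M restrict_space lborel {0..}) \<Longrightarrow>
      emeasure (N \<omega>) E = of_nat (card {i \<in> {1..K \<omega>}. (X \<omega> i, Y \<omega> i) \<in> E})"
begin

abbreviation "strip \<equiv> \<nu> \<Otimes>\<^sub>M (restrict_space lborel {0..} :: real measure)"

definition count :: "('a \<times> real) set \<Rightarrow> 'w \<Rightarrow> nat" where
  "count E \<omega> = card {i \<in> {1..K \<omega>}. (X \<omega> i, Y \<omega> i) \<in> E}"

lemma emeasure_eq_count: "\<omega> \<in> space P \<Longrightarrow> E \<in> sets strip \<Longrightarrow> emeasure (N \<omega>) E = of_nat (count E \<omega>)"
  by (simp add: points count_def)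

lemma measure_eq_count: "\<omega> \<in> space P \<Longrightarrow> E \<in> sets strip \<Longrightarrow> measure (N \<omega>) E = real (count E \<omega>)"
  by (simp add: measure_def emeasure_eq_count ennreal_of_nat_eq_real_of_nat)

lemma sets_intensity: "sets (strip_intensity \<nu> f \<theta>) = sets strip"
  by (simp add: strip_intensity_def)

lemma region_below_sets:
  assumes g[measurable]: "g \<in> borel_measurable \<nu>" and A[measurable]: "A \<in> sets \<nu>"
  shows "region_below g A \<in> sets strip"
proof -
  have [measurable]: "snd \<in> borel_measurable strip"
    by (rule measurable_compose[OF measurable_snd]) (simp add: measurable_restrict_space1)
  have "region_below g A = {z \<in> space strip. fst z \<in> A \<and> snd z \<le> g (fst z)}"
    using sets.sets_into_space[OF A] by (auto simp: region_below_def space_pair_measure space_restrict_space)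
  also have "\<dots> \<in> sets strip" by measurable
  finally show ?thesis .
qed

text \<open>
  Fubini: the vertical section at \<open>x\<close> is the interval from \<open>0\<close> to \<open>g x\<close>.
\<close>
lemma emeasure_region_below:
  assumes g[measurable]: "g \<in> borel_measurable \<nu>" and gf: "\<And>x. x \<in> space \<nu> \<Longrightarrow> 0 \<le> g x \<and> g x \<le> f x"
    and A[measurable]: "A \<in> sets \<nu>"
  shows "emeasure (strip_intensity \<nu> f \<theta>) (region_below g A) = ennreal (\<theta> * (LINT x:A|\<nu>. g x))"
proof -
  let ?H = "restrict_space lborel {0..} :: real measure"
  interpret H: sigma_finite_measure ?H
    by (rule sigma_finite_measure_restrict_space) (auto intro: lborel.sigma_finite_measure_axioms)
  note [measurable] = region_below_sets[OF g A] region_below_sets[OF f_meas sets.top]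
  have "emeasure (strip_intensity \<nu> f \<theta>) (region_below g A) =
      (\<integral>\<^sup>+z. ennreal \<theta> * indicator (region_below f (space \<nu>)) z * indicator (region_below g A) z \<partial>strip)"
    unfolding strip_intensity_def by (rule emeasure_density) measurable
  also have "\<dots> = (\<integral>\<^sup>+z. ennreal \<theta> * indicator (region_below g A) z \<partial>strip)"
  proof (rule nn_integral_cong)
    fix z assume "z \<in> space strip"
    have "z \<in> region_below f (space \<nu>)" if "z \<in> region_below g A"
      using that gf[of "fst z"] sets.sets_into_space[OF A] by (auto simp: region_below_def intro: order_trans)
    then show "ennreal \<theta> * indicator (region_below f (space \<nu>)) z * indicator (region_below g A) z =
        ennreal \<theta> * indicator (region_below g A) z"
      by (auto split: split_indicator)
  qed
  also have "\<dots> = ennreal \<theta> * emeasure strip (region_below g A)"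
    by (rule nn_integral_cmult_indicator) measurable
  also have "emeasure strip (region_below g A) = (\<integral>\<^sup>+x. emeasure ?H (Pair x -` region_below g A) \<partial>\<nu>)"
    by (rule H.emeasure_pair_measure_alt) measurable
  also have "\<dots> = (\<integral>\<^sup>+x. ennreal (indicat_real A x *\<^sub>R g x) \<partial>\<nu>)"
  proof (rule nn_integral_cong)
    fix x assume x: "x \<in> space \<nu>"
    show "emeasure ?H (Pair x -` region_below g A) = ennreal (indicat_real A x *\<^sub>R g x)"
    proof (cases "x \<in> A")
      case True
      then have "Pair x -` region_below g A = {0..g x}" by (auto simp: region_below_def)
      moreover have "emeasure ?H {0..g x} = emeasure lborel {0..g x}"
        by (rule emeasure_restrict_space) auto
      ultimately show ?thesis using gf[OF x] True by simp
    next
      case False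
      then have "Pair x -` region_below g A = {}" by (auto simp: region_below_def)
      then show ?thesis using False by simp
    qed
  qed
  also have "\<dots> = ennreal (LINT x:A|\<nu>. g x)"
    unfolding set_lebesgue_integral_def
  proof (rule nn_integral_eq_integral)
    show "integrable \<nu> (\<lambda>x. indicat_real A x *\<^sub>R g x)"
      using integrable_below[OF g gf A] by (simp only: set_integrable_def)
  qed (use gf in \<open>auto split: split_indicator\<close>)
  finally show ?thesis
    using theta_pos by (simp add: ennreal_mult')
qed

definition mass_below :: "'a set \<Rightarrow> real \<Rightarrow> real" where
  "mass_below A y = \<theta> * (LINT x:A|\<nu>. min (f x) y)"

definition mass :: "'a set \<Rightarrow> real" where
  "mass A = \<theta> * (LINT x:A|\<nu>. f x)"

text \<open>
  The part of the cell below level \<open>y\<close> is again the region below a function, so its intensity is given by \<open>emeasure_region_below\<close>.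
\<close>
definition low :: "'a set \<Rightarrow> real \<Rightarrow> ('a \<times> real) set" where
  "low A y = region_below (\<lambda>x. min (f x) y) A"

definition high :: "'a set \<Rightarrow> real \<Rightarrow> ('a \<times> real) set" where
  "high A y = region_below f A - low A y"

lemma low_subset: "low A y \<subseteq> region_below f A"
  by (auto simp: low_def region_below_def)

lemma low_sets[measurable]: "A \<in> sets \<nu> \<Longrightarrow> low A y \<in> sets strip"
  unfolding low_def by (rule region_below_sets) measurable

lemma region_sets[measurable]: "A \<in> sets \<nu> \<Longrightarrow> region_below f A \<in> sets strip"
  by (rule region_below_sets[OF f_meas])

lemma high_sets[measurable]: "A \<in> sets \<nu> \<Longrightarrow> high A y \<in> sets strip"
  unfolding high_def by (intro sets.Diff region_sets low_sets)

lemma integrable_min: "A \<in> sets \<nu> \<Longrightarrow> 0 \<le> y \<Longrightarrow> set_integrable \<nu> A (\<lambda>x. min (f x) y)"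
  by (rule integrable_below) (use f_nonneg in auto)

lemma integrable_f: "A \<in> sets \<nu> \<Longrightarrow> set_integrable \<nu> A f"
  by (rule integrable_below) (use f_nonneg in auto)

lemma intensity_low:
  assumes "A \<in> sets \<nu>" "0 \<le> y"
  shows "emeasure (strip_intensity \<nu> f \<theta>) (low A y) = ennreal (mass_below A y)"
  unfolding low_def mass_below_def
  by (rule emeasure_region_below) (use assms f_nonneg in auto)

lemma intensity_region:
  assumes "A \<in> sets \<nu>"
  shows "emeasure (strip_intensity \<nu> f \<theta>) (region_below f A) = ennreal (mass A)"
  unfolding mass_def by (rule emeasure_region_below) (use assms f_nonneg in auto)

lemma set_integral_mono_AE_below:
  assumes "A \<in> sets \<nu>" "set_integrable \<nu> A g" "set_integrable \<nu> A h" "AE x in \<nu>. x \<in> A \<longrightarrow> g x \<le> h x"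
  shows "(LINT x:A|\<nu>. g x) \<le> (LINT x:A|\<nu>. (h x :: real))"
  unfolding set_lebesgue_integral_def
  by (rule integral_mono_AE)
     (use assms in \<open>auto simp: set_integrable_def elim!: AE_mp intro!: AE_I2 split: split_indicator\<close>)

lemma mass_below_nonneg: "A \<in> sets \<nu> \<Longrightarrow> 0 \<le> y \<Longrightarrow> 0 \<le> mass_below A y"
  unfolding mass_below_def set_lebesgue_integral_def
  using theta_pos f_nonneg by (intro mult_nonneg_nonneg integral_nonneg_AE AE_I2) (auto split: split_indicator)

lemma mass_below_mono:
  assumes "A \<in> sets \<nu>" "0 \<le> y" "y \<le> z"
  shows "mass_below A y \<le> mass_below A z"
  unfolding mass_below_def
  by (intro mult_left_mono set_integral_mono_AE_below integrable_min) (use assms theta_pos in \<open>auto simp: min_def\<close>)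

lemma mass_below_le_mass:
  assumes "A \<in> sets \<nu>" "0 \<le> y"
  shows "mass_below A y \<le> mass A"
  unfolding mass_below_def mass_def
  by (intro mult_left_mono set_integral_mono_AE_below integrable_min integrable_f) (use assms theta_pos in auto)

lemma mass_below_hi:
  assumes "A \<in> sets \<nu>" "hi A \<le> y"
  shows "mass_below A y = mass A"
proof -
  have "(LINT x:A|\<nu>. min (f x) y) = (LINT x:A|\<nu>. f x)"
    unfolding set_lebesgue_integral_def
  proof (rule integral_cong_AE)
    show "AE x in \<nu>. indicat_real A x *\<^sub>R min (f x) y = indicat_real A x *\<^sub>R f x"
      using AE_le_hi[OF assms(1)] by eventually_elim (use assms(2) in \<open>auto split: split_indicator\<close>)
  qed (use assms in auto)
  then show ?thesis by (simp add: mass_below_def mass_def)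
qed

lemma mass_below_0: "A \<in> sets \<nu> \<Longrightarrow> mass_below A 0 = 0"
proof -
  have "(LINT x:A|\<nu>. min (f x) 0) = 0"
    unfolding set_lebesgue_integral_def
    by (rule integral_eq_zero_AE) (rule AE_I2, simp add: f_nonneg min_absorb2)
  then show ?thesis by (simp add: mass_below_def)
qed

text \<open>
  Raising the level raises the truncated function by at most as much.
\<close>
lemma mass_below_lipschitz:
  assumes "A \<in> sets \<nu>" "0 \<le> y" "y \<le> z"
  shows "mass_below A z - mass_below A y \<le> \<theta> * measure \<nu> A * (z - y)"
proof -
  have "(LINT x:A|\<nu>. min (f x) z) \<le> (LINT x:A|\<nu>. min (f x) y + (z - y))"
    using assms by (intro set_integral_mono_AE_below set_integral_add integrable_min set_integrable_const) auto
  also have "\<dots> = (LINT x:A|\<nu>. min (f x) y) + measure \<nu> A * (z - y)"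
    using assms by (subst set_integral_add) (auto intro: integrable_min set_integrable_const simp: set_integral_const)
  finally have "\<theta> * (LINT x:A|\<nu>. min (f x) z) \<le> \<theta> * ((LINT x:A|\<nu>. min (f x) y) + measure \<nu> A * (z - y))"
    using theta_pos by (intro mult_left_mono) auto
  then show ?thesis by (simp add: mass_below_def algebra_simps)
qed

lemma mass_below_continuous: "A \<in> sets \<nu> \<Longrightarrow> continuous_on {0..} (mass_below A)"
proof (rule continuous_on_iff[THEN iffD2], intro ballI allI impI)
  fix y e :: real assume A: "A \<in> sets \<nu>" and y: "y \<in> {0..}" and "0 < e"
  define c where "c = \<theta> * measure \<nu> A + 1"
  have c: "0 < c" using theta_pos by (simp add: c_def add_nonneg_pos)
  have bound: "\<bar>mass_below A z - mass_below A y\<bar> \<le> c * \<bar>z - y\<bar>" if "0 \<le> z" for z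
  proof -
    have le: "\<theta> * measure \<nu> A * t \<le> c * t" if "0 \<le> t" for t using that by (simp add: c_def algebra_simps)
    show ?thesis
    proof (cases "y \<le> z")
      case True
      then show ?thesis using order_trans[OF mass_below_lipschitz[OF A, of y z] le[of "z - y"]] mass_below_mono[OF A, of y z] y by simp
    next
      case False
      then show ?thesis using order_trans[OF mass_below_lipschitz[OF A, of z y] le[of "y - z"]] mass_below_mono[OF A, of z y] that by simp
    qed
  qed
  show "\<exists>d>0. \<forall>z\<in>{0..}. dist z y < d \<longrightarrow> dist (mass_below A z) (mass_below A y) < e"
  proof (intro exI conjI ballI impI)
    show "0 < e / c" using c \<open>0 < e\<close> by simp
    fix z assume "z \<in> {0..}" "dist z y < e / c"
    then have "c * \<bar>z - y\<bar> < e" using c by (simp add: dist_real_def field_simps)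
    then show "dist (mass_below A z) (mass_below A y) < e"
      using bound[of z] \<open>z \<in> {0..}\<close> by (simp add: dist_real_def)
  qed
qed

lemma intensity_high:
  assumes "A \<in> sets \<nu>" "0 \<le> y"
  shows "emeasure (strip_intensity \<nu> f \<theta>) (high A y) = ennreal (mass A - mass_below A y)"
proof -
  have "emeasure (strip_intensity \<nu> f \<theta>) (high A y) = ennreal (mass A) - ennreal (mass_below A y)"
    unfolding high_def intensity_region[OF assms(1), symmetric] intensity_low[OF assms, symmetric]
    by (rule emeasure_Diff) (use assms low_subset in \<open>auto simp: intensity_low sets_intensity\<close>)
  also have "\<dots> = ennreal (mass A - mass_below A y)"
    by (rule ennreal_minus) (rule mass_below_nonneg[OF assms])
  finally show ?thesis .
qed

lemma count_law:
  assumes "E \<in> sets strip" "emeasure (strip_intensity \<nu> f \<theta>) E = ennreal m" "0 \<le> m"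
  shows "P.prob {\<omega>\<in>space P. count E \<omega> = j} = poisson_weight m j"
proof -
  have "{\<omega>\<in>space P. emeasure (N \<omega>) E = of_nat j} = {\<omega>\<in>space P. count E \<omega> = j}"
    using assms(1) by (auto simp: emeasure_eq_count)
  moreover have "measure (strip_intensity \<nu> f \<theta>) E = m" using assms by (simp add: measure_def)
  moreover have "P.prob {\<omega>\<in>space P. emeasure (N \<omega>) E = of_nat j} =
      exp (- measure (strip_intensity \<nu> f \<theta>) E) * measure (strip_intensity \<nu> f \<theta>) E ^ j / fact j"
    using poisson assms by (simp add: poisson_point_process_def sets_intensity)
  ultimately show ?thesis by (simp add: poisson_weight_def)
qed

lemma count_measurable[measurable]:
  assumes "E \<in> sets strip"
  shows "count E \<in> measurable P (count_space UNIV)"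
proof (rule measurable_count_space_eq2_countable[THEN iffD2], intro conjI ballI)
  fix j
  have [measurable]: "(\<lambda>\<omega>. emeasure (N \<omega>) E) \<in> borel_measurable P"
    using poisson assms by (simp add: poisson_point_process_def sets_intensity)
  have "count E -` {j} \<inter> space P = {\<omega>\<in>space P. emeasure (N \<omega>) E = of_nat j}"
    using assms by (auto simp: emeasure_eq_count)
  also have "\<dots> \<in> sets P" by measurable
  finally show "count E -` {j} \<inter> space P \<in> sets P" .
qed auto

definition peak :: "'a set \<Rightarrow> 'w \<Rightarrow> real" where
  "peak A \<omega> = cell_max f (N \<omega>) (K \<omega>) (X \<omega>) (Y \<omega>) A"

lemma count_split: "count (region_below f A) \<omega> = count (low A y) \<omega> + count (high A y) \<omega>"
proof -
  have "{i \<in> {1..K \<omega>}. (X \<omega> i, Y \<omega> i) \<in> region_below f A} =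
      {i \<in> {1..K \<omega>}. (X \<omega> i, Y \<omega> i) \<in> low A y} \<union> {i \<in> {1..K \<omega>}. (X \<omega> i, Y \<omega> i) \<in> high A y}"
    using low_subset[of A y] by (auto simp: high_def)
  moreover have "card \<dots> = count (low A y) \<omega> + count (high A y) \<omega>"
    unfolding count_def by (rule card_Un_disjoint) (auto simp: high_def)
  ultimately show ?thesis by (simp add: count_def)
qed

text \<open>
  The peak is governed by an empty region, which is what makes its law computable; for an empty cell both sides hold since \<open>y \<ge> 0\<close>.
\<close>
lemma peak_le_iff:
  assumes "A \<in> sets \<nu>" "\<omega> \<in> space P" "0 \<le> y"
  shows "peak A \<omega> \<le> y \<longleftrightarrow> count (high A y) \<omega> = 0"
proof (cases "count (region_below f A) \<omega> = 0")
  case True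
  then show ?thesis using assms count_split[of A \<omega> y] by (simp add: peak_def cell_max_def measure_eq_count)
next
  case False
  let ?I = "{i \<in> {1..K \<omega>}. (X \<omega> i, Y \<omega> i) \<in> region_below f A}"
  have "?I \<noteq> {}" using False by (auto simp: count_def)
  have "peak A \<omega> = Max (Y \<omega> ` ?I)"
    using False assms by (simp add: peak_def cell_max_def measure_eq_count setcompr_eq_image)
  then have "peak A \<omega> \<le> y \<longleftrightarrow> (\<forall>i\<in>?I. Y \<omega> i \<le> y)"
    using \<open>?I \<noteq> {}\<close> by (simp add: Max_le_iff)
  also have "\<dots> \<longleftrightarrow> {i \<in> {1..K \<omega>}. (X \<omega> i, Y \<omega> i) \<in> high A y} = {}"
    by (auto simp: high_def low_def region_below_def)
  finally show ?thesis by (simp add: count_def)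
qed

lemma peak_nonneg:
  assumes "A \<in> sets \<nu>" "\<omega> \<in> space P"
  shows "0 \<le> peak A \<omega>"
proof (cases "count (region_below f A) \<omega> = 0")
  case True
  then show ?thesis using assms by (simp add: peak_def cell_max_def measure_eq_count)
next
  case False
  let ?I = "{i \<in> {1..K \<omega>}. (X \<omega> i, Y \<omega> i) \<in> region_below f A}"
  obtain i where i: "i \<in> ?I" using False by (auto simp: count_def)
  then have "0 \<le> Y \<omega> i" by (auto simp: region_below_def)
  also have "\<dots> \<le> Max (Y \<omega> ` ?I)" using i by (intro Max_ge) auto
  also have "\<dots> = peak A \<omega>"
    using False assms by (simp add: peak_def cell_max_def measure_eq_count setcompr_eq_image)
  finally show ?thesis .
qed

lemma peak_measurable[measurable]:
  assumes "A \<in> sets \<nu>"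
  shows "peak A \<in> borel_measurable P"
proof (rule borel_measurable_iff_le[THEN iffD2], rule allI)
  fix y
  show "{\<omega> \<in> space P. peak A \<omega> \<le> y} \<in> sets P"
  proof (cases "0 \<le> y")
    case True
    have [measurable]: "count (high A y) \<in> measurable P (count_space UNIV)"
      by (rule count_measurable) (rule high_sets[OF assms])
    have "{\<omega> \<in> space P. peak A \<omega> \<le> y} = {\<omega> \<in> space P. count (high A y) \<omega> = 0}"
      using peak_le_iff[OF assms _ True] by auto
    also have "\<dots> \<in> sets P" by measurable
    finally show ?thesis .
  next
    case False
    then have "{\<omega> \<in> space P. peak A \<omega> \<le> y} = {}" using peak_nonneg[OF assms] by force
    then show ?thesis by (simp only: sets.empty_sets)
  qed
qed

text \<open>
  As \<open>k\<close> and \<open>y\<close> vary, these events form a system stable under intersection that generates everything known about the cell. For \<open>y < 0\<close> they are empty.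
\<close>
definition cell_event :: "'a set \<Rightarrow> nat \<Rightarrow> real \<Rightarrow> 'w set" where
  "cell_event A k y = {\<omega> \<in> space P. count (region_below f A) \<omega> = k \<and> peak A \<omega> \<le> y}"

lemma cell_event_sets:
  assumes "A \<in> sets \<nu>"
  shows "cell_event A k y \<in> sets P"
proof -
  have [measurable]: "count (region_below f A) \<in> measurable P (count_space UNIV)" "peak A \<in> borel_measurable P"
    using assms by (auto intro: count_measurable region_sets)
  show ?thesis unfolding cell_event_def by measurable
qed

lemma cell_event_eq:
  assumes "A \<in> sets \<nu>" "0 \<le> y"
  shows "cell_event A k y = {\<omega> \<in> space P. count (low A y) \<omega> = k} \<inter> {\<omega> \<in> space P. count (high A y) \<omega> = 0}"
proof -
  have "\<omega> \<in> cell_event A k y \<longleftrightarrow> \<omega> \<in> {\<omega> \<in> space P. count (low A y) \<omega> = k} \<inter> {\<omega> \<in> space P. count (high A y) \<omega> = 0}" for \<omega>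
    using peak_le_iff[OF assms(1) _ assms(2), of \<omega>] count_split[of A \<omega> y] by (auto simp: cell_event_def)
  then show ?thesis by blast
qed

lemma prob_counts:
  fixes E :: "nat \<Rightarrow> ('a \<times> real) set"
  assumes J: "finite J" "J \<noteq> {}" and E: "\<And>i. i \<in> J \<Longrightarrow> E i \<in> sets strip" and disj: "disjoint_family_on E J"
  shows "P.prob (\<Inter>i\<in>J. {\<omega>\<in>space P. count (E i) \<omega> = j i}) = (\<Prod>i\<in>J. P.prob {\<omega>\<in>space P. count (E i) \<omega> = j i})"
proof -
  \<comment> \<open>The definition of a Poisson process speaks of initial segments of the index set, so the family is padded with empty sets.\<close>
  define E' where "E' i = (if i \<in> J then E i else {})" for i
  obtain q where q: "J \<subseteq> {..<q}"
    using finite_nat_iff_bounded[THEN iffD1, OF J(1)] by blast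
  have "(\<forall>i<q. E' i \<in> sets (strip_intensity \<nu> f \<theta>)) \<and> disjoint_family_on E' {..<q}"
    using E disj by (auto simp: E'_def sets_intensity disjoint_family_on_def)
  then have ind: "P.indep_vars (\<lambda>_. borel) (\<lambda>i \<omega>. emeasure (N \<omega>) (E' i)) {..<q}"
    using poisson by (simp add: poisson_point_process_def)
  have eq: "(\<lambda>\<omega>. emeasure (N \<omega>) (E' i)) -` {of_nat (j i)} \<inter> space P = {\<omega>\<in>space P. count (E i) \<omega> = j i}" if "i \<in> J" for i
    using that E[OF that] by (auto simp: E'_def emeasure_eq_count)
  have "P.prob (\<Inter>i\<in>J. (\<lambda>\<omega>. emeasure (N \<omega>) (E' i)) -` {of_nat (j i)} \<inter> space P) =
      (\<Prod>i\<in>J. P.prob ((\<lambda>\<omega>. emeasure (N \<omega>) (E' i)) -` {of_nat (j i)} \<inter> space P))"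
    by (rule P.indep_varsD[OF ind J(2,1) q]) simp
  then show ?thesis using eq by simp
qed

text \<open>
  Cut every cell at its own level: the events concern the point counts in \<open>2 \<bar>J\<bar>\<close> disjoint regions. The region below in cell \<open>r\<close> gets the index \<open>2 r\<close>,
  the one above the index \<open>2 r + 1\<close>.
\<close>
lemma prob_cell_events:
  fixes A :: "nat \<Rightarrow> 'a set"
  assumes J: "finite J" "J \<noteq> {}" and A: "\<And>r. r \<in> J \<Longrightarrow> A r \<in> sets \<nu>" and disj: "disjoint_family_on A J"
    and y: "\<And>r. r \<in> J \<Longrightarrow> 0 \<le> y r"
  shows "P.prob (\<Inter>r\<in>J. cell_event (A r) (j r) (y r)) =
    (\<Prod>r\<in>J. P.prob {\<omega>\<in>space P. count (low (A r) (y r)) \<omega> = j r} * P.prob {\<omega>\<in>space P. count (high (A r) (y r)) \<omega> = 0})"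
proof -
  define E where "E i = (if even i then low (A (i div 2)) (y (i div 2)) else high (A (i div 2)) (y (i div 2)))" for i :: nat
  define l where "l i = (if even i then j (i div 2) else 0)" for i :: nat
  define J2 where "J2 = (\<Union>r\<in>J. {2 * r, Suc (2 * r)})"
  have J2_div: "i div 2 \<in> J" if "i \<in> J2" for i using that by (auto simp: J2_def)
  have E_sub: "E i \<subseteq> region_below f (A (i div 2))" for i
    using low_subset by (auto simp: E_def high_def)
  have region_disj: "region_below f B \<inter> region_below f C = {}" if "B \<inter> C = {}" for B C
    using that by (auto simp: region_below_def)
  have "disjoint_family_on E J2"
    unfolding disjoint_family_on_def
  proof (intro ballI impI)
    fix i i' assume i: "i \<in> J2" "i' \<in> J2" "i \<noteq> i'"
    show "E i \<inter> E i' = {}"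
    proof (cases "i div 2 = i' div 2")
      case True
      then have "even i \<noteq> even i'" using i(3) by (metis even_two_times_div_two odd_two_times_div_two_succ)
      then show ?thesis using True by (auto simp: E_def high_def)
    next
      case False
      then have "A (i div 2) \<inter> A (i' div 2) = {}"
        using disj J2_div i by (auto simp: disjoint_family_on_def)
      then show ?thesis using region_disj E_sub by blast
    qed
  qed
  moreover have "E i \<in> sets strip" if "i \<in> J2" for i
    using A[OF J2_div[OF that]] by (simp add: E_def low_sets high_sets)
  moreover have "finite J2" "J2 \<noteq> {}" using J by (auto simp: J2_def)
  ultimately have "P.prob (\<Inter>i\<in>J2. {\<omega>\<in>space P. count (E i) \<omega> = l i}) = (\<Prod>i\<in>J2. P.prob {\<omega>\<in>space P. count (E i) \<omega> = l i})"
    by (intro prob_counts)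
  moreover have "(\<Inter>i\<in>J2. {\<omega>\<in>space P. count (E i) \<omega> = l i}) = (\<Inter>r\<in>J. cell_event (A r) (j r) (y r))"
  proof -
    have "(\<Inter>i\<in>J2. {\<omega>\<in>space P. count (E i) \<omega> = l i}) = (\<Inter>r\<in>J. {\<omega>\<in>space P. count (E (2 * r)) \<omega> = l (2 * r)} \<inter> {\<omega>\<in>space P. count (E (Suc (2 * r))) \<omega> = l (Suc (2 * r))})"
      unfolding J2_def by blast
    also have "\<dots> = (\<Inter>r\<in>J. cell_event (A r) (j r) (y r))"
      by (intro INF_cong refl) (simp add: cell_event_eq A y E_def l_def)
    finally show ?thesis .
  qed
  moreover have "(\<Prod>i\<in>J2. P.prob {\<omega>\<in>space P. count (E i) \<omega> = l i}) =
      (\<Prod>r\<in>J. P.prob {\<omega>\<in>space P. count (low (A r) (y r)) \<omega> = j r} * P.prob {\<omega>\<in>space P. count (high (A r) (y r)) \<omega> = 0})"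
    unfolding J2_def
  proof (subst prod.UNION_disjoint)
    show "\<forall>r\<in>J. \<forall>r'\<in>J. r \<noteq> r' \<longrightarrow> {2 * r, Suc (2 * r)} \<inter> {2 * r', Suc (2 * r')} = {}" by auto
  qed (use J in \<open>auto simp: E_def l_def intro!: prod.cong\<close>)
  ultimately show ?thesis by simp
qed

lemma prob_cell_event:
  assumes "A \<in> sets \<nu>" "0 \<le> y"
  shows "P.prob (cell_event A k y) = exp (- mass A) * mass_below A y ^ k / fact k"
proof -
  have "P.prob (cell_event A k y) = P.prob {\<omega>\<in>space P. count (low A y) \<omega> = k} * P.prob {\<omega>\<in>space P. count (high A y) \<omega> = 0}"
    using prob_cell_events[of "{0}" "\<lambda>_. A" "\<lambda>_. y" "\<lambda>_. k"] assms by (simp add: disjoint_family_on_def)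
  also have "P.prob {\<omega>\<in>space P. count (low A y) \<omega> = k} = poisson_weight (mass_below A y) k"
    by (rule count_law[OF low_sets intensity_low mass_below_nonneg]) (use assms in auto)
  also have "P.prob {\<omega>\<in>space P. count (high A y) \<omega> = 0} = poisson_weight (mass A - mass_below A y) 0"
    by (rule count_law[OF high_sets intensity_high]) (use assms mass_below_le_mass in auto)
  also have "poisson_weight (mass_below A y) k * poisson_weight (mass A - mass_below A y) 0 =
      (exp (- mass_below A y) * exp (- (mass A - mass_below A y))) * mass_below A y ^ k / fact k"
    by (simp add: poisson_weight_def)
  also have "exp (- mass_below A y) * exp (- (mass A - mass_below A y)) = exp (- mass A)"
    by (simp add: exp_add[symmetric])
  finally show ?thesis .
qed

lemma prob_peak_le:
  assumes "A \<in> sets \<nu>" "0 \<le> y"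
  shows "P.prob {\<omega>\<in>space P. peak A \<omega> \<le> y} = exp (- (mass A - mass_below A y))"
proof -
  have "{\<omega>\<in>space P. peak A \<omega> \<le> y} = {\<omega>\<in>space P. count (high A y) \<omega> = 0}"
    using peak_le_iff[OF assms(1) _ assms(2)] by auto
  also have "P.prob \<dots> = poisson_weight (mass A - mass_below A y) 0"
    by (rule count_law[OF high_sets intensity_high]) (use assms mass_below_le_mass in auto)
  finally show ?thesis by (simp add: poisson_weight_def)
qed

lemma mass_bounds:
  assumes "A \<in> sets \<nu>"
  shows "\<theta> * measure \<nu> A * lo A \<le> mass A" "mass A \<le> \<theta> * measure \<nu> A * hi A"
proof -
  have "(LINT x:A|\<nu>. lo A) \<le> (LINT x:A|\<nu>. f x)"
    by (rule set_integral_mono_AE_below) (use assms AE_lo_le in \<open>auto intro: set_integrable_const integrable_f\<close>)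
  then have "\<theta> * (LINT x:A|\<nu>. lo A) \<le> \<theta> * (LINT x:A|\<nu>. f x)"
    using theta_pos by (intro mult_left_mono) auto
  then show "\<theta> * measure \<nu> A * lo A \<le> mass A"
    by (simp add: mass_def set_integral_const[OF assms] mult.assoc)
  have "(LINT x:A|\<nu>. f x) \<le> (LINT x:A|\<nu>. hi A)"
    by (rule set_integral_mono_AE_below) (use assms AE_le_hi in \<open>auto intro: set_integrable_const integrable_f\<close>)
  then have "\<theta> * (LINT x:A|\<nu>. f x) \<le> \<theta> * (LINT x:A|\<nu>. hi A)"
    using theta_pos by (intro mult_left_mono) auto
  then show "mass A \<le> \<theta> * measure \<nu> A * hi A"
    by (simp add: mass_def set_integral_const[OF assms] mult.assoc)
qed

lemma mass_pos: "A \<in> sets \<nu> \<Longrightarrow> 0 < measure \<nu> A \<Longrightarrow> 0 < mass A"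
  using mass_bounds(1)[of A] lo_pos[of A] theta_pos
  by (meson less_le_trans mult_pos_pos)

lemma gap_nonneg:
  assumes "A \<in> sets \<nu>" "0 \<le> y"
  shows "mass_below A y \<le> \<theta> * measure \<nu> A * y"
proof -
  have "(LINT x:A|\<nu>. min (f x) y) \<le> (LINT x:A|\<nu>. y)"
    by (rule set_integral_mono_AE_below) (use assms in \<open>auto intro: set_integrable_const integrable_min\<close>)
  then have "\<theta> * (LINT x:A|\<nu>. min (f x) y) \<le> \<theta> * (LINT x:A|\<nu>. y)"
    using theta_pos by (intro mult_left_mono) auto
  then show ?thesis by (simp add: mass_below_def set_integral_const[OF assms(1)] mult.assoc)
qed

text \<open>
  If \<open>f \<ge> y - d\<close> on the cell, truncation at \<open>y\<close> lowers \<open>y\<close> by at most \<open>d\<close>. With \<open>d = 0\<close> there is no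
  gap up to the essential infimum.
\<close>
lemma gap_le:
  assumes A: "A \<in> sets \<nu>" and "0 \<le> y" "0 \<le> d" "y - d \<le> lo A"
  shows "\<theta> * measure \<nu> A * y - mass_below A y \<le> \<theta> * measure \<nu> A * d"
proof -
  have "(LINT x:A|\<nu>. y - d) \<le> (LINT x:A|\<nu>. min (f x) y)"
  proof (rule set_integral_mono_AE_below[OF A set_integrable_const[OF A] integrable_min[OF A \<open>0 \<le> y\<close>]])
    show "AE x in \<nu>. x \<in> A \<longrightarrow> y - d \<le> min (f x) y"
      using AE_lo_le[OF A] by eventually_elim (use assms in auto)
  qed
  then have "\<theta> * (LINT x:A|\<nu>. y - d) \<le> \<theta> * (LINT x:A|\<nu>. min (f x) y)"
    using theta_pos by (intro mult_left_mono) auto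
  then show ?thesis by (simp add: mass_below_def set_integral_const[OF A] algebra_simps)
qed

definition peak_mass :: "'a set \<Rightarrow> 'w \<Rightarrow> real" where
  "peak_mass A \<omega> = mass_below A (peak A \<omega>)"

lemma peak_mass_measurable[measurable]:
  assumes A: "A \<in> sets \<nu>"
  shows "peak_mass A \<in> borel_measurable P"
proof -
  have "(\<lambda>y. indicat_real {0..} y *\<^sub>R mass_below A y) \<in> borel_measurable borel"
    by (rule borel_measurable_continuous_on_indicator) (auto intro: mass_below_continuous[OF A])
  from measurable_compose[OF peak_measurable[OF A] this]
  have "(\<lambda>\<omega>. indicat_real {0..} (peak A \<omega>) *\<^sub>R mass_below A (peak A \<omega>)) \<in> borel_measurable P" .
  also have "(\<lambda>\<omega>. indicat_real {0..} (peak A \<omega>) *\<^sub>R mass_below A (peak A \<omega>)) \<in> borel_measurable P \<longleftrightarrow> ?thesis"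
    by (rule measurable_cong) (simp add: peak_mass_def peak_nonneg[OF A])
  finally show ?thesis .
qed

lemma count_region_measurable[measurable]:
  "A \<in> sets \<nu> \<Longrightarrow> count (region_below f A) \<in> measurable P (count_space UNIV)"
  by (rule count_measurable) (rule region_sets)

text \<open>
  The set of levels with mass at most \<open>u\<close> is a half-line, also where \<open>mass_below\<close> is flat; its right end is attained by continuity. It
  translates events about the mass below the peak into events about the peak. For \<open>u = mass A\<close> there need not be such a level.
\<close>
lemma record_level:
  assumes A: "A \<in> sets \<nu>" and u: "0 \<le> u" "u < mass A"
  obtains y where "0 \<le> y" "mass_below A y = u" "\<And>z. 0 \<le> z \<Longrightarrow> mass_below A z \<le> u \<longleftrightarrow> z \<le> y"
proof -
  let ?h = "hi A"
  have h: "0 \<le> ?h" by simp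
  have cont: "continuous_on {0..?h} (mass_below A)"
    by (rule continuous_on_subset[OF mass_below_continuous[OF A]]) auto
  have "\<exists>y\<ge>0. y \<le> ?h \<and> mass_below A y = u"
    by (rule IVT') (use cont u h in \<open>auto simp: mass_below_0[OF A] mass_below_hi[OF A]\<close>)
  then obtain y0 where y0: "0 \<le> y0" "y0 \<le> ?h" "mass_below A y0 = u" by blast
  define S where "S = {y \<in> {0..?h}. mass_below A y \<le> u}"
  have "closed S"
    unfolding S_def by (rule continuous_on_closed_Collect_le[OF cont continuous_on_const]) simp
  then have "compact S" by (auto simp: S_def compact_eq_bounded_closed intro: bounded_subset[OF bounded_closed_interval])
  moreover have "y0 \<in> S" using y0 by (simp add: S_def)
  ultimately obtain y where y: "y \<in> S" "\<And>z. z \<in> S \<Longrightarrow> z \<le> y"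
    using compact_attains_sup[of S] by blast
  have "y0 \<le> y" using y(2) \<open>y0 \<in> S\<close> by blast
  show thesis
  proof
    show "0 \<le> y" using y(1) by (simp add: S_def)
    show yu: "mass_below A y = u"
      using mass_below_mono[OF A y0(1) \<open>y0 \<le> y\<close>] y(1) y0(3) by (simp add: S_def)
    show "mass_below A z \<le> u \<longleftrightarrow> z \<le> y" if z: "0 \<le> z" for z
    proof
      assume "z \<le> y"
      from mass_below_mono[OF A z this] show "mass_below A z \<le> u" by (simp only: yu)
    next
      assume le: "mass_below A z \<le> u"
      have "z \<le> ?h"
      proof (rule ccontr)
        assume "\<not> z \<le> ?h"
        then have "mass_below A z = mass A" by (intro mass_below_hi[OF A]) simp
        then show False using le u by simp
      qed
      then show "z \<le> y" using y(2) le z by (simp add: S_def)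
    qed
  qed
qed

text \<open>
  The law of the peak in the scale of \<open>mass_below\<close> is universal. At \<open>u = mass A\<close> the condition on the
  mass is void and the law is that of the count.
\<close>
lemma poisson_record_cell:
  assumes A: "A \<in> sets \<nu>" and pos: "0 < measure \<nu> A"
  shows "poisson_record P (mass A) (count (region_below f A)) (peak_mass A)"
proof
  show "0 < mass A" by (rule mass_pos[OF assms])
  show "count (region_below f A) \<in> measurable P (count_space UNIV)" by (rule count_region_measurable[OF A])
  show "peak_mass A \<in> borel_measurable P" by (rule peak_mass_measurable[OF A])
  show "0 \<le> peak_mass A \<omega> \<and> peak_mass A \<omega> \<le> mass A" if "\<omega> \<in> space P" for \<omega>
    using mass_below_nonneg[OF A peak_nonneg[OF A that]] mass_below_le_mass[OF A peak_nonneg[OF A that]]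
    by (simp add: peak_mass_def)
  show "P.prob {\<omega>\<in>space P. count (region_below f A) \<omega> = k \<and> peak_mass A \<omega> \<le> u} = exp (- mass A) * u ^ k / fact k"
    if u: "0 \<le> u" "u \<le> mass A" for k u
  proof (cases "u = mass A")
    case True
    have "{\<omega>\<in>space P. count (region_below f A) \<omega> = k \<and> peak_mass A \<omega> \<le> u} = {\<omega>\<in>space P. count (region_below f A) \<omega> = k}"
      using True mass_below_le_mass[OF A peak_nonneg[OF A]] by (auto simp: peak_mass_def)
    moreover have "P.prob {\<omega>\<in>space P. count (region_below f A) \<omega> = k} = poisson_weight (mass A) k"
      by (rule count_law[OF region_sets[OF A] intensity_region[OF A]]) (use mass_pos[OF assms] in simp)
    ultimately show ?thesis using True by (simp add: poisson_weight_def)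
  next
    case False
    then obtain y where y: "0 \<le> y" "mass_below A y = u" "\<And>z. 0 \<le> z \<Longrightarrow> mass_below A z \<le> u \<longleftrightarrow> z \<le> y"
      using record_level[OF A u(1)] u(2) by (metis less_le)
    have "{\<omega>\<in>space P. count (region_below f A) \<omega> = k \<and> peak_mass A \<omega> \<le> u} = cell_event A k y"
      unfolding cell_event_def peak_mass_def using y(3)[OF peak_nonneg[OF A]] by blast
    then show ?thesis using prob_cell_event[OF A y(1)] y(2) by simp
  qed
qed

definition cell_deviation :: "'a set \<Rightarrow> 'w \<Rightarrow> real" where
  "cell_deviation A \<omega> = (1 + 1 / real (count (region_below f A) \<omega>)) * peak_mass A \<omega> - mass A"

lemma cell_deviation_measurable[measurable]:
  assumes [measurable]: "A \<in> sets \<nu>"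
  shows "cell_deviation A \<in> borel_measurable P"
  unfolding cell_deviation_def by measurable

lemma deviation_eq_cell_deviation:
  assumes "A \<in> sets \<nu>" "0 < measure \<nu> A"
  shows "poisson_record.deviation (mass A) (count (region_below f A)) (peak_mass A) = cell_deviation A"
  by (rule ext) (simp add: poisson_record.deviation_def[OF poisson_record_cell[OF assms]] cell_deviation_def)

lemma cell_deviation_integrable:
  assumes "A \<in> sets \<nu>" "0 < measure \<nu> A"
  shows "integrable P (cell_deviation A)"
  using poisson_record.deviation_power_integrable[OF poisson_record_cell[OF assms], of 1]
  by (simp add: deviation_eq_cell_deviation[OF assms])

lemma cell_deviation_abs:
  assumes "A \<in> sets \<nu>" "0 < measure \<nu> A"
  shows "P.expectation (\<lambda>\<omega>. \<bar>cell_deviation A \<omega>\<bar>) \<le> 49"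
  using poisson_record.deviation_abs_moment[OF poisson_record_cell[OF assms]]
  unfolding deviation_eq_cell_deviation[OF assms] .

lemma cell_deviation_char:
  assumes "A \<in> sets \<nu>" "0 < measure \<nu> A"
  shows "cmod (char (distr P borel (cell_deviation A)) t - complex_of_real (exp (- t\<^sup>2 / 2))) \<le>
    \<bar>t\<bar> * (mass A * exp (- mass A)) + 2 * t\<^sup>2 / mass A + 8 * \<bar>t\<bar> ^ 3 + t ^ 4 / 8"
  using poisson_record.deviation_char[OF poisson_record_cell[OF assms], of t]
  unfolding deviation_eq_cell_deviation[OF assms] .

text \<open>
  The deviation of a cell is measurable with respect to the events \<open>cell_event\<close>, which are independent over
  disjoint cells and stable under intersection.
\<close>
lemma cell_deviations_independent:
  fixes A :: "nat \<Rightarrow> 'a set"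
  assumes J: "finite J" and A: "\<And>r. r \<in> J \<Longrightarrow> A r \<in> sets \<nu>" and disj: "disjoint_family_on A J"
  shows "P.indep_vars (\<lambda>_. borel) (\<lambda>r. cell_deviation (A r)) J"
proof -
  define G where "G r = {cell_event (A r) k y | k y. True}" for r
  have G_events: "G r \<subseteq> P.events" if "r \<in> J" for r using cell_event_sets[OF A[OF that]] by (auto simp: G_def)
  have empty: "cell_event (A r) k y = {}" if "r \<in> J" "y < 0" for r k y
    using peak_nonneg[OF A[OF that(1)]] that(2) by (force simp: cell_event_def)
  have "P.indep_sets G J"
  proof (rule P.indep_setsI)
    show "G r \<subseteq> P.events" if "r \<in> J" for r by (rule G_events[OF that])
    fix B I assume I: "I \<noteq> {}" "I \<subseteq> J" "finite I" and "\<forall>r\<in>I. B r \<in> G r"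
    then have "\<forall>r\<in>I. \<exists>k y. B r = cell_event (A r) k y" by (auto simp: G_def)
    then obtain k y where B: "\<And>r. r \<in> I \<Longrightarrow> B r = cell_event (A r) (k r) (y r)" by metis
    have B': "(\<Inter>r\<in>I. B r) = (\<Inter>r\<in>I. cell_event (A r) (k r) (y r))" "(\<Prod>r\<in>I. P.prob (B r)) = (\<Prod>r\<in>I. P.prob (cell_event (A r) (k r) (y r)))"
      using B by auto
    show "P.prob (\<Inter>r\<in>I. B r) = (\<Prod>r\<in>I. P.prob (B r))"
    proof (cases "\<exists>r\<in>I. y r < 0")
      case True
      then obtain r where r: "r \<in> I" "B r = {}" using B empty I(2) by (metis subsetD)
      then have "(\<Inter>r\<in>I. B r) = {}" by blast
      moreover have "(\<Prod>r\<in>I. P.prob (B r)) = 0" by (rule prod_zero[OF I(3)]) (rule bexI[OF _ r(1)], simp only: r(2) measure_empty)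
      ultimately show ?thesis by (simp only: measure_empty)
    next
      case False
      then have y: "0 \<le> y r" if "r \<in> I" for r using that by force
      have AI: "A r \<in> sets \<nu>" if "r \<in> I" for r using A that I(2) by blast
      have dI: "disjoint_family_on A I" using disj I(2) by (rule disjoint_family_on_mono[rotated])
      have joint: "P.prob (\<Inter>r\<in>I. cell_event (A r) (k r) (y r)) =
          (\<Prod>r\<in>I. P.prob {\<omega>\<in>space P. count (low (A r) (y r)) \<omega> = k r} * P.prob {\<omega>\<in>space P. count (high (A r) (y r)) \<omega> = 0})"
        by (rule prob_cell_events[OF I(3,1) AI dI y])
      have "P.prob (cell_event (A r) (k r) (y r)) =
          P.prob {\<omega>\<in>space P. count (low (A r) (y r)) \<omega> = k r} * P.prob {\<omega>\<in>space P. count (high (A r) (y r)) \<omega> = 0}" if "r \<in> I" for r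
        using prob_cell_events[of "{r}" A y k] AI[OF that] y[OF that] by (simp add: disjoint_family_on_def)
      then show ?thesis
        unfolding B' joint by (intro prod.cong refl) (simp only:)
    qed
  qed
  moreover have "Int_stable (G r)" if "r \<in> J" for r
  proof (rule Int_stableI)
    fix B C assume "B \<in> G r" "C \<in> G r"
    then obtain k y k' y' where BC: "B = cell_event (A r) k y" "C = cell_event (A r) k' y'" by (auto simp: G_def)
    have "B \<inter> C = (if k = k' then cell_event (A r) k (min y y') else cell_event (A r) k (- 1))"
      unfolding empty[OF that, of "- 1" k, simplified] unfolding BC by (auto simp: cell_event_def)
    then show "B \<inter> C \<in> G r" by (auto simp: G_def)
  qed
  ultimately have ind: "P.indep_sets (\<lambda>r. sigma_sets (space P) (G r)) J"
    by (rule P.indep_sets_sigma)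
  show ?thesis
    unfolding P.indep_vars_def2
  proof (intro conjI ballI)
    show "cell_deviation (A r) \<in> borel_measurable P" if "r \<in> J" for r
      by (rule cell_deviation_measurable[OF A[OF that]])
    show "P.indep_sets (\<lambda>r. {cell_deviation (A r) -` B \<inter> space P |B. B \<in> sets borel}) J"
    proof (rule P.indep_sets_mono_sets[OF ind])
      fix r assume r: "r \<in> J"
      let ?S = "sigma (space P) (G r)"
      have sub: "G r \<subseteq> Pow (space P)" by (auto simp: G_def cell_event_def)
      have S: "space ?S = space P" "sets ?S = sigma_sets (space P) (G r)" using sub by simp_all
      have ev: "cell_event (A r) k y \<in> sets ?S" for k y unfolding S by (rule sigma_sets.Basic) (auto simp: G_def)
      have cnt: "count (region_below f (A r)) \<in> measurable ?S (count_space UNIV)"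
      proof (rule measurable_count_space_eq2_countable[THEN iffD2], intro conjI ballI)
        fix k
        have "count (region_below f (A r)) -` {k} \<inter> space ?S = (\<Union>j::nat. cell_event (A r) k (real j))"
          using real_arch_simple by (auto simp: cell_event_def S)
        also have "\<dots> \<in> sets ?S" by (rule sets.countable_UN) (use ev in auto)
        finally show "count (region_below f (A r)) -` {k} \<inter> space ?S \<in> sets ?S" .
      qed auto
      have pk: "peak (A r) \<in> borel_measurable ?S"
      proof (rule borel_measurable_iff_le[THEN iffD2], rule allI)
        fix y
        have "{\<omega> \<in> space ?S. peak (A r) \<omega> \<le> y} = (\<Union>k. cell_event (A r) k y)"
          by (auto simp: cell_event_def S)
        also have "\<dots> \<in> sets ?S" by (rule sets.countable_UN) (use ev in auto)
        finally show "{\<omega> \<in> space ?S. peak (A r) \<omega> \<le> y} \<in> sets ?S" .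
      qed
      have "(\<lambda>y. indicat_real {0..} y *\<^sub>R mass_below (A r) y) \<in> borel_measurable borel"
        by (rule borel_measurable_continuous_on_indicator) (auto intro: mass_below_continuous[OF A[OF r]])
      from measurable_compose[OF pk this] have [measurable]: "(\<lambda>\<omega>. indicat_real {0..} (peak (A r) \<omega>) *\<^sub>R mass_below (A r) (peak (A r) \<omega>)) \<in> borel_measurable ?S" .
      note cnt[measurable]
      have "(\<lambda>\<omega>. (1 + 1 / real (count (region_below f (A r)) \<omega>)) * (indicat_real {0..} (peak (A r) \<omega>) *\<^sub>R mass_below (A r) (peak (A r) \<omega>)) - mass (A r))
          \<in> borel_measurable ?S" by measurable
      also have "?this \<longleftrightarrow> cell_deviation (A r) \<in> borel_measurable ?S"
        by (rule measurable_cong) (simp add: S cell_deviation_def peak_mass_def peak_nonneg[OF A[OF r]])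
      finally have "cell_deviation (A r) \<in> borel_measurable ?S" .
      from measurable_sets[OF this] show "{cell_deviation (A r) -` B \<inter> space P |B. B \<in> sets borel} \<subseteq> sigma_sets (space P) (G r)"
        unfolding S by auto
    qed
  qed
qed

text \<open>
  What the estimator adds to the deviation because it uses the height of the peak and not the mass below it.
\<close>
definition residual :: "'a set \<Rightarrow> 'w \<Rightarrow> real" where
  "residual A \<omega> = (1 + 1 / real (count (region_below f A) \<omega>)) * (\<theta> * measure \<nu> A * peak A \<omega> - peak_mass A \<omega>)"

lemma residual_measurable[measurable]:
  assumes [measurable]: "A \<in> sets \<nu>"
  shows "residual A \<in> borel_measurable P"
  unfolding residual_def by measurable

lemma corrected_max_eq:
  assumes "A \<in> sets \<nu>" "\<omega> \<in> space P"
  shows "\<theta> * measure \<nu> A * corrected_max f (N \<omega>) (K \<omega>) (X \<omega>) (Y \<omega>) A = mass A + cell_deviation A \<omega> + residual A \<omega>"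
  using assms measure_eq_count[OF assms(2) region_sets[OF assms(1)]]
  by (simp add: corrected_max_def peak_def[symmetric] residual_def cell_deviation_def algebra_simps)

text \<open>
  Up to the essential infimum of \<open>f\<close> on the cell, \<open>mass_below\<close> is exactly \<open>\<theta> \<nu>(A)\<close> times the height; between the
  essential bounds it falls short by at most \<open>\<theta> \<nu>(A)\<close> times the oscillation. Almost surely no point lies higher.
\<close>
lemma residual_le:
  assumes A: "A \<in> sets \<nu>" and pos: "0 < measure \<nu> A"
  shows "AE \<omega> in P. \<bar>residual A \<omega>\<bar> \<le> 2 * (\<theta> * (measure \<nu> A * ess_osc_on \<nu> f A)) * indicator {\<omega> \<in> space P. lo A < peak A \<omega>} \<omega>"
proof -
  note [measurable] = peak_measurable[OF A]
  have h: "0 \<le> hi A" by simp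
  have "P.prob {\<omega>\<in>space P. peak A \<omega> \<le> hi A} = 1"
    using prob_peak_le[OF A h] mass_below_hi[OF A] by simp
  then have "AE \<omega> in P. peak A \<omega> \<le> hi A"
    by (subst (asm) P.prob_Collect_eq_1) measurable
  then show ?thesis using AE_space
  proof eventually_elim
    case (elim \<omega>)
    let ?R = "\<theta> * measure \<nu> A * peak A \<omega> - peak_mass A \<omega>"
    have y: "0 \<le> peak A \<omega>" using peak_nonneg[OF A elim(2)] .
    have fac: "0 \<le> 1 + 1 / real (count (region_below f A) \<omega>)" "1 + 1 / real (count (region_below f A) \<omega>) \<le> 2"
      by (cases "count (region_below f A) \<omega>"; simp)+
    have R0: "0 \<le> ?R" using gap_nonneg[OF A y] by (simp add: peak_mass_def)
    show ?case
    proof (cases "lo A < peak A \<omega>")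
      case True
      have "?R \<le> \<theta> * measure \<nu> A * (hi A - lo A)"
        using gap_le[OF A y, of "hi A - lo A"] lo_le_hi[OF A pos] elim(1) by (simp add: peak_mass_def)
      then have "\<bar>residual A \<omega>\<bar> \<le> 2 * (\<theta> * measure \<nu> A * (hi A - lo A))"
        unfolding residual_def abs_mult using fac R0 by (intro mult_mono) auto
      then show ?thesis using True elim(2) by (simp add: osc_eq mult.assoc)
    next
      case False
      then have "?R \<le> 0" using gap_le[OF A y, of 0] by (simp add: peak_mass_def)
      then have "residual A \<omega> = 0" using R0 by (simp add: residual_def)
      then show ?thesis using False by simp
    qed
  qed
qed

text \<open>
  The oscillation enters twice, once as the size of the residual and once as the probability that it does not vanish.
\<close>
lemma residual_expectation:
  assumes A: "A \<in> sets \<nu>" and pos: "0 < measure \<nu> A"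
  shows "integrable P (residual A)"
    and "P.expectation (\<lambda>\<omega>. \<bar>residual A \<omega>\<bar>) \<le> 2 * (\<theta> * (measure \<nu> A * ess_osc_on \<nu> f A))\<^sup>2"
proof -
  note [measurable] = peak_measurable[OF A] residual_measurable[OF A]
  let ?d = "\<theta> * (measure \<nu> A * ess_osc_on \<nu> f A)"
  let ?B = "{\<omega> \<in> space P. lo A < peak A \<omega>}"
  have d: "0 \<le> ?d" using theta_pos lo_le_hi[OF A pos] by (simp add: osc_eq)
  have B: "?B \<in> sets P" by measurable
  have int: "integrable P (\<lambda>\<omega>. 2 * ?d * indicator ?B \<omega>)"
    using B by (intro integrable_mult_right integrable_real_indicator) (auto simp: less_top[symmetric])
  show intR: "integrable P (residual A)"
  proof (rule Bochner_Integration.integrable_bound[OF int])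
    show "AE \<omega> in P. norm (residual A \<omega>) \<le> norm (2 * ?d * indicator ?B \<omega>)"
      using residual_le[OF assms]
    proof eventually_elim
      case (elim \<omega>)
      from order_trans[OF elim abs_ge_self] show ?case by (simp only: real_norm_def)
    qed
  qed measurable
  have lo0: "0 \<le> lo A" by simp
  have "P.prob ?B \<le> ?d"
  proof -
    have "?B = space P - {\<omega>\<in>space P. peak A \<omega> \<le> lo A}" by auto
    then have "P.prob ?B = 1 - P.prob {\<omega>\<in>space P. peak A \<omega> \<le> lo A}"
      by (simp only:) (rule P.prob_compl, measurable)
    also have "\<dots> = 1 - exp (- (mass A - mass_below A (lo A)))" by (simp only: prob_peak_le[OF A lo0])
    also have "\<dots> \<le> mass A - mass_below A (lo A)"
      using exp_ge_add_one_self[of "- (mass A - mass_below A (lo A))"] by linarith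
    also have "mass_below A (lo A) = \<theta> * measure \<nu> A * lo A"
      using gap_le[OF A lo0, of 0] gap_nonneg[OF A lo0] by simp
    also have "mass A - \<theta> * measure \<nu> A * lo A \<le> ?d"
      using mass_bounds(2)[OF A] by (simp add: osc_eq algebra_simps)
    finally show ?thesis .
  qed
  have "P.expectation (\<lambda>\<omega>. \<bar>residual A \<omega>\<bar>) \<le> P.expectation (\<lambda>\<omega>. 2 * ?d * indicator ?B \<omega>)"
    by (rule integral_mono_AE) (use intR int residual_le[OF assms] in auto)
  also have "\<dots> = 2 * ?d * P.prob (?B \<inter> space P)" by simp
  also have "?B \<inter> space P = ?B" by blast
  also have "2 * ?d * P.prob ?B \<le> 2 * ?d * ?d" using \<open>P.prob ?B \<le> ?d\<close> d by (intro mult_left_mono) auto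
  finally show "P.expectation (\<lambda>\<omega>. \<bar>residual A \<omega>\<bar>) \<le> 2 * ?d\<^sup>2" by (simp only: power2_eq_square mult.assoc)
qed

lemma mass_eq_cell_mean:
  "0 < measure \<nu> A \<Longrightarrow> mass A = \<theta> * (measure \<nu> A * cell_mean \<nu> f A)"
  by (simp add: mass_def cell_mean_def)

lemma mass_space: "mass (space \<nu>) = \<theta> * expectation f"
proof -
  have "(LINT x:space \<nu>|\<nu>. f x) = expectation f"
    unfolding set_lebesgue_integral_def by (rule Bochner_Integration.integral_cong) auto
  then show ?thesis by (simp add: mass_def)
qed

lemma mass_partition:
  fixes A :: "nat \<Rightarrow> 'a set"
  assumes "finite J" "\<And>r. r \<in> J \<Longrightarrow> A r \<in> sets \<nu>" "disjoint_family_on A J" "(\<Union>r\<in>J. A r) = space \<nu>"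
  shows "(\<Sum>r\<in>J. mass (A r)) = \<theta> * expectation f"
proof -
  have "(LINT x:(\<Union>r\<in>J. A r)|\<nu>. f x) = (\<Sum>r\<in>J. LINT x:A r|\<nu>. f x)"
    by (rule set_integral_finite_Union) (use assms in \<open>auto intro: integrable_f\<close>)
  then have "mass (space \<nu>) = (\<Sum>r\<in>J. mass (A r))"
    unfolding assms(4) by (simp add: mass_def sum_distrib_left)
  then show ?thesis by (simp add: mass_space)
qed

lemma mass_lower:
  assumes "A \<in> sets \<nu>" "0 < measure \<nu> A"
  shows "\<theta> * measure \<nu> A * lo (space \<nu>) \<le> mass A"
proof -
  have "\<theta> * measure \<nu> A * lo (space \<nu>) \<le> \<theta> * measure \<nu> A * lo A"
    using theta_pos lo_mono[OF assms] by (intro mult_left_mono) auto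
  also have "\<dots> \<le> mass A" by (rule mass_bounds(1)[OF assms(1)])
  finally show ?thesis .
qed

lemma total_measurable: "(\<lambda>\<omega>. measure (N \<omega>) (region_below f (space \<nu>))) \<in> borel_measurable P"
proof -
  have [measurable]: "count (region_below f (space \<nu>)) \<in> measurable P (count_space UNIV)"
    by (rule count_region_measurable) simp
  have "(\<lambda>\<omega>. real (count (region_below f (space \<nu>)) \<omega>)) \<in> borel_measurable P" by measurable
  also have "?this \<longleftrightarrow> ?thesis"
    by (rule measurable_cong) (simp add: measure_eq_count[OF _ region_sets[OF sets.top]])
  finally show ?thesis .
qed

lemma total_concentration:
  assumes e: "0 < e"
  shows "P.prob {\<omega>\<in>space P. e * (\<theta> * expectation f) \<le> \<bar>measure (N \<omega>) (region_below f (space \<nu>)) - \<theta> * expectation f\<bar>}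
    \<le> 1 / (e\<^sup>2 * (\<theta> * expectation f))"
proof -
  have pos: "0 < mass (space \<nu>)" by (rule mass_pos) (simp_all add: prob_space)
  have "P.prob {\<omega>\<in>space P. e * mass (space \<nu>) \<le> \<bar>real (count (region_below f (space \<nu>)) \<omega>) - mass (space \<nu>)\<bar>}
      \<le> 1 / (e\<^sup>2 * mass (space \<nu>))"
    by (rule P.poisson_concentration[OF count_region_measurable[OF sets.top] count_law[OF region_sets[OF sets.top] intensity_region[OF sets.top]] pos e])
       (use pos in simp)
  moreover have "{\<omega>\<in>space P. e * mass (space \<nu>) \<le> \<bar>real (count (region_below f (space \<nu>)) \<omega>) - mass (space \<nu>)\<bar>} =
      {\<omega>\<in>space P. e * mass (space \<nu>) \<le> \<bar>measure (N \<omega>) (region_below f (space \<nu>)) - mass (space \<nu>)\<bar>}"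
    using measure_eq_count[OF _ region_sets[OF sets.top]] by auto
  ultimately show ?thesis by (simp only: mass_space)
qed

text \<open>
  The cells of one partition, freed from the point process: the corrected maxima are their targets \<open>\<mu>\<close> plus independent deviations \<open>Z\<close> plus residuals \<open>R\<close>.
\<close>
lemma corrected_max_decomposition:
  fixes A :: "nat \<Rightarrow> 'a set"
  assumes J: "finite J" and A: "\<And>r. r \<in> J \<Longrightarrow> A r \<in> sets \<nu> \<and> 0 < measure \<nu> (A r)"
    and disj: "disjoint_family_on A J"
  shows "\<exists>Z R \<mu>. P.indep_vars (\<lambda>_. borel) Z J \<and>
    (\<forall>r\<in>J. integrable P (Z r) \<and> P.expectation (\<lambda>\<omega>. \<bar>Z r \<omega>\<bar>) \<le> 49 \<and>
      (\<forall>t. cmod (char (distr P borel (Z r)) t - complex_of_real (exp (- t\<^sup>2 / 2))) \<le>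
        \<bar>t\<bar> * (\<mu> r * exp (- \<mu> r)) + 2 * t\<^sup>2 / \<mu> r + 8 * \<bar>t\<bar> ^ 3 + t ^ 4 / 8) \<and>
      integrable P (R r) \<and> P.expectation (\<lambda>\<omega>. \<bar>R r \<omega>\<bar>) \<le> 2 * (\<theta> * (measure \<nu> (A r) * ess_osc_on \<nu> f (A r)))\<^sup>2 \<and>
      \<mu> r = \<theta> * (measure \<nu> (A r) * cell_mean \<nu> f (A r)) \<and>
      \<theta> * measure \<nu> (A r) * lo (space \<nu>) \<le> \<mu> r \<and>
      (\<forall>\<omega>\<in>space P. \<theta> * measure \<nu> (A r) * corrected_max f (N \<omega>) (K \<omega>) (X \<omega>) (Y \<omega>) (A r) = \<mu> r + Z r \<omega> + R r \<omega>))"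
proof (rule exI[of _ "\<lambda>r. cell_deviation (A r)"], rule exI[of _ "\<lambda>r. residual (A r)"],
    rule exI[of _ "\<lambda>r. mass (A r)"], intro conjI ballI allI)
  show "P.indep_vars (\<lambda>_. borel) (\<lambda>r. cell_deviation (A r)) J"
    by (rule cell_deviations_independent[OF J _ disj]) (use A in blast)
  fix r assume r: "r \<in> J"
  note Ar = A[OF r, THEN conjunct1] A[OF r, THEN conjunct2]
  show "integrable P (cell_deviation (A r))" by (rule cell_deviation_integrable[OF Ar])
  show "P.expectation (\<lambda>\<omega>. \<bar>cell_deviation (A r) \<omega>\<bar>) \<le> 49" by (rule cell_deviation_abs[OF Ar])
  show "cmod (char (distr P borel (cell_deviation (A r))) t - complex_of_real (exp (- t\<^sup>2 / 2))) \<le>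
        \<bar>t\<bar> * (mass (A r) * exp (- mass (A r))) + 2 * t\<^sup>2 / mass (A r) + 8 * \<bar>t\<bar> ^ 3 + t ^ 4 / 8" for t
    by (rule cell_deviation_char[OF Ar])
  show "integrable P (residual (A r))" by (rule residual_expectation(1)[OF Ar])
  show "P.expectation (\<lambda>\<omega>. \<bar>residual (A r) \<omega>\<bar>) \<le> 2 * (\<theta> * (measure \<nu> (A r) * ess_osc_on \<nu> f (A r)))\<^sup>2"
    by (rule residual_expectation(2)[OF Ar])
  show "mass (A r) = \<theta> * (measure \<nu> (A r) * cell_mean \<nu> f (A r))" by (rule mass_eq_cell_mean[OF Ar(2)])
  show "\<theta> * measure \<nu> (A r) * lo (space \<nu>) \<le> mass (A r)" by (rule mass_lower[OF Ar])
  show "\<theta> * measure \<nu> (A r) * corrected_max f (N \<omega>) (K \<omega>) (X \<omega>) (Y \<omega>) (A r) =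
      mass (A r) + cell_deviation (A r) \<omega> + residual (A r) \<omega>" if "\<omega> \<in> space P" for \<omega>
    by (rule corrected_max_eq[OF Ar(1) that])
qed

end

section \<open>Asymptotic normality of the edge estimator\<close>

theorem corollary1:
  fixes P :: "'w measure" and \<nu> :: "'a measure" and f :: "'a \<Rightarrow> real" and c :: real
    and N :: "nat \<Rightarrow> 'w \<Rightarrow> ('a \<times> real) measure"
    and K :: "nat \<Rightarrow> 'w \<Rightarrow> nat"
    and X :: "nat \<Rightarrow> 'w \<Rightarrow> nat \<Rightarrow> 'a" and Y :: "nat \<Rightarrow> 'w \<Rightarrow> nat \<Rightarrow> real"
    and k :: "nat \<Rightarrow> nat" and I :: "nat \<Rightarrow> nat \<Rightarrow> 'a set"
    and \<kappa> :: "nat \<Rightarrow> nat \<Rightarrow> 'a \<Rightarrow> real"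
    and F :: "'a set" and \<sigma> :: "'a \<Rightarrow> 'a \<Rightarrow> real"
    and x :: "'p::finite \<Rightarrow> 'a"
  assumes "prob_space P" and "prob_space \<nu>"
    and "f \<in> borel_measurable \<nu>" and "\<And>z. z \<in> space \<nu> \<Longrightarrow> 0 \<le> f z"
    and "0 < c"
    \<comment> \<open>the point processes and their points; \<open>K n\<close> is the total number of points\<close>
    and "\<And>n. 1 \<le> n \<Longrightarrow> poisson_point_process P (strip_intensity \<nu> f (real n * c)) (N n)"
    and "\<And>n \<omega>. 1 \<le> n \<Longrightarrow> \<omega> \<in> space P \<Longrightarrow>
           emeasure (N n \<omega>) (region_below f (space \<nu>)) = of_nat (K n \<omega>)"
    and "\<And>n \<omega> A. 1 \<le> n \<Longrightarrow> \<omega> \<in> space P \<Longrightarrow> A \<in> sets (\<nu> \<Otimes>\<^sub>M restrict_space lborel {0..}) \<Longrightarrow>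
           emeasure (N n \<omega>) A = of_nat (card {i \<in> {1..K n \<omega>}. (X n \<omega> i, Y n \<omega> i) \<in> A})"
    \<comment> \<open>the partitions and the weights\<close>
    and "\<And>n. 1 \<le> n \<Longrightarrow> 1 \<le> k n"
    and "\<And>n r. 1 \<le> n \<Longrightarrow> r \<in> {1..k n} \<Longrightarrow> I n r \<in> sets \<nu> \<and> 0 < measure \<nu> (I n r)"
    and "\<And>n. 1 \<le> n \<Longrightarrow> disjoint_family_on (I n) {1..k n} \<and> (\<Union>r\<in>{1..k n}. I n r) = space \<nu>"
    and "F \<subseteq> space \<nu>"
    and "\<And>n z. 1 \<le> n \<Longrightarrow> z \<in> F \<Longrightarrow> 0 < weight_norm (k n) (\<kappa> n) z"
    \<comment> \<open>(1)\<close>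
    and "mono_on {1..} k" and "filterlim k at_top sequentially"
    and "filterlim (\<lambda>n. real n * (MIN r\<in>{1..k n}. measure \<nu> (I n r))) at_top sequentially"
    \<comment> \<open>(2)\<close>
    and "0 < ess_inf_on \<nu> f (space \<nu>)"
    and "ess_inf_on \<nu> f (space \<nu>) \<le> ess_sup_on \<nu> f (space \<nu>)"
    and "ess_sup_on \<nu> f (space \<nu>) < \<infinity>"
    and "(\<lambda>n. MAX r\<in>{1..k n}. measure \<nu> (I n r) * ess_osc_on \<nu> f (I n r)) \<in> o(\<lambda>n. 1 / real n)"
    \<comment> \<open>(3)\<close>
    and "\<And>(q::nat) z. 1 \<le> q \<Longrightarrow> (\<forall>i\<in>{1..q}. z i \<in> F) \<Longrightarrow>
           covariance_matrix {1..q} (\<lambda>i j. \<sigma> (z i) (z j)) \<and>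
           (\<forall>i\<in>{1..q}. \<forall>j\<in>{1..q}.
              (\<lambda>n. \<Sum>r=1..k n. norm_weight (k n) (\<kappa> n) r (z i) * norm_weight (k n) (\<kappa> n) r (z j))
                \<longlonglongrightarrow> \<sigma> (z i) (z j))"
    \<comment> \<open>(4)\<close>
    and "\<And>z. z \<in> F \<Longrightarrow> (\<lambda>n. MAX r\<in>{1..k n}. \<bar>norm_weight (k n) (\<kappa> n) r z\<bar>) \<longlonglongrightarrow> 0"
    \<comment> \<open>(5)\<close>
    and "\<And>z. z \<in> F \<Longrightarrow>
           (\<lambda>n. \<bar>(\<Sum>r=1..k n. measure \<nu> (I n r) * \<kappa> n r z * cell_mean \<nu> f (I n r)) - f z\<bar>)
             \<in> o(\<lambda>n. weight_norm (k n) (\<kappa> n) z / real n)"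
    \<comment> \<open>(6)\<close>
    and "\<And>z. z \<in> F \<Longrightarrow>
           (\<lambda>n. (\<Sum>r=1..k n. \<bar>norm_weight (k n) (\<kappa> n) r z\<bar>) *
                Max {(real n * (MAX r\<in>{1..k n}. measure \<nu> (I n r) * ess_osc_on \<nu> f (I n r)))\<^sup>2,
                     real n * (MIN r\<in>{1..k n}. measure \<nu> (I n r)) *
                       exp (- (enn2real (ess_inf_on \<nu> f (space \<nu>)) * c * real n *
                               (MIN r\<in>{1..k n}. measure \<nu> (I n r)))),
                     MAX r\<in>{1..k n}. ess_osc_on \<nu> f (I n r)}) \<longlonglongrightarrow> 0"
    and "\<And>j. x j \<in> F"
  shows "\<exists>L. centered_gaussian (\<chi> i j. \<sigma> (x i) (x j)) L \<and>
           converges_in_distribution P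
             (\<lambda>n \<omega>. \<chi> j.
                real n * intensity_estimator \<nu> f n (k n) (I n) (N n \<omega>) (K n \<omega>) (X n \<omega>) (Y n \<omega>)
                  / weight_norm (k n) (\<kappa> n) (x j) *
                (edge_estimator \<nu> f (k n) (I n) (\<kappa> n) (N n \<omega>) (K n \<omega>) (X n \<omega>) (Y n \<omega>) (x j) - f (x j)))
             L"
proof -
  interpret P: prob_space P by (rule assms(1))
  interpret bounded_edge \<nu> f
    by (rule bounded_edge.intro[OF assms(2)]) (unfold_locales, use assms(3,4,17,19) in auto)
  have sp: "strip_process \<nu> f P (real n * c) (N n) (K n) (X n) (Y n)" if n: "1 \<le> n" for n
  proof (intro strip_process.intro strip_process_axioms.intro)
    show "bounded_edge \<nu> f" by (rule bounded_edge_axioms)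
    show "prob_space P" by (rule assms(1))
    show "0 < real n * c" using n assms(5) by simp
  qed (use assms(6)[OF n] assms(7)[OF n] assms(8)[OF n] in auto)
  define J where "J n = {1..k n}" for n
  have J: "finite (J n)" for n by (simp add: J_def)
  have J_ne: "J n \<noteq> {}" if "1 \<le> n" for n using assms(9)[OF that] by (simp add: J_def)
  have cell: "I n r \<in> sets \<nu> \<and> 0 < measure \<nu> (I n r)" if "1 \<le> n" "r \<in> J n" for n r
    using assms(10)[OF that(1)] that(2) by (simp add: J_def)
  have disj: "disjoint_family_on (I n) (J n)" "(\<Union>r\<in>J n. I n r) = space \<nu>" if "1 \<le> n" for n
    using assms(11)[OF that] by (simp_all add: J_def)
  define a where "a = expectation f"
  define m0 where "m0 = lo (space \<nu>)"
  have m0: "0 < m0" unfolding m0_def by (rule lo_space_pos)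
  define \<nu>m where "\<nu>m n = (MIN r\<in>J n. measure \<nu> (I n r))" for n
  define \<delta> where "\<delta> n = (MAX r\<in>J n. measure \<nu> (I n r) * ess_osc_on \<nu> f (I n r))" for n
  define w where "w n r z = norm_weight (k n) (\<kappa> n) r z" for n r z
  define W where "W n z = (\<Sum>r\<in>J n. \<bar>w n r z\<bar>)" for n z
  define corr where "corr n r \<omega> = corrected_max f (N n \<omega>) (K n \<omega>) (X n \<omega>) (Y n \<omega>) (I n r)" for n r \<omega>
  define tot where "tot n \<omega> = measure (N n \<omega>) (region_below f (space \<nu>))" for n \<omega>

  \<comment> \<open>From here on the point process enters only through the arrays \<open>Z\<close>, \<open>R\<close>, \<open>\<mu>\<close> and the total number of points.\<close>
  define Q where "Q n Z R \<mu> \<longleftrightarrow> P.indep_vars (\<lambda>_. borel) Z (J n) \<and>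
    (\<forall>r\<in>J n. integrable P (Z r) \<and> P.expectation (\<lambda>\<omega>. \<bar>Z r \<omega>\<bar>) \<le> 49 \<and>
      (\<forall>t. cmod (char (distr P borel (Z r)) t - complex_of_real (exp (- t\<^sup>2 / 2))) \<le>
        \<bar>t\<bar> * (\<mu> r * exp (- \<mu> r)) + 2 * t\<^sup>2 / \<mu> r + 8 * \<bar>t\<bar> ^ 3 + t ^ 4 / 8) \<and>
      integrable P (R r) \<and> P.expectation (\<lambda>\<omega>. \<bar>R r \<omega>\<bar>) \<le> 2 * (real n * c * (measure \<nu> (I n r) * ess_osc_on \<nu> f (I n r)))\<^sup>2 \<and>
      \<mu> r = real n * c * (measure \<nu> (I n r) * cell_mean \<nu> f (I n r)) \<and>
      real n * c * measure \<nu> (I n r) * m0 \<le> \<mu> r \<and>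
      (\<forall>\<omega>\<in>space P. real n * c * measure \<nu> (I n r) * corr n r \<omega> = \<mu> r + Z r \<omega> + R r \<omega>))"
    for n and Z R :: "nat \<Rightarrow> 'w \<Rightarrow> real" and \<mu> :: "nat \<Rightarrow> real"
  have "\<exists>Z R \<mu>. Q n Z R \<mu>" if "1 \<le> n" for n
    unfolding Q_def corr_def m0_def
    by (rule strip_process.corrected_max_decomposition[OF sp[OF that] J cell[OF that] disj(1)[OF that]])
  then obtain Z R \<mu> where Q: "\<And>n. 1 \<le> n \<Longrightarrow> Q n (Z n) (R n) (\<mu> n)" by metis
  have Z_indep: "P.indep_vars (\<lambda>_. borel) (Z n) (J n)" if "1 \<le> n" for n
    using Q[OF that] unfolding Q_def by (rule conjunct1)
  note Qr = Q[unfolded Q_def, THEN conjunct2, rule_format]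
  have Z_int: "integrable P (Z n r)" and Z_abs: "P.expectation (\<lambda>\<omega>. \<bar>Z n r \<omega>\<bar>) \<le> 49"
    and Z_char: "cmod (char (distr P borel (Z n r)) t - complex_of_real (exp (- t\<^sup>2 / 2))) \<le>
        \<bar>t\<bar> * (\<mu> n r * exp (- \<mu> n r)) + 2 * t\<^sup>2 / \<mu> n r + 8 * \<bar>t\<bar> ^ 3 + t ^ 4 / 8"
    and R_int: "integrable P (R n r)"
    and R_abs0: "P.expectation (\<lambda>\<omega>. \<bar>R n r \<omega>\<bar>) \<le> 2 * (real n * c * (measure \<nu> (I n r) * ess_osc_on \<nu> f (I n r)))\<^sup>2"
    and \<mu>_eq: "\<mu> n r = real n * c * (measure \<nu> (I n r) * cell_mean \<nu> f (I n r))"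
    and \<mu>_ge: "real n * c * measure \<nu> (I n r) * m0 \<le> \<mu> n r"
    and corr_eq: "\<omega> \<in> space P \<Longrightarrow> real n * c * measure \<nu> (I n r) * corr n r \<omega> = \<mu> n r + Z n r \<omega> + R n r \<omega>"
    if "1 \<le> n" "r \<in> J n" for n r t \<omega>
    using Qr[OF that] by blast+

  have c: "0 < c" by (rule assms(5))
  have \<nu>m_le: "\<nu>m n \<le> measure \<nu> (I n r)" if "r \<in> J n" for n r
    unfolding \<nu>m_def using that J by (intro Min_le) auto
  have \<nu>m_pos: "0 < \<nu>m n" if "1 \<le> n" for n
    unfolding \<nu>m_def using J J_ne[OF that] cell[OF that] by (subst Min_gr_iff) auto
  have n\<nu>: "filterlim (\<lambda>n. real n * \<nu>m n) at_top sequentially"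
    using assms(16) by (simp only: \<nu>m_def J_def)
  have osc_nonneg: "0 \<le> ess_osc_on \<nu> f (I n r)" if "1 \<le> n" "r \<in> J n" for n r
    using lo_le_hi cell[OF that] by (simp add: osc_eq)
  have \<delta>_ge: "measure \<nu> (I n r) * ess_osc_on \<nu> f (I n r) \<le> \<delta> n" if "r \<in> J n" for n r
    unfolding \<delta>_def using that J by (intro Max_ge) auto
  have "(\<lambda>n. \<delta> n / (1 / real n)) \<longlonglongrightarrow> 0"
    using smalloD_tendsto[OF assms(20)] by (simp only: \<delta>_def J_def)
  then have n\<delta>: "(\<lambda>n. real n * \<delta> n) \<longlonglongrightarrow> 0" by (simp add: mult.commute)
  define \<epsilon> where "\<epsilon> n = 2 * c\<^sup>2 * (real n * \<delta> n)\<^sup>2" for n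
  have R_abs: "P.expectation (\<lambda>\<omega>. \<bar>R n r \<omega>\<bar>) \<le> \<epsilon> n" if "1 \<le> n" "r \<in> J n" for n r
  proof -
    have "(real n * c * (measure \<nu> (I n r) * ess_osc_on \<nu> f (I n r)))\<^sup>2 \<le> (real n * c * \<delta> n)\<^sup>2"
      using \<delta>_ge[OF that(2)] osc_nonneg[OF that] c by (intro power_mono mult_left_mono) auto
    then show ?thesis using R_abs0[OF that] by (simp add: \<epsilon>_def power_mult_distrib algebra_simps)
  qed
  have \<epsilon>_lim: "\<epsilon> \<longlonglongrightarrow> 0"
  proof -
    have "(\<lambda>n. 2 * c\<^sup>2 * (real n * \<delta> n)\<^sup>2) \<longlonglongrightarrow> 2 * c\<^sup>2 * 0\<^sup>2" by (intro tendsto_intros n\<delta>)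
    then show ?thesis by (simp add: \<epsilon>_def[abs_def])
  qed
  define m where "m n = m0 * c * (real n * \<nu>m n)" for n
  have m_lim: "filterlim m at_top sequentially"
    unfolding m_def using m0 c by (intro filterlim_tendsto_pos_mult_at_top[OF tendsto_const _ n\<nu>]) simp
  have m_le: "m n \<le> \<mu> n r" if "1 \<le> n" "r \<in> J n" for n r
  proof -
    have "m n \<le> m0 * c * (real n * measure \<nu> (I n r))"
      unfolding m_def using \<nu>m_le[OF that(2)] m0 c by (intro mult_left_mono) auto
    also have "\<dots> \<le> \<mu> n r" using \<mu>_ge[OF that] by (simp add: mult_ac)
    finally show ?thesis .
  qed
  have W_nonneg: "0 \<le> W n z" for n z by (simp add: W_def sum_nonneg)
  have W_\<epsilon>: "(\<lambda>n. W n z * \<epsilon> n) \<longlonglongrightarrow> 0" and W_m: "(\<lambda>n. W n z * (m n * exp (- m n))) \<longlonglongrightarrow> 0" if z: "z \<in> F" for z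
  proof -
    define T where "T n = Max {(real n * \<delta> n)\<^sup>2, real n * \<nu>m n * exp (- (m0 * c * real n * \<nu>m n)),
      MAX r\<in>J n. ess_osc_on \<nu> f (I n r)}" for n
    have lim: "(\<lambda>n. W n z * T n) \<longlonglongrightarrow> 0"
      using assms(24)[OF z] by (simp only: W_def T_def J_def \<delta>_def \<nu>m_def m0_def w_def)
    have T1: "(real n * \<delta> n)\<^sup>2 \<le> T n" and T2: "real n * \<nu>m n * exp (- (m0 * c * real n * \<nu>m n)) \<le> T n" for n
      unfolding T_def by (intro Max_ge; simp)+
    have "(\<lambda>n. W n z * (real n * \<delta> n)\<^sup>2) \<longlonglongrightarrow> 0"
      by (rule tendsto_sandwich[OF _ _ tendsto_const lim])
         (auto intro!: always_eventually mult_left_mono mult_nonneg_nonneg W_nonneg T1)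
    then have "(\<lambda>n. 2 * c\<^sup>2 * (W n z * (real n * \<delta> n)\<^sup>2)) \<longlonglongrightarrow> 0" by (rule tendsto_mult_right_zero)
    then show "(\<lambda>n. W n z * \<epsilon> n) \<longlonglongrightarrow> 0" by (simp add: \<epsilon>_def mult_ac)
    have "(\<lambda>n. W n z * (real n * \<nu>m n * exp (- (m0 * c * real n * \<nu>m n)))) \<longlonglongrightarrow> 0"
    proof (rule tendsto_sandwich[OF _ _ tendsto_const lim])
      show "\<forall>\<^sub>F n in sequentially. 0 \<le> W n z * (real n * \<nu>m n * exp (- (m0 * c * real n * \<nu>m n)))"
        using eventually_ge_at_top[of "1::nat"] by eventually_elim (use W_nonneg \<nu>m_pos in \<open>simp add: less_imp_le\<close>)
    qed (auto intro!: always_eventually mult_left_mono W_nonneg T2)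
    then have "(\<lambda>n. m0 * c * (W n z * (real n * \<nu>m n * exp (- (m0 * c * real n * \<nu>m n))))) \<longlonglongrightarrow> 0"
      by (rule tendsto_mult_right_zero)
    then show "(\<lambda>n. W n z * (m n * exp (- m n))) \<longlonglongrightarrow> 0" by (simp add: m_def mult_ac)
  qed
  have w_lim: "(\<lambda>n. \<Sum>r\<in>J n. w n r z * w n r z') \<longlonglongrightarrow> \<sigma> z z'" if "z \<in> F" "z' \<in> F" for z z'
  proof -
    \<comment> \<open>The covariance hypothesis speaks of finite lists of points; a list of length two suffices.\<close>
    define zz where "zz i = (if i = 1 then z else z')" for i :: nat
    have "\<forall>i\<in>{1..2}. zz i \<in> F" using that by (simp add: zz_def)
    from assms(21)[OF _ this] have "\<forall>i\<in>{1..2::nat}. \<forall>j\<in>{1..2}. (\<lambda>n. \<Sum>r = 1..k n. norm_weight (k n) (\<kappa> n) r (zz i) * norm_weight (k n) (\<kappa> n) r (zz j)) \<longlonglongrightarrow> \<sigma> (zz i) (zz j)"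
      by simp
    then have "(\<lambda>n. \<Sum>r = 1..k n. norm_weight (k n) (\<kappa> n) r (zz 1) * norm_weight (k n) (\<kappa> n) r (zz 2)) \<longlonglongrightarrow> \<sigma> (zz 1) (zz 2)"
      by (elim ballE) auto
    then show ?thesis by (simp add: zz_def w_def J_def)
  qed

  \<comment> \<open>The quadratic form of the limit covariance is the limit of the variances of the sums with weights \<open>b t n r\<close>, which also gives its positivity.\<close>
  define S where "S = (\<chi> i j. \<sigma> (x i) (x j))"
  define b where "b t n r = (\<Sum>j\<in>UNIV. t $ j * w n r (x j))" for t :: "real^'p" and n r
  have b2: "(\<lambda>n. \<Sum>r\<in>J n. (b t n r)\<^sup>2) \<longlonglongrightarrow> t \<bullet> (S *v t)" for t
  proof -
    have "(\<Sum>r\<in>J n. (b t n r)\<^sup>2) = (\<Sum>i\<in>UNIV. \<Sum>j\<in>UNIV. t $ i * t $ j * (\<Sum>r\<in>J n. w n r (x i) * w n r (x j)))" for n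
    proof -
      have "(\<Sum>r\<in>J n. (b t n r)\<^sup>2) = (\<Sum>r\<in>J n. \<Sum>i\<in>UNIV. \<Sum>j\<in>UNIV. t $ i * t $ j * (w n r (x i) * w n r (x j)))"
        unfolding b_def power2_eq_square sum_product by (intro sum.cong refl) (simp add: mult_ac)
      also have "\<dots> = (\<Sum>i\<in>UNIV. \<Sum>r\<in>J n. \<Sum>j\<in>UNIV. t $ i * t $ j * (w n r (x i) * w n r (x j)))" by (rule sum.swap)
      also have "\<dots> = (\<Sum>i\<in>UNIV. \<Sum>j\<in>UNIV. \<Sum>r\<in>J n. t $ i * t $ j * (w n r (x i) * w n r (x j)))"
        by (intro sum.cong refl sum.swap)
      finally show ?thesis by (simp add: sum_distrib_left)
    qed
    moreover have "(\<lambda>n. \<Sum>i\<in>UNIV. \<Sum>j\<in>UNIV. t $ i * t $ j * (\<Sum>r\<in>J n. w n r (x i) * w n r (x j))) \<longlonglongrightarrow>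
        (\<Sum>i\<in>UNIV. \<Sum>j\<in>UNIV. t $ i * t $ j * \<sigma> (x i) (x j))"
      by (intro tendsto_intros w_lim assms(25))
    moreover have "t \<bullet> (S *v t) = (\<Sum>i\<in>UNIV. \<Sum>j\<in>UNIV. t $ i * t $ j * \<sigma> (x i) (x j))"
      by (simp add: S_def inner_vec_def matrix_vector_mult_def sum_distrib_left mult_ac)
    ultimately show ?thesis by simp
  qed
  have psd: "0 \<le> t \<bullet> (S *v t)" for t
    by (rule LIMSEQ_le_const[OF b2]) (intro exI allI impI sum_nonneg zero_le_power2)
  have S_sym: "S $ i $ j = S $ j $ i" for i j
  proof -
    have "(\<lambda>n. \<Sum>r\<in>J n. w n r (x i) * w n r (x j)) \<longlonglongrightarrow> \<sigma> (x j) (x i)"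
      using w_lim[OF assms(25) assms(25), of j i] by (simp add: mult.commute)
    from LIMSEQ_unique[OF w_lim[OF assms(25) assms(25)] this] show ?thesis by (simp add: S_def)
  qed
  obtain L where L: "centered_gaussian S L" using centered_gaussian_exists[OF S_sym psd] by blast
  have L_prob: "prob_space L" "sets L = sets borel" using L by (simp_all add: centered_gaussian_def)

  have main: "(\<lambda>n. CLINT \<omega>|P. iexp (\<Sum>r\<in>J n. b t n r * Z n r \<omega>)) \<longlonglongrightarrow> complex_of_real (exp (- (t \<bullet> (S *v t)) / 2))" for t
  proof -
    define \<beta> where "\<beta> n = (\<Sum>j\<in>UNIV. \<bar>t $ j\<bar> * (MAX r\<in>J n. \<bar>w n r (x j)\<bar>))" for n
    have b_abs: "\<bar>b t n r\<bar> \<le> (\<Sum>j\<in>UNIV. \<bar>t $ j\<bar> * \<bar>w n r (x j)\<bar>)" for n r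
      unfolding b_def by (rule order_trans[OF sum_abs]) (simp add: abs_mult)
    have "(\<lambda>n. MAX r\<in>J n. \<bar>w n r (x j)\<bar>) \<longlonglongrightarrow> 0" for j
      using assms(22)[OF assms(25)] by (simp only: J_def w_def)
    then have "\<beta> \<longlonglongrightarrow> (\<Sum>j\<in>UNIV. \<bar>t $ j\<bar> * 0)" unfolding \<beta>_def by (intro tendsto_intros)
    then have \<beta>_lim: "\<beta> \<longlonglongrightarrow> 0" by simp
    have b_le: "\<bar>b t n r\<bar> \<le> \<beta> n" if "r \<in> J n" for n r
    proof -
      have "(\<Sum>j\<in>UNIV. \<bar>t $ j\<bar> * \<bar>w n r (x j)\<bar>) \<le> \<beta> n"
        unfolding \<beta>_def using that J by (intro sum_mono mult_left_mono Max_ge) auto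
      then show ?thesis using b_abs[of n r] by linarith
    qed
    have bias: "(\<lambda>n. (\<Sum>r\<in>J n. \<bar>b t n r\<bar>) * (m n * exp (- m n))) \<longlonglongrightarrow> 0"
    proof (rule tendsto_sandwich[OF _ _ tendsto_const])
      show "(\<lambda>n. \<Sum>j\<in>UNIV. \<bar>t $ j\<bar> * (W n (x j) * (m n * exp (- m n)))) \<longlonglongrightarrow> 0"
      proof -
        have "(\<lambda>n. \<Sum>j\<in>UNIV. \<bar>t $ j\<bar> * (W n (x j) * (m n * exp (- m n)))) \<longlonglongrightarrow> (\<Sum>j\<in>(UNIV :: 'p set). \<bar>t $ j\<bar> * 0)"
          by (intro tendsto_sum tendsto_mult tendsto_const W_m assms(25))
        then show ?thesis by simp
      qed
      have m_nonneg: "0 \<le> m n" if "1 \<le> n" for n using m0 c \<nu>m_pos[OF that] by (simp add: m_def)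
      show "\<forall>\<^sub>F n in sequentially. 0 \<le> (\<Sum>r\<in>J n. \<bar>b t n r\<bar>) * (m n * exp (- m n))"
        using eventually_ge_at_top[of "1::nat"] by eventually_elim (use m_nonneg in \<open>simp add: sum_nonneg\<close>)
      show "\<forall>\<^sub>F n in sequentially. (\<Sum>r\<in>J n. \<bar>b t n r\<bar>) * (m n * exp (- m n)) \<le> (\<Sum>j\<in>UNIV. \<bar>t $ j\<bar> * (W n (x j) * (m n * exp (- m n))))"
        using eventually_ge_at_top[of "1::nat"]
      proof eventually_elim
        case (elim n)
        have "(\<Sum>r\<in>J n. \<bar>b t n r\<bar>) \<le> (\<Sum>r\<in>J n. \<Sum>j\<in>UNIV. \<bar>t $ j\<bar> * \<bar>w n r (x j)\<bar>)"
          by (intro sum_mono b_abs)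
        also have "\<dots> = (\<Sum>j\<in>UNIV. \<Sum>r\<in>J n. \<bar>t $ j\<bar> * \<bar>w n r (x j)\<bar>)" by (rule sum.swap)
        also have "\<dots> = (\<Sum>j\<in>UNIV. \<bar>t $ j\<bar> * W n (x j))" by (simp only: W_def sum_distrib_left)
        finally have "(\<Sum>r\<in>J n. \<bar>b t n r\<bar>) * (m n * exp (- m n)) \<le> (\<Sum>j\<in>UNIV. \<bar>t $ j\<bar> * W n (x j)) * (m n * exp (- m n))"
          using m_nonneg[OF elim] by (intro mult_right_mono) auto
        then show ?case by (simp only: sum_distrib_right mult.assoc)
      qed
    qed
    show ?thesis
      using P.array_clt[where Z=Z and b="b t" and \<mu>=\<mu> and k=k and m=m and \<beta>=\<beta> and s="t \<bullet> (S *v t)"]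
        Z_indep Z_char m_le m_lim b_le \<beta>_lim bias b2[of t] unfolding J_def by blast
  qed

  \<comment> \<open>The errors normalised with the true constant \<open>c\<close>: they differ from the main sums by residuals and by the deterministic bias of the weights.\<close>
  define bias where "bias n z = c * real n / weight_norm (k n) (\<kappa> n) z *
    ((\<Sum>r\<in>J n. measure \<nu> (I n r) * \<kappa> n r z * cell_mean \<nu> f (I n r)) - f z)" for n z
  define T where "T n j \<omega> = (\<Sum>r\<in>J n. w n r (x j) * (Z n r \<omega> + R n r \<omega>)) + bias n (x j)" for n j \<omega>
  have bias_lim: "(\<lambda>n. bias n (x j)) \<longlonglongrightarrow> 0" for j
  proof -
    have "(\<lambda>n. \<bar>(\<Sum>r\<in>J n. measure \<nu> (I n r) * \<kappa> n r (x j) * cell_mean \<nu> f (I n r)) - f (x j)\<bar> / (weight_norm (k n) (\<kappa> n) (x j) / real n)) \<longlonglongrightarrow> 0"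
      using smalloD_tendsto[OF assms(23)[OF assms(25)]] by (simp only: J_def)
    then have "(\<lambda>n. c * (\<bar>(\<Sum>r\<in>J n. measure \<nu> (I n r) * \<kappa> n r (x j) * cell_mean \<nu> f (I n r)) - f (x j)\<bar> / (weight_norm (k n) (\<kappa> n) (x j) / real n))) \<longlonglongrightarrow> 0"
      by (rule tendsto_mult_right_zero)
    then have "(\<lambda>n. \<bar>bias n (x j)\<bar>) \<longlonglongrightarrow> 0"
    proof (rule Lim_transform_eventually)
      show "\<forall>\<^sub>F n in sequentially. c * (\<bar>(\<Sum>r\<in>J n. measure \<nu> (I n r) * \<kappa> n r (x j) * cell_mean \<nu> f (I n r)) - f (x j)\<bar> / (weight_norm (k n) (\<kappa> n) (x j) / real n)) = \<bar>bias n (x j)\<bar>"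
        using eventually_ge_at_top[of "1::nat"]
      proof eventually_elim
        case (elim n)
        have "0 < weight_norm (k n) (\<kappa> n) (x j)" by (rule assms(13)[OF elim assms(25)])
        then show ?case using c by (simp add: bias_def abs_mult)
      qed
    qed
    then show ?thesis by (rule tendsto_rabs_zero_cancel)
  qed
  have T_meas: "T n j \<in> borel_measurable P" if "1 \<le> n" for n j
    unfolding T_def using borel_measurable_integrable[OF Z_int[OF that]] borel_measurable_integrable[OF R_int[OF that]]
    by (intro borel_measurable_add borel_measurable_sum borel_measurable_times borel_measurable_const) auto
  have wR_null: "null_in_probability P (\<lambda>n \<omega>. \<Sum>r\<in>J n. w n r (x j) * R n r \<omega>)" for j
  proof (rule P.null_in_probability_of_L1[OF _ W_\<epsilon>[OF assms(25)[of j]]])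
    show "\<forall>\<^sub>F n in sequentially. integrable P (\<lambda>\<omega>. \<Sum>r\<in>J n. w n r (x j) * R n r \<omega>) \<and>
        P.expectation (\<lambda>\<omega>. \<bar>\<Sum>r\<in>J n. w n r (x j) * R n r \<omega>\<bar>) \<le> W n (x j) * \<epsilon> n"
      using eventually_ge_at_top[of "1::nat"]
    proof eventually_elim
      case (elim n)
      have int: "integrable P (\<lambda>\<omega>. \<Sum>r\<in>J n. w n r (x j) * R n r \<omega>)"
        by (intro Bochner_Integration.integrable_sum integrable_mult_right R_int[OF elim])
      have "P.expectation (\<lambda>\<omega>. \<bar>\<Sum>r\<in>J n. w n r (x j) * R n r \<omega>\<bar>) \<le> P.expectation (\<lambda>\<omega>. \<Sum>r\<in>J n. \<bar>w n r (x j)\<bar> * \<bar>R n r \<omega>\<bar>)"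
      proof (rule integral_mono)
        show "integrable P (\<lambda>\<omega>. \<Sum>r\<in>J n. \<bar>w n r (x j)\<bar> * \<bar>R n r \<omega>\<bar>)"
          by (intro Bochner_Integration.integrable_sum integrable_mult_right integrable_abs R_int[OF elim])
        show "\<bar>\<Sum>r\<in>J n. w n r (x j) * R n r \<omega>\<bar> \<le> (\<Sum>r\<in>J n. \<bar>w n r (x j)\<bar> * \<bar>R n r \<omega>\<bar>)" for \<omega>
          by (rule order_trans[OF sum_abs]) (simp add: abs_mult)
      qed (rule integrable_abs[OF int])
      also have "\<dots> = (\<Sum>r\<in>J n. \<bar>w n r (x j)\<bar> * P.expectation (\<lambda>\<omega>. \<bar>R n r \<omega>\<bar>))"
        by (subst Bochner_Integration.integral_sum) (auto intro!: integrable_mult_right integrable_abs R_int[OF elim])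
      also have "\<dots> \<le> (\<Sum>r\<in>J n. \<bar>w n r (x j)\<bar> * \<epsilon> n)"
        by (intro sum_mono mult_left_mono R_abs[OF elim]) auto
      finally show ?case using int by (simp only: W_def sum_distrib_right simp_thms)
    qed
  qed
  have T_char: "(\<lambda>n. CLINT \<omega>|P. iexp (\<Sum>j\<in>UNIV. t $ j * T n j \<omega>)) \<longlonglongrightarrow> complex_of_real (exp (- (t \<bullet> (S *v t)) / 2))" for t
  proof (rule P.char_limit_transfer[OF _ _ _ main])
    have eq: "(\<Sum>j\<in>UNIV. t $ j * T n j \<omega>) - (\<Sum>r\<in>J n. b t n r * Z n r \<omega>) =
        (\<Sum>j\<in>UNIV. t $ j * ((\<Sum>r\<in>J n. w n r (x j) * R n r \<omega>) + bias n (x j)))" for n \<omega>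
    proof -
      have "(\<Sum>r\<in>J n. b t n r * Z n r \<omega>) = (\<Sum>r\<in>J n. \<Sum>j\<in>UNIV. t $ j * (w n r (x j) * Z n r \<omega>))"
        by (simp only: b_def sum_distrib_right mult.assoc)
      also have "\<dots> = (\<Sum>j\<in>UNIV. \<Sum>r\<in>J n. t $ j * (w n r (x j) * Z n r \<omega>))" by (rule sum.swap)
      also have "\<dots> = (\<Sum>j\<in>UNIV. t $ j * (\<Sum>r\<in>J n. w n r (x j) * Z n r \<omega>))" by (simp only: sum_distrib_left)
      finally show ?thesis
        by (simp only: sum_subtractf[symmetric] right_diff_distrib[symmetric])
           (simp add: T_def distrib_left sum.distrib)
    qed
    show "null_in_probability P (\<lambda>n \<omega>. (\<Sum>j\<in>UNIV. t $ j * T n j \<omega>) - (\<Sum>r\<in>J n. b t n r * Z n r \<omega>))"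
      unfolding eq
      by (intro P.null_in_probability_sum P.null_in_probability_cmult P.null_in_probability_add wR_null
          P.null_in_probability_deterministic bias_lim finite)
    show "\<forall>\<^sub>F n in sequentially. (\<lambda>\<omega>. \<Sum>j\<in>UNIV. t $ j * T n j \<omega>) \<in> borel_measurable P"
      using eventually_ge_at_top[of "1::nat"] by eventually_elim (intro borel_measurable_sum borel_measurable_times borel_measurable_const T_meas)
    show "\<forall>\<^sub>F n in sequentially. (\<lambda>\<omega>. \<Sum>r\<in>J n. b t n r * Z n r \<omega>) \<in> borel_measurable P"
      using eventually_ge_at_top[of "1::nat"]
    proof eventually_elim
      case (elim n)
      show ?case
        using borel_measurable_integrable[OF Z_int[OF elim]]
        by (intro borel_measurable_sum borel_measurable_times borel_measurable_const) auto
    qed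
  qed
  have T_tight: "\<exists>r>0. \<forall>\<^sub>F n in sequentially. P.prob {\<omega>\<in>space P. r < \<bar>T n j \<omega>\<bar>} < e" if "0 < e" for j e
  proof -
    define v where "v = axis j 1 \<bullet> (S *v axis j 1)"
    interpret G: real_distribution "gaussian_law v"
      by (rule gaussian_law_distribution) (simp add: v_def psd)
    have meas: "\<forall>\<^sub>F n in sequentially. T n j \<in> borel_measurable P"
      using eventually_ge_at_top[of "1::nat"] by eventually_elim (rule T_meas)
    have conv: "(\<lambda>n. CLINT \<omega>|P. iexp (u * T n j \<omega>)) \<longlonglongrightarrow> (CLINT z|gaussian_law v. iexp (u * z))" for u
    proof -
      have "(\<Sum>i\<in>UNIV. (u *\<^sub>R axis j 1) $ i * T n i \<omega>) = u * T n j \<omega>" for n \<omega>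
      proof -
        have "(\<Sum>i\<in>UNIV. (u *\<^sub>R axis j 1) $ i * T n i \<omega>) = (\<Sum>i\<in>UNIV. if i = j then u * T n j \<omega> else 0)"
          by (intro sum.cong refl) (auto simp: axis_def)
        then show ?thesis by simp
      qed
      moreover have "(u *\<^sub>R axis j 1) \<bullet> (S *v (u *\<^sub>R axis j 1)) = u\<^sup>2 * v"
        by (simp add: v_def matrix_vector_mult_scaleR power2_eq_square)
      moreover have "(CLINT z|gaussian_law v. iexp (u * z)) = complex_of_real (exp (- (u\<^sup>2 * v) / 2))"
        using char_gaussian_law[of v u] psd unfolding char_def v_def by blast
      ultimately show ?thesis using T_char[of "u *\<^sub>R axis j 1"] by (simp only:)
    qed
    show ?thesis
      by (rule tight_of_char_convergence[OF assms(1) G.prob_space_axioms G.events_eq_borel meas conv that]) blast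
  qed

  \<comment> \<open>\<open>a + G\<close> is the area estimator and \<open>a + H\<close> the rescaled number of points, so their ratio is the estimated intensity divided by \<open>c\<close>.\<close>
  define G where "G n \<omega> = (\<Sum>r\<in>J n. Z n r \<omega> + R n r \<omega>) / (real n * c)" for n \<omega>
  define H where "H n \<omega> = tot n \<omega> / (real n * c) - a" for n \<omega>
  have a_pos: "0 < a"
    using strip_process.mass_space[OF sp[of 1]] strip_process.mass_pos[OF sp[of 1] sets.top] c
    by (simp add: a_def prob_space zero_less_mult_iff)
  have G_null: "null_in_probability P G"
  proof (rule P.null_in_probability_of_L1)
    show "\<forall>\<^sub>F n in sequentially. integrable P (G n) \<and> P.expectation (\<lambda>\<omega>. \<bar>G n \<omega>\<bar>) \<le> (49 + \<epsilon> n) / c * (1 / (real n * \<nu>m n))"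
      using eventually_ge_at_top[of "1::nat"]
    proof eventually_elim
      case (elim n)
      have nc: "0 < real n * c" using elim c by simp
      have int: "integrable P (G n)"
        unfolding G_def by (intro integrable_divide Bochner_Integration.integrable_sum Bochner_Integration.integrable_add Z_int[OF elim] R_int[OF elim])
      have "P.expectation (\<lambda>\<omega>. \<bar>G n \<omega>\<bar>) \<le> P.expectation (\<lambda>\<omega>. (\<Sum>r\<in>J n. \<bar>Z n r \<omega>\<bar> + \<bar>R n r \<omega>\<bar>) / (real n * c))"
      proof (rule integral_mono)
        show "integrable P (\<lambda>\<omega>. (\<Sum>r\<in>J n. \<bar>Z n r \<omega>\<bar> + \<bar>R n r \<omega>\<bar>) / (real n * c))"
          by (intro integrable_divide Bochner_Integration.integrable_sum Bochner_Integration.integrable_add integrable_abs Z_int[OF elim] R_int[OF elim])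
        fix \<omega>
        have "\<bar>G n \<omega>\<bar> = \<bar>\<Sum>r\<in>J n. Z n r \<omega> + R n r \<omega>\<bar> / (real n * c)" using nc by (simp add: G_def abs_divide)
        also have "\<dots> \<le> (\<Sum>r\<in>J n. \<bar>Z n r \<omega>\<bar> + \<bar>R n r \<omega>\<bar>) / (real n * c)"
          using nc by (intro divide_right_mono order_trans[OF sum_abs] sum_mono abs_triangle_ineq) auto
        finally show "\<bar>G n \<omega>\<bar> \<le> (\<Sum>r\<in>J n. \<bar>Z n r \<omega>\<bar> + \<bar>R n r \<omega>\<bar>) / (real n * c)" .
      qed (rule integrable_abs[OF int])
      also have "\<dots> = (\<Sum>r\<in>J n. P.expectation (\<lambda>\<omega>. \<bar>Z n r \<omega>\<bar>) + P.expectation (\<lambda>\<omega>. \<bar>R n r \<omega>\<bar>)) / (real n * c)"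
        using Z_int[OF elim] R_int[OF elim] by simp
      also have "\<dots> \<le> (\<Sum>r\<in>J n. 49 + \<epsilon> n) / (real n * c)"
        using nc by (intro divide_right_mono sum_mono add_mono Z_abs[OF elim] R_abs[OF elim]) auto
      also have "\<dots> = real (card (J n)) * (49 + \<epsilon> n) / (real n * c)" by simp
      also have "\<dots> \<le> (1 / \<nu>m n) * (49 + \<epsilon> n) / (real n * c)"
      proof (intro divide_right_mono mult_right_mono)
        \<comment> \<open>The cells are disjoint, so there are at most \<open>1 / \<nu>m n\<close> of them.\<close>
        have "real (card (J n)) * \<nu>m n = (\<Sum>r\<in>J n. \<nu>m n)" by simp
        also have "\<dots> \<le> (\<Sum>r\<in>J n. measure \<nu> (I n r))" by (intro sum_mono \<nu>m_le)
        also have "\<dots> = prob (\<Union>r\<in>J n. I n r)"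
          by (rule finite_measure_finite_Union[symmetric]) (use J cell[OF elim] disj[OF elim] in auto)
        also have "\<dots> \<le> 1" by simp
        finally show "real (card (J n)) \<le> 1 / \<nu>m n" using \<nu>m_pos[OF elim] by (simp add: pos_le_divide_eq)
        show "0 \<le> 49 + \<epsilon> n" by (simp add: \<epsilon>_def)
      qed (use nc in auto)
      also have "\<dots> = (49 + \<epsilon> n) / c * (1 / (real n * \<nu>m n))" by simp
      finally show ?case using int by blast
    qed
    have "(\<lambda>n. (49 + \<epsilon> n) / c * (1 / (real n * \<nu>m n))) \<longlonglongrightarrow> (49 + 0) / c * 0"
      using c by (intro tendsto_intros \<epsilon>_lim real_tendsto_divide_at_top[OF tendsto_const n\<nu>]) auto
    then show "(\<lambda>n. (49 + \<epsilon> n) / c * (1 / (real n * \<nu>m n))) \<longlonglongrightarrow> 0" by simp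
  qed
  have tot_meas: "tot n \<in> borel_measurable P" if "1 \<le> n" for n
    unfolding tot_def by (rule strip_process.total_measurable[OF sp[OF that]])
  have H_null: "null_in_probability P H"
  proof (rule P.null_in_probabilityI)
    show "\<forall>\<^sub>F n in sequentially. H n \<in> borel_measurable P"
      using eventually_ge_at_top[of "1::nat"] unfolding H_def
      by eventually_elim (intro borel_measurable_diff borel_measurable_divide borel_measurable_const tot_meas)
    fix e :: real assume e: "0 < e"
    show "\<forall>\<^sub>F n in sequentially. P.prob {\<omega>\<in>space P. e \<le> \<bar>H n \<omega>\<bar>} \<le> (1 / ((e / a)\<^sup>2 * (c * a))) / real n"
      using eventually_ge_at_top[of "1::nat"]
    proof eventually_elim
      case (elim n)
      have nc: "0 < real n * c" using elim c by simp
      have "e \<le> \<bar>H n \<omega>\<bar> \<longleftrightarrow> e / a * (real n * c * a) \<le> \<bar>tot n \<omega> - real n * c * a\<bar>" for \<omega>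
      proof -
        have "H n \<omega> = (tot n \<omega> - real n * c * a) / (real n * c)" using nc elim c by (simp add: H_def diff_divide_distrib)
        then have "\<bar>H n \<omega>\<bar> = \<bar>tot n \<omega> - real n * c * a\<bar> / (real n * c)" using nc by (simp add: abs_divide)
        moreover have "e / a * (real n * c * a) = e * (real n * c)" using a_pos by simp
        ultimately show ?thesis using nc by (simp only: pos_le_divide_eq)
      qed
      then have "P.prob {\<omega>\<in>space P. e \<le> \<bar>H n \<omega>\<bar>} \<le> 1 / ((e / a)\<^sup>2 * (real n * c * a))"
        using strip_process.total_concentration[OF sp[OF elim], of "e / a"] e a_pos
        by (simp only: tot_def a_def[symmetric] zero_less_divide_iff simp_thms)
      also have "\<dots> = (1 / ((e / a)\<^sup>2 * (c * a))) / real n" by (simp add: mult_ac)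
      finally show ?case .
    qed
    show "(\<lambda>n. (1 / ((e / a)\<^sup>2 * (c * a))) / real n) \<longlonglongrightarrow> 0" by (rule lim_const_over_n)
  qed
  have ratio_null: "null_in_probability P (\<lambda>n \<omega>. (a + H n \<omega>) / (a + G n \<omega>) - 1)"
    by (rule P.ratio_null_in_probability[OF G_null H_null a_pos])

  define V where "V n \<omega> = (\<chi> j. real n * intensity_estimator \<nu> f n (k n) (I n) (N n \<omega>) (K n \<omega>) (X n \<omega>) (Y n \<omega>)
      / weight_norm (k n) (\<kappa> n) (x j) *
      (edge_estimator \<nu> f (k n) (I n) (\<kappa> n) (N n \<omega>) (K n \<omega>) (X n \<omega>) (Y n \<omega>) (x j) - f (x j)))" for n \<omega>
  have V_eq: "V n \<omega> $ j = (a + H n \<omega>) / (a + G n \<omega>) * T n j \<omega>" if n: "1 \<le> n" and \<omega>: "\<omega> \<in> space P" for n \<omega> j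
  proof -
    define \<theta> where "\<theta> = real n * c"
    have \<theta>: "0 < \<theta>" using n c by (simp add: \<theta>_def)
    define \<kappa>n where "\<kappa>n = weight_norm (k n) (\<kappa> n) (x j)"
    have \<kappa>n: "0 < \<kappa>n" unfolding \<kappa>n_def by (rule assms(13)[OF n assms(25)])
    note ce = corr_eq[OF n _ \<omega>, folded \<theta>_def]
    have "\<theta> * area_estimator \<nu> f (k n) (I n) (N n \<omega>) (K n \<omega>) (X n \<omega>) (Y n \<omega>) = (\<Sum>r\<in>J n. \<theta> * measure \<nu> (I n r) * corr n r \<omega>)"
      by (simp only: area_estimator_def corr_def J_def sum_distrib_left mult.assoc)
    also have "\<dots> = (\<Sum>r\<in>J n. \<mu> n r + (Z n r \<omega> + R n r \<omega>))" by (rule sum.cong[OF refl]) (simp add: ce)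
    also have "\<dots> = (\<Sum>r\<in>J n. \<mu> n r) + \<theta> * G n \<omega>" using \<theta> by (simp add: sum.distrib G_def \<theta>_def[symmetric])
    also have "(\<Sum>r\<in>J n. \<mu> n r) = \<theta> * a"
    proof -
      have "(\<Sum>r\<in>J n. \<mu> n r) = (\<Sum>r\<in>J n. strip_process.mass \<nu> f \<theta> (I n r))"
        using \<mu>_eq[OF n] strip_process.mass_eq_cell_mean[OF sp[OF n]] cell[OF n] by (intro sum.cong refl) (simp add: \<theta>_def)
      also have "\<dots> = \<theta> * a"
        unfolding \<theta>_def a_def by (rule strip_process.mass_partition[OF sp[OF n] J]) (use cell[OF n] disj[OF n] in auto)
      finally show ?thesis .
    qed
    finally have area: "area_estimator \<nu> f (k n) (I n) (N n \<omega>) (K n \<omega>) (X n \<omega>) (Y n \<omega>) = a + G n \<omega>"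
      using \<theta> by (simp add: distrib_left[symmetric])
    have tot: "tot n \<omega> = \<theta> * (a + H n \<omega>)" using \<theta> by (simp add: H_def \<theta>_def[symmetric])
    have int: "real n * intensity_estimator \<nu> f n (k n) (I n) (N n \<omega>) (K n \<omega>) (X n \<omega>) (Y n \<omega>) = \<theta> * ((a + H n \<omega>) / (a + G n \<omega>))"
      using n unfolding intensity_estimator_def area tot_def[symmetric] tot by simp
    have "\<theta> / \<kappa>n * (edge_estimator \<nu> f (k n) (I n) (\<kappa> n) (N n \<omega>) (K n \<omega>) (X n \<omega>) (Y n \<omega>) (x j) - f (x j)) = T n j \<omega>"
    proof -
      have w: "w n r (x j) = \<kappa> n r (x j) / \<kappa>n" for r by (simp add: w_def norm_weight_def \<kappa>n_def)
      have "\<theta> / \<kappa>n * edge_estimator \<nu> f (k n) (I n) (\<kappa> n) (N n \<omega>) (K n \<omega>) (X n \<omega>) (Y n \<omega>) (x j) =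
          (\<Sum>r\<in>J n. w n r (x j) * (\<theta> * measure \<nu> (I n r) * corr n r \<omega>))"
        unfolding edge_estimator_def corr_def[symmetric] J_def[symmetric] sum_distrib_left w
        by (intro sum.cong refl) (simp add: mult_ac)
      also have "\<dots> = (\<Sum>r\<in>J n. w n r (x j) * (Z n r \<omega> + R n r \<omega>) + w n r (x j) * \<mu> n r)"
      proof (rule sum.cong[OF refl])
        fix r assume r: "r \<in> J n"
        show "w n r (x j) * (\<theta> * measure \<nu> (I n r) * corr n r \<omega>) = w n r (x j) * (Z n r \<omega> + R n r \<omega>) + w n r (x j) * \<mu> n r"
          unfolding ce[OF r] by (simp add: algebra_simps)
      qed
      also have "\<dots> = (\<Sum>r\<in>J n. w n r (x j) * (Z n r \<omega> + R n r \<omega>)) + (\<Sum>r\<in>J n. w n r (x j) * \<mu> n r)"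
        by (rule sum.distrib)
      also have "(\<Sum>r\<in>J n. w n r (x j) * \<mu> n r) = \<theta> / \<kappa>n * (\<Sum>r\<in>J n. measure \<nu> (I n r) * \<kappa> n r (x j) * cell_mean \<nu> f (I n r))"
        unfolding sum_distrib_left by (intro sum.cong refl) (simp add: \<mu>_eq[OF n] w \<theta>_def mult_ac)
      finally show ?thesis
        by (simp add: right_diff_distrib T_def bias_def \<kappa>n_def[symmetric] \<theta>_def mult_ac)
    qed
    then have "(a + H n \<omega>) / (a + G n \<omega>) * T n j \<omega> = (a + H n \<omega>) / (a + G n \<omega>) * (\<theta> / \<kappa>n * (edge_estimator \<nu> f (k n) (I n) (\<kappa> n) (N n \<omega>) (K n \<omega>) (X n \<omega>) (Y n \<omega>) (x j) - f (x j)))"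
      by (simp only:)
    also have "\<dots> = V n \<omega> $ j" unfolding V_def vec_lambda_beta int \<kappa>n_def[symmetric] by (simp only: mult_ac times_divide_eq_left times_divide_eq_right)
    finally show ?thesis by (rule sym)
  qed
  have V_meas: "V n \<in> borel_measurable P" if n: "1 \<le> n" "G n \<in> borel_measurable P" "H n \<in> borel_measurable P" for n
  proof (rule borel_measurable_vec_components)
    fix j
    have "(\<lambda>\<omega>. (a + H n \<omega>) / (a + G n \<omega>) * T n j \<omega>) \<in> borel_measurable P"
      using n T_meas[OF n(1)] by (intro borel_measurable_times borel_measurable_divide borel_measurable_add borel_measurable_const)
    also have "?this \<longleftrightarrow> (\<lambda>\<omega>. V n \<omega> $ j) \<in> borel_measurable P"
      by (rule measurable_cong) (simp only: V_eq[OF n(1)])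
    finally show "(\<lambda>\<omega>. V n \<omega> $ j) \<in> borel_measurable P" .
  qed
  have V_meas_ev: "\<forall>\<^sub>F n in sequentially. V n \<in> borel_measurable P"
    using eventually_ge_at_top[of "1::nat"] null_in_probability_measurable[OF G_null] null_in_probability_measurable[OF H_null]
    by eventually_elim (rule V_meas)
  have "converges_in_distribution P V L"
  proof (rule levy_continuity_euclidean[OF assms(1) L_prob V_meas_ev])
    fix t :: "real^'p"
    define V' where "V' n \<omega> = (\<Sum>j\<in>UNIV. t $ j * ((a + H n \<omega>) / (a + G n \<omega>) * T n j \<omega>))" for n \<omega>
    have V': "t \<bullet> V n \<omega> = V' n \<omega>" if "1 \<le> n" "\<omega> \<in> space P" for n \<omega>
      by (simp add: inner_vec_def V'_def V_eq[OF that])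
    have T_ev: "\<forall>\<^sub>F n in sequentially. T n j \<in> borel_measurable P" for j
      using eventually_ge_at_top[of "1::nat"] by eventually_elim (rule T_meas)
    have V'_ev: "\<forall>\<^sub>F n in sequentially. V' n \<in> borel_measurable P"
      using eventually_ge_at_top[of "1::nat"] null_in_probability_measurable[OF G_null] null_in_probability_measurable[OF H_null]
    proof eventually_elim
      case (elim n)
      show ?case unfolding V'_def using elim T_meas[OF elim(1)]
        by (intro borel_measurable_sum borel_measurable_times borel_measurable_divide borel_measurable_add borel_measurable_const)
    qed
    have "(\<lambda>n. CLINT \<omega>|P. iexp (V' n \<omega>)) \<longlonglongrightarrow> complex_of_real (exp (- (t \<bullet> (S *v t)) / 2))"
    proof (rule P.char_limit_transfer[OF _ V'_ev _ T_char])
      have "V' n \<omega> - (\<Sum>j\<in>UNIV. t $ j * T n j \<omega>) = (\<Sum>j\<in>UNIV. t $ j * (((a + H n \<omega>) / (a + G n \<omega>) - 1) * T n j \<omega>))" for n \<omega>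
        unfolding V'_def sum_subtractf[symmetric] by (intro sum.cong refl) (simp only: left_diff_distrib right_diff_distrib mult_1)
      then show "null_in_probability P (\<lambda>n \<omega>. V' n \<omega> - (\<Sum>j\<in>UNIV. t $ j * T n j \<omega>))"
        by (simp only:) (intro P.null_in_probability_sum P.null_in_probability_cmult P.null_in_probability_mult_tight ratio_null T_ev T_tight finite)
      show "\<forall>\<^sub>F n in sequentially. (\<lambda>\<omega>. \<Sum>j\<in>UNIV. t $ j * T n j \<omega>) \<in> borel_measurable P"
        using eventually_ge_at_top[of "1::nat"] by eventually_elim (intro borel_measurable_sum borel_measurable_times borel_measurable_const T_meas)
    qed
    then have "(\<lambda>n. CLINT \<omega>|P. iexp (t \<bullet> V n \<omega>)) \<longlonglongrightarrow> complex_of_real (exp (- (t \<bullet> (S *v t)) / 2))"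
    proof (rule Lim_transform_eventually)
      show "\<forall>\<^sub>F n in sequentially. (CLINT \<omega>|P. iexp (V' n \<omega>)) = (CLINT \<omega>|P. iexp (t \<bullet> V n \<omega>))"
        using eventually_ge_at_top[of "1::nat"]
        by eventually_elim (rule Bochner_Integration.integral_cong[OF refl], simp only: V')
    qed
    then show "(\<lambda>n. CLINT \<omega>|P. iexp (t \<bullet> V n \<omega>)) \<longlonglongrightarrow> (CLINT z|L. iexp (t \<bullet> z))"
      by (simp only: char_centered_gaussian[OF L psd])
  qed
  then show ?thesis using L unfolding V_def[abs_def] S_def by blast
qed

end
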